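(* Let $k$ be an infinite field, let $d,n\in\mathbb{N}\cup\{0\}$, let $X$ be a finite type $k$-scheme, and let $V$ be a rank-$n$ vector bundle over $X$. If $V$ is generated by global sections, then there is an open subscheme $U$ of $X$ such that $\mathrm{codim}(X-U,X)>d$ and $V|_U$ is generated by $n+d$ global sections (over $U$). In particular, if $\dim X=d$, then $V$ is generated by $n+d$ global sections.
   Context: A vector bundle is a locally free $\mathcal{O}_X$-module of finite rank. Sections $m_1,\dots,m_t\in\Gamma(X,\mathcal{M})$ generate an $\mathcal{O}_X$-module $\mathcal{M}$ if the map $\mathcal{O}_X^t\to\mathcal{M}$, $(a_i)\mapsto\sum a_im_i$, is surjective (as a map of sheaves). Codimension: if $X$ is irreducible and $Y\subseteq X$ closed irreducible, $\mathrm{codim}(Y,X)$ is the supremum of the $c$ for which there is a chain of closed irreducible subsets $Y=Y_0\subsetneq\dots\subsetneq Y_c\subseteq X$. In general, for $Y$ closed in $X$, $\mathrm{codim}(Y,X)$ is the infimum of $\mathrm{codim}(Y',X')$ with $X'$ ranging over the irreducible components of $X$ and $Y'$ over the irreducible components of $Y\cap X'$; $\mathrm{codim}(\emptyset,X)=\infty$. *)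

theory Defs
  imports "HOL-Analysis.Abstract_Topology" "HOL-Library.Extended_Nat"
    "HOL-Library.Extended_Real" "HOL-Algebra.QuotRing" "HOL-Algebra.Generated_Rings"
begin

section \<open>Irreducibility, codimension and dimension\<close>

text \<open>Irreducibility of the subspace \<open>Y\<close>, expressed with closed sets of the ambient space.\<close>

definition irreducible_in :: "'a topology \<Rightarrow> 'a set \<Rightarrow> bool" where
  "irreducible_in T Y \<longleftrightarrow> Y \<noteq> {} \<and> Y \<subseteq> topspace T \<and>
     (\<forall>A B. closedin T A \<and> closedin T B \<and> Y \<subseteq> A \<union> B \<longrightarrow> Y \<subseteq> A \<or> Y \<subseteq> B)"

definition irreducible_components :: "'a topology \<Rightarrow> 'a set \<Rightarrow> 'a set set" where
  "irreducible_components T Z =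
     {Y. Y \<subseteq> Z \<and> irreducible_in T Y \<and>
         (\<forall>Y'. Y \<subseteq> Y' \<and> Y' \<subseteq> Z \<and> irreducible_in T Y' \<longrightarrow> Y' = Y)}"

definition irreducible_chain :: "'a topology \<Rightarrow> nat \<Rightarrow> (nat \<Rightarrow> 'a set) \<Rightarrow> bool" where
  "irreducible_chain T c C \<longleftrightarrow>
     (\<forall>i\<le>c. closedin T (C i) \<and> irreducible_in T (C i)) \<and> (\<forall>i<c. C i \<subset> C (Suc i))"

definition codim_irreducible :: "'a set \<Rightarrow> 'a topology \<Rightarrow> enat" where
  "codim_irreducible Y T = Sup {enat c | c. \<exists>C. irreducible_chain T c C \<and> C 0 = Y}"

text \<open>The infimum of the empty set in \<^typ>\<open>enat\<close> is \<open>\<infinity>\<close>, so the empty set has codimension \<open>\<infinity>\<close>.\<close>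

definition codim :: "'a set \<Rightarrow> 'a topology \<Rightarrow> enat" where
  "codim Y T = Inf {codim_irreducible Y' (subtopology T X') | X' Y'.
     X' \<in> irreducible_components T (topspace T) \<and> Y' \<in> irreducible_components T (Y \<inter> X')}"

text \<open>Valued in \<^typ>\<open>ereal\<close> so that the empty space has dimension \<open>-\<infinity>\<close>, not \<open>0\<close>.\<close>

definition krull_dim :: "'a topology \<Rightarrow> ereal" where
  "krull_dim T = Sup {ereal (real c) | c. \<exists>C. irreducible_chain T c C}"


section \<open>Sheaves and ringed spaces\<close>

text \<open>
  \<open>F U\<close> is the set of sections over \<open>U\<close> and \<open>r U V\<close> the restriction from \<open>U\<close> to \<open>V \<subseteq> U\<close>;
  nothing is required of \<open>F\<close> and \<open>r\<close> on sets that are not open. Taking the empty cover of the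
  empty set shows that \<open>F {}\<close> is a singleton.
\<close>

definition sheaf :: "'a topology \<Rightarrow> ('a set \<Rightarrow> 's set) \<Rightarrow> ('a set \<Rightarrow> 'a set \<Rightarrow> 's \<Rightarrow> 's) \<Rightarrow> bool" where
  "sheaf T F r \<longleftrightarrow>
     (\<forall>U V. openin T U \<and> openin T V \<and> V \<subseteq> U \<longrightarrow> r U V \<in> F U \<rightarrow> F V) \<and>
     (\<forall>U. openin T U \<longrightarrow> (\<forall>s\<in>F U. r U U s = s)) \<and>
     (\<forall>U V W. openin T U \<and> openin T V \<and> openin T W \<and> W \<subseteq> V \<and> V \<subseteq> U \<longrightarrow>
        (\<forall>s\<in>F U. r V W (r U V s) = r U W s)) \<and>
     (\<forall>\<U> s. (\<forall>V\<in>\<U>. openin T V \<and> s V \<in> F V) \<and>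
        (\<forall>V\<in>\<U>. \<forall>W\<in>\<U>. r V (V \<inter> W) (s V) = r W (V \<inter> W) (s W)) \<longrightarrow>
        (\<exists>!t. t \<in> F (\<Union>\<U>) \<and> (\<forall>V\<in>\<U>. r (\<Union>\<U>) V t = s V)))"

record ('a, 'r) ringed =
  top_of :: "'a topology"
  fun_ring :: "'a set \<Rightarrow> 'r ring"
  fun_res :: "'a set \<Rightarrow> 'a set \<Rightarrow> 'r \<Rightarrow> 'r"

abbreviation points :: "('a, 'r) ringed \<Rightarrow> 'a set" where
  "points X \<equiv> topspace (top_of X)"

definition ringed_space :: "('a, 'r) ringed \<Rightarrow> bool" where
  "ringed_space X \<longleftrightarrow>
     sheaf (top_of X) (\<lambda>U. carrier (fun_ring X U)) (fun_res X) \<and>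
     (\<forall>U. openin (top_of X) U \<longrightarrow> cring (fun_ring X U)) \<and>
     (\<forall>U V. openin (top_of X) U \<and> openin (top_of X) V \<and> V \<subseteq> U \<longrightarrow>
        fun_res X U V \<in> ring_hom (fun_ring X U) (fun_ring X V))"

text \<open>
  For \<open>U\<close> open, the open sets of \<open>U\<close> are the open sets of \<open>X\<close> contained in \<open>U\<close>, so the sections
  and restriction maps need not be changed.
\<close>

definition open_subspace :: "('a, 'r) ringed \<Rightarrow> 'a set \<Rightarrow> ('a, 'r) ringed" where
  "open_subspace X U = X\<lparr>top_of := subtopology (top_of X) U\<rparr>"

definition ringed_space_iso ::
  "('a, 'r) ringed \<Rightarrow> ('b, 's) ringed \<Rightarrow> ('a \<Rightarrow> 'b) \<Rightarrow> ('b set \<Rightarrow> 's \<Rightarrow> 'r) \<Rightarrow> bool" where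
  "ringed_space_iso X Y f \<theta> \<longleftrightarrow>
     homeomorphic_map (top_of X) (top_of Y) f \<and>
     (\<forall>V. openin (top_of Y) V \<longrightarrow>
        \<theta> V \<in> ring_iso (fun_ring Y V) (fun_ring X (f -` V \<inter> points X))) \<and>
     (\<forall>V W. openin (top_of Y) V \<and> openin (top_of Y) W \<and> W \<subseteq> V \<longrightarrow>
        (\<forall>s\<in>carrier (fun_ring Y V).
           \<theta> W (fun_res Y V W s) = fun_res X (f -` V \<inter> points X) (f -` W \<inter> points X) (\<theta> V s)))"


section \<open>The spectrum of a commutative ring\<close>

text \<open>The fraction \<open>a / s\<close>, as an equivalence class of pairs, and the ring of such fractions.\<close>

definition fraction :: "'r ring \<Rightarrow> 'r set \<Rightarrow> 'r \<Rightarrow> 'r \<Rightarrow> ('r \<times> 'r) set" where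
  "fraction A S a s = {(b, t). b \<in> carrier A \<and> t \<in> S \<and>
     (\<exists>u\<in>S. u \<otimes>\<^bsub>A\<^esub> (t \<otimes>\<^bsub>A\<^esub> a) = u \<otimes>\<^bsub>A\<^esub> (s \<otimes>\<^bsub>A\<^esub> b))}"

definition localization :: "'r ring \<Rightarrow> 'r set \<Rightarrow> ('r \<times> 'r) set ring" where
  "localization A S = \<lparr>
     carrier = {fraction A S a s | a s. a \<in> carrier A \<and> s \<in> S},
     monoid.mult = (\<lambda>x y. \<Union>(a, s)\<in>x. \<Union>(b, t)\<in>y. fraction A S (a \<otimes>\<^bsub>A\<^esub> b) (s \<otimes>\<^bsub>A\<^esub> t)),
     one = fraction A S \<one>\<^bsub>A\<^esub> \<one>\<^bsub>A\<^esub>,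
     zero = fraction A S \<zero>\<^bsub>A\<^esub> \<one>\<^bsub>A\<^esub>,
     add = (\<lambda>x y. \<Union>(a, s)\<in>x. \<Union>(b, t)\<in>y.
              fraction A S (t \<otimes>\<^bsub>A\<^esub> a \<oplus>\<^bsub>A\<^esub> s \<otimes>\<^bsub>A\<^esub> b) (s \<otimes>\<^bsub>A\<^esub> t))\<rparr>"

definition zariski_open :: "'r ring \<Rightarrow> 'r set set \<Rightarrow> bool" where
  "zariski_open A U \<longleftrightarrow> (\<exists>E\<subseteq>carrier A. U = {p. primeideal p A \<and> \<not> E \<subseteq> p})"

definition zariski_topology :: "'r ring \<Rightarrow> 'r set topology" where
  "zariski_topology A = topology (zariski_open A)"

lemma istopology_zariski_open: "istopology (zariski_open A)"
proof -
  have "zariski_open A (S \<inter> T)" if S: "zariski_open A S" and T: "zariski_open A T" for S T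
  proof -
    obtain E where E: "E \<subseteq> carrier A" "S = {p. primeideal p A \<and> \<not> E \<subseteq> p}"
      using S unfolding zariski_open_def by blast
    obtain F where F: "F \<subseteq> carrier A" "T = {p. primeideal p A \<and> \<not> F \<subseteq> p}"
      using T unfolding zariski_open_def by blast
    let ?G = "{x. \<exists>e\<in>E. \<exists>f\<in>F. x = e \<otimes>\<^bsub>A\<^esub> f \<and> e \<otimes>\<^bsub>A\<^esub> f \<in> carrier A}"
    have "\<not> ?G \<subseteq> p \<longleftrightarrow> \<not> E \<subseteq> p \<and> \<not> F \<subseteq> p" if p: "primeideal p A" for p
    proof -
      interpret primeideal p A by (rule p)
      show ?thesis
      proof
        assume "\<not> ?G \<subseteq> p"
        then obtain e f where "e \<in> E" "f \<in> F" "e \<otimes>\<^bsub>A\<^esub> f \<notin> p" by blast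
        then show "\<not> E \<subseteq> p \<and> \<not> F \<subseteq> p"
          using E(1) F(1) I_l_closed I_r_closed by blast
      next
        assume "\<not> E \<subseteq> p \<and> \<not> F \<subseteq> p"
        then obtain e f where ef: "e \<in> E" "e \<notin> p" "f \<in> F" "f \<notin> p" by blast
        then have "e \<in> carrier A" "f \<in> carrier A" using E(1) F(1) by auto
        then have "e \<otimes>\<^bsub>A\<^esub> f \<notin> p" "e \<otimes>\<^bsub>A\<^esub> f \<in> carrier A"
          using I_prime ef by auto
        then show "\<not> ?G \<subseteq> p" using ef by blast
      qed
    qed
    then have "S \<inter> T = {p. primeideal p A \<and> \<not> ?G \<subseteq> p}"
      using E(2) F(2) by blast
    moreover have "?G \<subseteq> carrier A" by blast
    ultimately show ?thesis unfolding zariski_open_def by blast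
  qed
  moreover have "zariski_open A (\<Union>K)" if K: "\<forall>S\<in>K. zariski_open A S" for K
  proof -
    have "\<forall>S\<in>K. \<exists>E. E \<subseteq> carrier A \<and> S = {p. primeideal p A \<and> \<not> E \<subseteq> p}"
      using K unfolding zariski_open_def by blast
    then obtain E where E: "\<And>S. S \<in> K \<Longrightarrow> E S \<subseteq> carrier A"
        "\<And>S. S \<in> K \<Longrightarrow> S = {p. primeideal p A \<and> \<not> E S \<subseteq> p}"
      by metis
    have "\<Union>K = {p. primeideal p A \<and> \<not> (\<Union>S\<in>K. E S) \<subseteq> p}" using E(2) by blast
    moreover have "(\<Union>S\<in>K. E S) \<subseteq> carrier A" using E(1) by blast
    ultimately show ?thesis unfolding zariski_open_def by blast
  qed
  ultimately show ?thesis unfolding istopology_def by blast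
qed

lemma openin_zariski_topology: "openin (zariski_topology A) = zariski_open A"
  unfolding zariski_topology_def by (rule topology_inverse'[OF istopology_zariski_open])

text \<open>
  Sections over \<open>U\<close> are the families of elements of the local rings at the points of \<open>U\<close> that are
  locally given by one fraction of elements of \<open>A\<close>.
\<close>

definition spec_sections :: "'r ring \<Rightarrow> 'r set set \<Rightarrow> ('r set \<Rightarrow> ('r \<times> 'r) set) set" where
  "spec_sections A U =
     {s \<in> \<Pi>\<^sub>E p\<in>U. carrier (localization A (carrier A - p)).
        \<forall>p\<in>U. \<exists>V a f. zariski_open A V \<and> p \<in> V \<and> V \<subseteq> U \<and> a \<in> carrier A \<and> f \<in> carrier A \<and>
          (\<forall>q\<in>V. f \<notin> q \<and> s q = fraction A (carrier A - q) a f)}"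

definition Spec :: "'r ring \<Rightarrow> ('r set, 'r set \<Rightarrow> ('r \<times> 'r) set) ringed" where
  "Spec A = \<lparr>
     top_of = zariski_topology A,
     fun_ring = (\<lambda>U. \<lparr>
       carrier = spec_sections A U,
       monoid.mult = (\<lambda>s t. \<lambda>p\<in>U. s p \<otimes>\<^bsub>localization A (carrier A - p)\<^esub> t p),
       one = (\<lambda>p\<in>U. \<one>\<^bsub>localization A (carrier A - p)\<^esub>),
       zero = (\<lambda>p\<in>U. \<zero>\<^bsub>localization A (carrier A - p)\<^esub>),
       add = (\<lambda>s t. \<lambda>p\<in>U. s p \<oplus>\<^bsub>localization A (carrier A - p)\<^esub> t p)\<rparr>),
     fun_res = (\<lambda>U V s. restrict s V)\<rparr>"


section \<open>Schemes of finite type over a field\<close>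

text \<open>
  A ring whose spectrum is isomorphic to \<open>X\<close> is isomorphic to the ring of global functions of \<open>X\<close>,
  so it is no restriction that \<open>A\<close> has elements of the type of the sections of \<open>X\<close>.
\<close>

definition affine_scheme :: "('a, 'r) ringed \<Rightarrow> bool" where
  "affine_scheme X \<longleftrightarrow> ringed_space X \<and>
     (\<exists>(A :: 'r ring) f \<theta>. cring A \<and> ringed_space_iso X (Spec A) f \<theta>)"

text \<open>
  A ringed space locally isomorphic to spectra is locally ringed, and an isomorphism of ringed
  spaces is local on stalks, so neither has to be mentioned.
\<close>

definition is_scheme :: "('a, 'r) ringed \<Rightarrow> bool" where
  "is_scheme X \<longleftrightarrow> ringed_space X \<and>
     (\<forall>x\<in>points X. \<exists>U. openin (top_of X) U \<and> x \<in> U \<and> affine_scheme (open_subspace X U))"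

text \<open>
  A scheme over \<open>k\<close> is a scheme whose rings of functions are \<open>k\<close>-algebras, compatibly with
  restriction. Such a structure, equivalently a morphism to the spectrum of \<open>k\<close>, is given by the
  homomorphism \<open>\<phi>\<close> from \<open>k\<close> to the ring of global functions.
\<close>

definition scheme_over :: "'k ring \<Rightarrow> ('a, 'r) ringed \<Rightarrow> ('k \<Rightarrow> 'r) \<Rightarrow> bool" where
  "scheme_over k X \<phi> \<longleftrightarrow> is_scheme X \<and> \<phi> \<in> ring_hom k (fun_ring X (points X))"

definition fin_gen_algebra :: "'k ring \<Rightarrow> 'r ring \<Rightarrow> ('k \<Rightarrow> 'r) \<Rightarrow> bool" where
  "fin_gen_algebra k B \<phi> \<longleftrightarrow>
     (\<exists>S\<subseteq>carrier B. finite S \<and> generate_ring B (\<phi> ` carrier k \<union> S) = carrier B)"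

definition finite_type_scheme :: "'k ring \<Rightarrow> ('a, 'r) ringed \<Rightarrow> ('k \<Rightarrow> 'r) \<Rightarrow> bool" where
  "finite_type_scheme k X \<phi> \<longleftrightarrow> scheme_over k X \<phi> \<and> compact_space (top_of X) \<and>
     (\<forall>x\<in>points X. \<exists>U. openin (top_of X) U \<and> x \<in> U \<and> affine_scheme (open_subspace X U) \<and>
        fin_gen_algebra k (fun_ring X U) (fun_res X (points X) U \<circ> \<phi>))"


section \<open>Sheaves of modules and vector bundles\<close>

record ('a, 'r, 'm) sheaf_mod =
  sec :: "'a set \<Rightarrow> ('r, 'm) module"
  sec_res :: "'a set \<Rightarrow> 'a set \<Rightarrow> 'm \<Rightarrow> 'm"

definition module_sheaf :: "('a, 'r) ringed \<Rightarrow> ('a, 'r, 'm) sheaf_mod \<Rightarrow> bool" where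
  "module_sheaf X M \<longleftrightarrow>
     sheaf (top_of X) (\<lambda>U. carrier (sec M U)) (sec_res M) \<and>
     (\<forall>U. openin (top_of X) U \<longrightarrow> Module.module (fun_ring X U) (sec M U)) \<and>
     (\<forall>U V. openin (top_of X) U \<and> openin (top_of X) V \<and> V \<subseteq> U \<longrightarrow>
        (\<forall>x\<in>carrier (sec M U). \<forall>y\<in>carrier (sec M U).
           sec_res M U V (x \<oplus>\<^bsub>sec M U\<^esub> y) = sec_res M U V x \<oplus>\<^bsub>sec M V\<^esub> sec_res M U V y) \<and>
        (\<forall>a\<in>carrier (fun_ring X U). \<forall>x\<in>carrier (sec M U).
           sec_res M U V (a \<odot>\<^bsub>sec M U\<^esub> x) = fun_res X U V a \<odot>\<^bsub>sec M V\<^esub> sec_res M U V x))"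

text \<open>
  As with \<^const>\<open>open_subspace\<close>, the restriction of \<open>M\<close> to an open \<open>U\<close> is \<open>M\<close> itself, regarded
  as a sheaf of modules on \<open>open_subspace X U\<close>.
\<close>

definition module_sheaf_hom ::
  "('a, 'r) ringed \<Rightarrow> ('a, 'r, 'm) sheaf_mod \<Rightarrow> ('a, 'r, 'n) sheaf_mod \<Rightarrow> ('a set \<Rightarrow> 'm \<Rightarrow> 'n) \<Rightarrow> bool"
  where
  "module_sheaf_hom X M N \<phi> \<longleftrightarrow>
     (\<forall>U. openin (top_of X) U \<longrightarrow>
        \<phi> U \<in> carrier (sec M U) \<rightarrow> carrier (sec N U) \<and>
        (\<forall>x\<in>carrier (sec M U). \<forall>y\<in>carrier (sec M U).
           \<phi> U (x \<oplus>\<^bsub>sec M U\<^esub> y) = \<phi> U x \<oplus>\<^bsub>sec N U\<^esub> \<phi> U y) \<and>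
        (\<forall>a\<in>carrier (fun_ring X U). \<forall>x\<in>carrier (sec M U).
           \<phi> U (a \<odot>\<^bsub>sec M U\<^esub> x) = a \<odot>\<^bsub>sec N U\<^esub> \<phi> U x)) \<and>
     (\<forall>U V. openin (top_of X) U \<and> openin (top_of X) V \<and> V \<subseteq> U \<longrightarrow>
        (\<forall>x\<in>carrier (sec M U). \<phi> V (sec_res M U V x) = sec_res N U V (\<phi> U x)))"

definition module_sheaf_iso ::
  "('a, 'r) ringed \<Rightarrow> ('a, 'r, 'm) sheaf_mod \<Rightarrow> ('a, 'r, 'n) sheaf_mod \<Rightarrow> ('a set \<Rightarrow> 'm \<Rightarrow> 'n) \<Rightarrow> bool"
  where
  "module_sheaf_iso X M N \<phi> \<longleftrightarrow> module_sheaf_hom X M N \<phi> \<and>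
     (\<forall>U. openin (top_of X) U \<longrightarrow> bij_betw (\<phi> U) (carrier (sec M U)) (carrier (sec N U)))"

text \<open>Surjectivity as a map of sheaves: every section is locally in the image.\<close>

definition sheaf_surjective ::
  "('a, 'r) ringed \<Rightarrow> ('a, 'r, 'm) sheaf_mod \<Rightarrow> ('a, 'r, 'n) sheaf_mod \<Rightarrow> ('a set \<Rightarrow> 'm \<Rightarrow> 'n) \<Rightarrow> bool"
  where
  "sheaf_surjective X M N \<phi> \<longleftrightarrow>
     (\<forall>U s x. openin (top_of X) U \<and> s \<in> carrier (sec N U) \<and> x \<in> U \<longrightarrow>
        (\<exists>V. openin (top_of X) V \<and> x \<in> V \<and> V \<subseteq> U \<and>
             sec_res N U V s \<in> \<phi> V ` carrier (sec M V)))"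

text \<open>
  The fields \<open>mult\<close> and \<open>one\<close>, which the record type for modules inherits from rings, play no role
  in \<^const>\<open>Module.module\<close>.
\<close>

definition free_module :: "'r ring \<Rightarrow> nat \<Rightarrow> ('r, nat \<Rightarrow> 'r) module" where
  "free_module R n = \<lparr>
     carrier = {..<n} \<rightarrow>\<^sub>E carrier R,
     monoid.mult = (\<lambda>a b. \<lambda>i\<in>{..<n}. a i \<otimes>\<^bsub>R\<^esub> b i),
     one = (\<lambda>i\<in>{..<n}. \<one>\<^bsub>R\<^esub>),
     zero = (\<lambda>i\<in>{..<n}. \<zero>\<^bsub>R\<^esub>),
     add = (\<lambda>a b. \<lambda>i\<in>{..<n}. a i \<oplus>\<^bsub>R\<^esub> b i),
     smult = (\<lambda>c a. \<lambda>i\<in>{..<n}. c \<otimes>\<^bsub>R\<^esub> a i)\<rparr>"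

definition free_sheaf :: "('a, 'r) ringed \<Rightarrow> nat \<Rightarrow> ('a, 'r, nat \<Rightarrow> 'r) sheaf_mod" where
  "free_sheaf X n = \<lparr>
     sec = (\<lambda>U. free_module (fun_ring X U) n),
     sec_res = (\<lambda>U V a. \<lambda>i\<in>{..<n}. fun_res X U V (a i))\<rparr>"

definition vector_bundle :: "('a, 'r) ringed \<Rightarrow> ('a, 'r, 'm) sheaf_mod \<Rightarrow> nat \<Rightarrow> bool" where
  "vector_bundle X M n \<longleftrightarrow> module_sheaf X M \<and>
     (\<forall>x\<in>points X. \<exists>U \<phi>. openin (top_of X) U \<and> x \<in> U \<and>
        module_sheaf_iso (open_subspace X U) (free_sheaf (open_subspace X U) n) M \<phi>)"


section \<open>Generation by sections\<close>

abbreviation global_sections :: "('a, 'r) ringed \<Rightarrow> ('a, 'r, 'm) sheaf_mod \<Rightarrow> 'm set" where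
  "global_sections X M \<equiv> carrier (sec M (points X))"

text \<open>The map from the free sheaf of rank \<open>t\<close> to \<open>M\<close> sending \<open>a\<close> to \<open>\<Sum>i<t. a i \<cdot> m i\<close>.\<close>

definition sections_map ::
  "('a, 'r) ringed \<Rightarrow> ('a, 'r, 'm) sheaf_mod \<Rightarrow> nat \<Rightarrow> (nat \<Rightarrow> 'm) \<Rightarrow> 'a set \<Rightarrow> (nat \<Rightarrow> 'r) \<Rightarrow> 'm" where
  "sections_map X M t m U a = (\<Oplus>\<^bsub>sec M U\<^esub>i\<in>{..<t}. a i \<odot>\<^bsub>sec M U\<^esub> sec_res M (points X) U (m i))"

definition sections_generate ::
  "('a, 'r) ringed \<Rightarrow> ('a, 'r, 'm) sheaf_mod \<Rightarrow> nat \<Rightarrow> (nat \<Rightarrow> 'm) \<Rightarrow> bool" where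
  "sections_generate X M t m \<longleftrightarrow>
     m \<in> {..<t} \<rightarrow> global_sections X M \<and>
     sheaf_surjective X (free_sheaf X t) M (sections_map X M t m)"

definition generated_by_n_sections ::
  "('a, 'r) ringed \<Rightarrow> ('a, 'r, 'm) sheaf_mod \<Rightarrow> nat \<Rightarrow> bool" where
  "generated_by_n_sections X M t \<longleftrightarrow> (\<exists>m. sections_generate X M t m)"

text \<open>
  No bound on the number of global sections: the family of all of them generates \<open>M\<close>, that is,
  every section is locally a linear combination of finitely many global sections. (This is implied
  by \<open>\<exists>t. generated_by_n_sections X M t\<close>.)
\<close>

definition globally_generated :: "('a, 'r) ringed \<Rightarrow> ('a, 'r, 'm) sheaf_mod \<Rightarrow> bool" where
  "globally_generated X M \<longleftrightarrow>
     (\<forall>U s x. openin (top_of X) U \<and> s \<in> carrier (sec M U) \<and> x \<in> U \<longrightarrow>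
        (\<exists>V t m. openin (top_of X) V \<and> x \<in> V \<and> V \<subseteq> U \<and> m \<in> {..<t} \<rightarrow> global_sections X M \<and>
           sec_res M U V s \<in> sections_map X M t m V ` carrier (sec (free_sheaf X t) V)))"

end

theory Submission
  imports Defs
begin

text \<open>
  A family of global sections fails to generate \<open>V\<close> exactly on a degeneracy locus, and adding one
  sufficiently general section raises the codimension of this locus. Fix global sections
  \<open>t\<^sub>1, \<dots>, t\<^sub>m\<close> and call the corank at a point \<open>p\<close> the least number of further local
  sections that one has to add in order to generate \<open>V\<close> near \<open>p\<close>; it is at most \<open>n\<close> because
  \<open>V\<close> is free of rank \<open>n\<close> near \<open>p\<close>. Let \<open>D\<^sub>i\<close> be the closed set of points of corank \<open>> i\<close>.
  By induction on \<open>m\<close>, the sections can be chosen so that every closed irreducible subset of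
  \<open>D\<^sub>i\<close> inside a component \<open>X'\<close> of \<open>X\<close> starts a chain of length at least \<open>m + i + 1 - n\<close>
  in \<open>X'\<close> (lemma \<open>generic_sections\<close>). For \<open>m = n + d\<close> and \<open>i = 0\<close> this says that the locus where
  the sections do not generate has codimension \<open>> d\<close>; if \<open>X\<close> has dimension \<open>d\<close>, it must be empty.

  For the step, let \<open>Y\<close> be one of the finitely many closed irreducible sets of which \<open>D\<^sub>i \<inter> X'\<close> is
  the union. If \<open>Y \<subseteq> D\<^sub>i\<^sub>+\<^sub>1\<close>, the induction
  hypothesis for \<open>i + 1\<close> already gives the longer chain. Otherwise some point \<open>p\<close> of \<open>Y\<close> has corank
  exactly \<open>i + 1\<close>. A new section lowers the corank at \<open>p\<close> unless it lies in a certain proper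
  submodule of the module of all global sections (lemma \<open>generic_section\<close>). There are only finitely
  many \<open>Y\<close> to consider, and over an infinite field finitely many proper submodules do not exhaust a
  module (lemma \<open>avoid_submodules\<close>). A section avoiding all of them removes from \<open>D\<^sub>i\<close> a point of
  each such \<open>Y\<close>, so a closed irreducible subset of the new \<open>D\<^sub>i\<close> that lies in \<open>Y\<close> lies in it
  properly, and prolongs the chain of \<open>Y\<close> by one.

  Measuring the corank by how many generators are missing, rather than by the rank of a matrix over
  the residue field, keeps the linear algebra elementary: openness of the condition is immediate,
  and the effect of a new section is a Steinitz exchange over a local ring in which Nakayama's
  lemma amounts to inverting \<open>1 - b\<close> for a non-unit \<open>b\<close>.

  Two facts about schemes are needed. The functions at \<open>p\<close> that are not invertible near \<open>p\<close> form
  an ideal (lemmas \<open>scheme_locally_ringed\<close> and \<open>nonunits_ideal\<close>), which is read off from fractions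
  on a spectrum. The space of \<open>X\<close> is Noetherian (lemma \<open>finite_type_noetherian\<close>): in an affine chart \<open>U\<close> a closed set
  is determined by the ideal of functions on \<open>U\<close> that are non-units at all its points, and these
  ideals satisfy the ascending chain condition by Hilbert's basis theorem.
\<close>


section \<open>Noetherian spaces and chains of irreducible sets\<close>

definition noetherian_topology :: "'a topology \<Rightarrow> bool" where
  "noetherian_topology T \<longleftrightarrow>
     (\<forall>C :: nat \<Rightarrow> 'a set. (\<forall>i. closedin T (C i)) \<and> (\<forall>i. C (Suc i) \<subseteq> C i) \<longrightarrow>
        (\<exists>N. \<forall>i\<ge>N. C i = C N))"

lemma noetherian_topologyD:
  assumes "noetherian_topology T" and "\<forall>i. closedin T (C i)" and "\<forall>i. C (Suc i) \<subseteq> C i"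
  shows "\<exists>N. \<forall>i\<ge>N. C i = C N"
  using assms(1)[unfolded noetherian_topology_def, THEN spec, of C] assms(2,3) by simp

lemma noetherian_topology_wf:
  assumes "noetherian_topology T"
  shows "wf {(A, B). closedin T A \<and> closedin T B \<and> A \<subset> B}"
  unfolding wf_iff_no_infinite_down_chain
proof
  assume "\<exists>C. \<forall>i. (C (Suc i), C i) \<in> {(A, B). closedin T A \<and> closedin T B \<and> A \<subset> B}"
  then obtain C where C: "\<forall>i. closedin T (C (Suc i)) \<and> closedin T (C i) \<and> C (Suc i) \<subset> C i"
    by auto
  then have cl: "\<forall>i. closedin T (C i)" and dec: "\<forall>i. C (Suc i) \<subseteq> C i" by auto
  obtain N where N: "\<forall>i\<ge>N. C i = C N"
    using noetherian_topologyD[OF assms cl dec] by (elim exE)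
  have "C (Suc N) = C N" by (rule N[rule_format]) simp
  then show False using C by (metis psubset_eq)
qed

text \<open>
  By compactness finitely many Noetherian open sets cover the space, and a descending sequence is
  stationary as soon as its traces on all of them are.
\<close>
lemma noetherian_topology_local:
  assumes "compact_space T"
    and local: "\<And>x. x \<in> topspace T \<Longrightarrow>
      \<exists>U. openin T U \<and> x \<in> U \<and> noetherian_topology (subtopology T U)"
  shows "noetherian_topology T"
  unfolding noetherian_topology_def
proof (intro allI impI)
  fix C :: "nat \<Rightarrow> 'a set"
  assume "(\<forall>i. closedin T (C i)) \<and> (\<forall>i. C (Suc i) \<subseteq> C i)"
  then have C: "\<And>i. closedin T (C i)" "\<And>i. C (Suc i) \<subseteq> C i" by auto
  let ?\<U> = "{U. openin T U \<and> noetherian_topology (subtopology T U)}"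
  have "topspace T \<subseteq> \<Union>?\<U>" using local by blast
  then obtain \<F> where \<F>: "finite \<F>" "\<F> \<subseteq> ?\<U>" "topspace T \<subseteq> \<Union>\<F>"
    using assms(1) by (metis (no_types, lifting) compact_space_alt mem_Collect_eq)
  have "\<exists>N. \<forall>i\<ge>N. C i \<inter> U = C N \<inter> U" if "U \<in> \<F>" for U
  proof -
    have "closedin (subtopology T U) (C i \<inter> U)" for i
      using C(1) by (metis closedin_subtopology)
    moreover have "C (Suc i) \<inter> U \<subseteq> C i \<inter> U" for i using C(2) by blast
    moreover have "noetherian_topology (subtopology T U)" using that \<F>(2) by blast
    ultimately show ?thesis by (intro noetherian_topologyD[where C = "\<lambda>i. C i \<inter> U"] allI)
  qed
  then obtain N where N: "\<And>U i. U \<in> \<F> \<Longrightarrow> i \<ge> N U \<Longrightarrow> C i \<inter> U = C (N U) \<inter> U" by metis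
  (* 0 is inserted only so that the maximum exists when the cover is empty *)
  let ?N = "Max (insert 0 (N ` \<F>))"
  have "C i = C ?N" if i: "i \<ge> ?N" for i
  proof -
    have eq: "C i \<inter> U = C ?N \<inter> U" if U: "U \<in> \<F>" for U
    proof -
      have "N U \<le> ?N" using U \<F>(1) by simp
      then show ?thesis using N[OF U] i by (metis order_trans)
    qed
    have cover: "C j = (\<Union>U\<in>\<F>. C j \<inter> U)" for j
      using closedin_subset[OF C(1)[of j]] \<F>(3) by blast
    show ?thesis by (subst (1 2) cover) (simp only: eq cong: SUP_cong)
  qed
  then show "\<exists>N. \<forall>i\<ge>N. C i = C N" by (intro exI[of _ ?N] allI impI)
qed

text \<open>
  Noetherian induction: a nonempty reducible closed set is the union of two smaller ones.
\<close>
lemma noetherian_irreducible_decomposition: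
  assumes "noetherian_topology T" and "closedin T Z"
  shows "\<exists>F. finite F \<and> (\<forall>Y\<in>F. closedin T Y \<and> irreducible_in T Y) \<and> \<Union>F = Z"
  using assms(2)
proof (induction Z rule: wf_induct_rule[OF noetherian_topology_wf[OF assms(1)]])
  case (1 Z)
  consider "Z = {}" | "irreducible_in T Z" | "Z \<noteq> {}" "\<not> irreducible_in T Z" by blast
  then show ?case
  proof cases
    case 1
    then show ?thesis by (intro exI[of _ "{}"]) auto
  next
    case 2
    then show ?thesis using "1.prems" by (intro exI[of _ "{Z}"]) auto
  next
    case 3
    then obtain A B where AB: "closedin T A" "closedin T B" "Z \<subseteq> A \<union> B" "\<not> Z \<subseteq> A" "\<not> Z \<subseteq> B"
      using "1.prems" closedin_subset unfolding irreducible_in_def by meson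
    have cl: "closedin T (Z \<inter> A)" "closedin T (Z \<inter> B)"
      using AB "1.prems" by (auto intro: closedin_Int)
    obtain F where F: "finite F" "\<forall>Y\<in>F. closedin T Y \<and> irreducible_in T Y" "\<Union>F = Z \<inter> A"
      using "1.IH"[of "Z \<inter> A"] cl "1.prems" AB by blast
    obtain G where G: "finite G" "\<forall>Y\<in>G. closedin T Y \<and> irreducible_in T Y" "\<Union>G = Z \<inter> B"
      using "1.IH"[of "Z \<inter> B"] cl "1.prems" AB by blast
    show ?thesis using F G AB(3) by (intro exI[of _ "F \<union> G"]) auto
  qed
qed

lemma irreducible_in_finite_Union:
  assumes "irreducible_in T Y" and "finite F" and "\<And>A. A \<in> F \<Longrightarrow> closedin T A" and "Y \<subseteq> \<Union>F"
  shows "\<exists>A\<in>F. Y \<subseteq> A"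
  using assms(2-4)
proof (induction F rule: finite_induct)
  case empty
  then show ?case using assms(1) unfolding irreducible_in_def by blast
next
  case (insert A F)
  have "closedin T (\<Union>F)" using insert by (intro closedin_Union) auto
  then have "Y \<subseteq> A \<or> Y \<subseteq> \<Union>F"
    using assms(1) insert.prems unfolding irreducible_in_def by simp
  then show ?case using insert by auto
qed

text \<open>
  The closure of an irreducible set is irreducible, so a maximal irreducible subset of a closed set
  is its own closure.
\<close>
lemma irreducible_component_closed:
  assumes "closedin T Z" and "Y \<in> irreducible_components T Z"
  shows "closedin T Y"
proof -
  have Y: "Y \<subseteq> Z" "irreducible_in T Y"
    and max: "\<And>Y'. Y \<subseteq> Y' \<Longrightarrow> Y' \<subseteq> Z \<Longrightarrow> irreducible_in T Y' \<Longrightarrow> Y' = Y"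
    using assms(2) unfolding irreducible_components_def by auto
  have sub: "Y \<subseteq> T closure_of Y"
    using Y(2) by (simp add: irreducible_in_def closure_of_subset)
  have "irreducible_in T (T closure_of Y)"
    using Y(2) sub unfolding irreducible_in_def
    by (metis closedin_Un closure_of_minimal closure_of_subset_topspace order_trans subset_empty)
  moreover have "T closure_of Y \<subseteq> Z" using Y(1) assms(1) by (rule closure_of_minimal)
  ultimately show ?thesis using max sub by (metis closedin_closure_of)
qed

lemma finite_irreducible_components:
  assumes "noetherian_topology T"
  shows "finite (irreducible_components T (topspace T))"
proof -
  obtain F where F: "finite F" "\<And>Y. Y \<in> F \<Longrightarrow> closedin T Y \<and> irreducible_in T Y" "\<Union>F = topspace T"
    using noetherian_irreducible_decomposition[OF assms closedin_topspace] by blast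
  have "irreducible_components T (topspace T) \<subseteq> F"
  proof
    fix Y assume "Y \<in> irreducible_components T (topspace T)"
    then have Y: "irreducible_in T Y"
      and max: "\<And>Y'. Y \<subseteq> Y' \<Longrightarrow> Y' \<subseteq> topspace T \<Longrightarrow> irreducible_in T Y' \<Longrightarrow> Y' = Y"
      unfolding irreducible_components_def by auto
    obtain A where "A \<in> F" "Y \<subseteq> A"
      using irreducible_in_finite_Union[OF Y F(1)] F Y unfolding irreducible_in_def by metis
    then show "Y \<in> F" using max[of A] F closedin_subset by metis
  qed
  then show ?thesis using F(1) finite_subset by blast
qed

lemma in_irreducible_component:
  assumes "noetherian_topology T" and "p \<in> topspace T"
  shows "\<exists>Y\<in>irreducible_components T (topspace T). p \<in> Y"
proof -
  obtain F where F: "finite F" "\<And>Y. Y \<in> F \<Longrightarrow> closedin T Y \<and> irreducible_in T Y" "\<Union>F = topspace T"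
    using noetherian_irreducible_decomposition[OF assms(1) closedin_topspace] by blast
  have "finite {Y \<in> F. p \<in> Y}" "{Y \<in> F. p \<in> Y} \<noteq> {}" using F assms(2) by auto
  then obtain Y where Y: "Y \<in> F" "p \<in> Y" and max: "\<And>A. A \<in> F \<Longrightarrow> p \<in> A \<Longrightarrow> Y \<subseteq> A \<Longrightarrow> Y = A"
    by (metis (no_types, lifting) finite_has_maximal mem_Collect_eq)
  have "Y' = Y" if sub: "Y \<subseteq> Y'" and irr: "irreducible_in T Y'" for Y'
  proof -
    obtain A where "A \<in> F" "Y' \<subseteq> A"
      using irreducible_in_finite_Union[OF irr F(1)] F irr unfolding irreducible_in_def by metis
    then show ?thesis using max[of A] Y sub by blast
  qed
  then have "Y \<in> irreducible_components T (topspace T)"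
    using F(2)[OF Y(1)] closedin_subset unfolding irreducible_components_def by blast
  then show ?thesis using Y(2) by blast
qed

text \<open>
  Chains are kept in the whole space, and confined to a component \<open>X'\<close> by inclusion, so that they
  can be compared and lengthened without passing to subspaces.
\<close>
definition chain_from :: "'a topology \<Rightarrow> 'a set \<Rightarrow> 'a set \<Rightarrow> nat \<Rightarrow> bool" where
  "chain_from T X' Y c \<longleftrightarrow> (\<exists>C. irreducible_chain T c C \<and> C 0 = Y \<and> (\<forall>i\<le>c. C i \<subseteq> X'))"

lemma chain_from_le:
  assumes "chain_from T X' Y c" and "c' \<le> c"
  shows "chain_from T X' Y c'"
proof -
  obtain C where C: "irreducible_chain T c C" "C 0 = Y" "\<forall>i\<le>c. C i \<subseteq> X'"
    using assms(1) unfolding chain_from_def by (elim exE conjE)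
  then have "irreducible_chain T c' C" "\<forall>i\<le>c'. C i \<subseteq> X'"
    using assms(2) unfolding irreducible_chain_def by auto
  then show ?thesis using C(2) unfolding chain_from_def by (intro exI[of _ C]) simp
qed

lemma chain_from_0:
  "closedin T Y \<Longrightarrow> irreducible_in T Y \<Longrightarrow> Y \<subseteq> X' \<Longrightarrow> chain_from T X' Y 0"
  unfolding chain_from_def irreducible_chain_def by (intro exI[of _ "\<lambda>_. Y"]) auto

lemma chain_from_Suc:
  assumes "chain_from T X' Y c" and "closedin T Y'" and "irreducible_in T Y'" and "Y' \<subset> Y"
  shows "chain_from T X' Y' (Suc c)"
proof -
  obtain C where C: "irreducible_chain T c C" "C 0 = Y" "\<forall>i\<le>c. C i \<subseteq> X'"
    using assms(1) unfolding chain_from_def by (elim exE conjE)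
  let ?D = "case_nat Y' C"
  have "irreducible_chain T (Suc c) ?D"
    using C assms(2-4) unfolding irreducible_chain_def by (auto split: nat.split)
  moreover have "\<forall>i\<le>Suc c. ?D i \<subseteq> X'" using C assms(4) by (auto split: nat.split)
  ultimately show ?thesis unfolding chain_from_def by (intro exI[of _ ?D]) simp
qed

lemma codim_irreducible_ge:
  assumes "closedin T X'" and "chain_from T X' Y c"
  shows "enat c \<le> codim_irreducible Y (subtopology T X')"
proof -
  obtain C where C: "irreducible_chain T c C" "C 0 = Y" "\<forall>i\<le>c. C i \<subseteq> X'"
    using assms(2) unfolding chain_from_def by (elim exE conjE)
  have "irreducible_in (subtopology T X') A" if "irreducible_in T A" "A \<subseteq> X'" for A
    using that closedin_closed_subtopology[OF assms(1)] unfolding irreducible_in_def by auto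
  moreover have "closedin (subtopology T X') A" if "closedin T A" "A \<subseteq> X'" for A
    using that closedin_closed_subtopology[OF assms(1)] by auto
  ultimately have "irreducible_chain (subtopology T X') c C"
    using C(1,3) unfolding irreducible_chain_def by simp
  then have "\<exists>C. irreducible_chain (subtopology T X') c C \<and> C 0 = Y"
    using C(2) by (intro exI[of _ C]) simp
  then show ?thesis unfolding codim_irreducible_def by (intro Sup_upper CollectI exI[of _ c]) simp
qed

text \<open>
  Irreducible components are closed, so the sets over which the infimum defining the codimension is
  taken are among the closed irreducible subsets \<open>Y\<close> considered here.
\<close>
lemma codim_gt:
  assumes "closedin T Z"
    and "\<And>X' Y. X' \<in> irreducible_components T (topspace T) \<Longrightarrow> closedin T Y \<Longrightarrow>
      irreducible_in T Y \<Longrightarrow> Y \<subseteq> Z \<inter> X' \<Longrightarrow> chain_from T X' Y (Suc d)"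
  shows "codim Z T > enat d"
proof -
  have "enat (Suc d) \<le> codim_irreducible Y (subtopology T X')"
    if X': "X' \<in> irreducible_components T (topspace T)" and Y: "Y \<in> irreducible_components T (Z \<inter> X')"
    for X' Y
  proof (rule codim_irreducible_ge)
    show X'cl: "closedin T X'" using X' closedin_topspace irreducible_component_closed by blast
    then have "closedin T Y" using Y irreducible_component_closed assms(1) closedin_Int by blast
    then show "chain_from T X' Y (Suc d)"
      using assms(2)[OF X'] Y unfolding irreducible_components_def by blast
  qed
  then have "enat (Suc d) \<le> codim Z T" unfolding codim_def by (intro Inf_greatest) auto
  then show ?thesis by (meson enat_ord_simps(2) lessI less_le_trans)
qed

lemma krull_dim_ge:
  assumes "chain_from T X' Y c"
  shows "ereal (real c) \<le> krull_dim T"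
proof -
  obtain C where "irreducible_chain T c C" using assms unfolding chain_from_def by (elim exE conjE)
  then have "\<exists>C. irreducible_chain T c C" by (rule exI[of _ C])
  then show ?thesis unfolding krull_dim_def by (intro Sup_upper CollectI exI[of _ c]) simp
qed


section \<open>Hilbert's basis theorem\<close>

text \<open>
  Ideals of the subring with carrier \<open>K\<close>, as subsets of the ring \<open>B\<close>. Closure under negation
  follows from closure under multiplication by \<open>-1\<close>.
\<close>
definition sub_ideal :: "'r ring \<Rightarrow> 'r set \<Rightarrow> 'r set \<Rightarrow> bool" where
  "sub_ideal B K J \<longleftrightarrow> J \<subseteq> K \<and> \<zero>\<^bsub>B\<^esub> \<in> J \<and> (\<forall>x\<in>J. \<forall>y\<in>J. x \<oplus>\<^bsub>B\<^esub> y \<in> J) \<and>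
     (\<forall>r\<in>K. \<forall>x\<in>J. r \<otimes>\<^bsub>B\<^esub> x \<in> J)"

definition acc_ideals :: "'r ring \<Rightarrow> 'r set \<Rightarrow> bool" where
  "acc_ideals B K \<longleftrightarrow>
     (\<forall>J :: nat \<Rightarrow> 'r set. (\<forall>i. sub_ideal B K (J i)) \<longrightarrow> (\<forall>i. J i \<subseteq> J (Suc i)) \<longrightarrow>
        (\<exists>N. \<forall>i\<ge>N. J i = J N))"

lemma acc_idealsD:
  assumes "acc_ideals B K" and "\<And>i. sub_ideal B K (J i)" and "\<And>i. J i \<subseteq> J (Suc i)"
  shows "\<exists>N. \<forall>i\<ge>N. J i = J N"
  using assms(1)[unfolded acc_ideals_def, THEN spec, of J] assms(2,3) by (auto simp del: split_paired_All)

text \<open>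
  The values at \<open>x\<close> of the polynomials of degree below \<open>d\<close> with coefficients in \<open>K\<close>. Hilbert's
  argument compares such expressions, and one element of the ring may have several of them.
\<close>
primrec poly_values :: "'r ring \<Rightarrow> 'r set \<Rightarrow> 'r \<Rightarrow> nat \<Rightarrow> 'r set" where
  "poly_values B K x 0 = {\<zero>\<^bsub>B\<^esub>}"
| "poly_values B K x (Suc d) =
     {r \<otimes>\<^bsub>B\<^esub> x [^]\<^bsub>B\<^esub> d \<oplus>\<^bsub>B\<^esub> p | r p. r \<in> K \<and> p \<in> poly_values B K x d}"

text \<open>
  The elements of \<open>K\<close> that occur as coefficient of \<open>x\<^sup>d\<close> in some element of \<open>J\<close> written as a
  polynomial expression of degree at most \<open>d\<close>.
\<close>
definition leading_coeffs :: "'r ring \<Rightarrow> 'r set \<Rightarrow> 'r \<Rightarrow> 'r set \<Rightarrow> nat \<Rightarrow> 'r set" where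
  "leading_coeffs B K x J d =
     {r \<in> K. \<exists>p\<in>poly_values B K x d. r \<otimes>\<^bsub>B\<^esub> x [^]\<^bsub>B\<^esub> d \<oplus>\<^bsub>B\<^esub> p \<in> J}"

locale simple_ring_extension = cring B for B :: "'r ring" +
  fixes K and x
  assumes K: "subring K B" and x: "x \<in> carrier B"
begin

abbreviation "P \<equiv> poly_values B K x"

lemma K_carrier: "r \<in> K \<Longrightarrow> r \<in> carrier B"
  using subringE(1)[OF K] by blast

lemma P_carrier: "p \<in> P d \<Longrightarrow> p \<in> carrier B"
  by (induction d arbitrary: p) (auto simp: K_carrier x)

lemma P_SucI: "r \<in> K \<Longrightarrow> p \<in> P d \<Longrightarrow> r \<otimes>\<^bsub>B\<^esub> x [^]\<^bsub>B\<^esub> d \<oplus>\<^bsub>B\<^esub> p \<in> P (Suc d)"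
  by auto

lemma P_zero: "\<zero>\<^bsub>B\<^esub> \<in> P d"
proof (induction d)
  case (Suc d)
  have "\<zero>\<^bsub>B\<^esub> = \<zero>\<^bsub>B\<^esub> \<otimes>\<^bsub>B\<^esub> x [^]\<^bsub>B\<^esub> d \<oplus>\<^bsub>B\<^esub> \<zero>\<^bsub>B\<^esub>" using x by simp
  then show ?case using P_SucI[OF subringE(2)[OF K] Suc] by (simp only:)
qed simp

lemma P_add: "p \<in> P d \<Longrightarrow> q \<in> P d \<Longrightarrow> p \<oplus>\<^bsub>B\<^esub> q \<in> P d"
proof (induction d arbitrary: p q)
  case (Suc d)
  then obtain r p' s q' where *: "r \<in> K" "p' \<in> P d" "s \<in> K" "q' \<in> P d"
    and eq: "p = r \<otimes>\<^bsub>B\<^esub> x [^]\<^bsub>B\<^esub> d \<oplus>\<^bsub>B\<^esub> p'" "q = s \<otimes>\<^bsub>B\<^esub> x [^]\<^bsub>B\<^esub> d \<oplus>\<^bsub>B\<^esub> q'" by auto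
  have "p \<oplus>\<^bsub>B\<^esub> q = (r \<oplus>\<^bsub>B\<^esub> s) \<otimes>\<^bsub>B\<^esub> x [^]\<^bsub>B\<^esub> d \<oplus>\<^bsub>B\<^esub> (p' \<oplus>\<^bsub>B\<^esub> q')"
    using * x by (simp add: eq K_carrier P_carrier l_distr a_ac)
  then show ?case using P_SucI[OF subringE(7)[OF K *(1,3)] Suc.IH[OF *(2,4)]] by (simp only:)
qed simp

lemma P_smult: "r \<in> K \<Longrightarrow> p \<in> P d \<Longrightarrow> r \<otimes>\<^bsub>B\<^esub> p \<in> P d"
proof (induction d arbitrary: p)
  case 0
  then show ?case by (simp add: K_carrier)
next
  case (Suc d)
  then obtain s q where *: "s \<in> K" "q \<in> P d" and eq: "p = s \<otimes>\<^bsub>B\<^esub> x [^]\<^bsub>B\<^esub> d \<oplus>\<^bsub>B\<^esub> q" by auto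
  have "r \<otimes>\<^bsub>B\<^esub> p = (r \<otimes>\<^bsub>B\<^esub> s) \<otimes>\<^bsub>B\<^esub> x [^]\<^bsub>B\<^esub> d \<oplus>\<^bsub>B\<^esub> r \<otimes>\<^bsub>B\<^esub> q"
    using * x Suc.prems by (simp add: eq K_carrier P_carrier r_distr m_assoc)
  then show ?case using P_SucI[OF subringE(6)[OF K _ *(1)] Suc.IH[OF _ *(2)]] Suc.prems(1) by (simp only:)
qed

lemma P_Suc: "p \<in> P d \<Longrightarrow> p \<in> P (Suc d)"
proof -
  assume p: "p \<in> P d"
  then have "p = \<zero>\<^bsub>B\<^esub> \<otimes>\<^bsub>B\<^esub> x [^]\<^bsub>B\<^esub> d \<oplus>\<^bsub>B\<^esub> p" using x by (simp add: P_carrier)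
  then show ?thesis using P_SucI[OF subringE(2)[OF K] p] by (simp only:)
qed

lemma P_mono: "d \<le> e \<Longrightarrow> P d \<subseteq> P e"
  by (rule lift_Suc_mono_le[of P]) (use P_Suc in blast)+

lemma P_times_x: "p \<in> P d \<Longrightarrow> x \<otimes>\<^bsub>B\<^esub> p \<in> P (Suc d)"
proof (induction d arbitrary: p)
  case 0
  then show ?case using x P_zero[of "Suc 0"] by (simp del: poly_values.simps(2))
next
  case (Suc d)
  then obtain s q where *: "s \<in> K" "q \<in> P d" and eq: "p = s \<otimes>\<^bsub>B\<^esub> x [^]\<^bsub>B\<^esub> d \<oplus>\<^bsub>B\<^esub> q" by auto
  have "x \<otimes>\<^bsub>B\<^esub> p = s \<otimes>\<^bsub>B\<^esub> x [^]\<^bsub>B\<^esub> Suc d \<oplus>\<^bsub>B\<^esub> x \<otimes>\<^bsub>B\<^esub> q"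
    using * x by (simp add: eq K_carrier P_carrier r_distr m_ac)
  then show ?case using P_SucI[OF *(1) Suc.IH[OF *(2)]] by (simp only:)
qed

lemma P_times_power: "p \<in> P d \<Longrightarrow> x [^]\<^bsub>B\<^esub> (e::nat) \<otimes>\<^bsub>B\<^esub> p \<in> P (d + e)"
proof (induction e)
  case 0
  then show ?case by (simp add: P_carrier)
next
  case (Suc e)
  have "x [^]\<^bsub>B\<^esub> Suc e \<otimes>\<^bsub>B\<^esub> p = x \<otimes>\<^bsub>B\<^esub> (x [^]\<^bsub>B\<^esub> e \<otimes>\<^bsub>B\<^esub> p)"
    using x P_carrier[OF Suc.prems] by (simp add: m_ac)
  then show ?case using P_times_x[OF Suc.IH[OF Suc.prems]] by simp
qed

lemma P_mult: "p \<in> P d \<Longrightarrow> q \<in> P e \<Longrightarrow> p \<otimes>\<^bsub>B\<^esub> q \<in> P (e + d)"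
proof (induction d arbitrary: p)
  case 0
  then show ?case using P_zero by (simp add: P_carrier)
next
  case (Suc d)
  then obtain s p' where *: "s \<in> K" "p' \<in> P d" and eq: "p = s \<otimes>\<^bsub>B\<^esub> x [^]\<^bsub>B\<^esub> d \<oplus>\<^bsub>B\<^esub> p'" by auto
  have "p \<otimes>\<^bsub>B\<^esub> q = s \<otimes>\<^bsub>B\<^esub> (x [^]\<^bsub>B\<^esub> d \<otimes>\<^bsub>B\<^esub> q) \<oplus>\<^bsub>B\<^esub> p' \<otimes>\<^bsub>B\<^esub> q"
    using * x Suc.prems by (simp add: eq K_carrier P_carrier l_distr m_assoc)
  moreover have "s \<otimes>\<^bsub>B\<^esub> (x [^]\<^bsub>B\<^esub> d \<otimes>\<^bsub>B\<^esub> q) \<oplus>\<^bsub>B\<^esub> p' \<otimes>\<^bsub>B\<^esub> q \<in> P (e + d)"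
    by (rule P_add[OF P_smult[OF *(1) P_times_power[OF Suc.prems(2)]] Suc.IH[OF *(2) Suc.prems(2)]])
  ultimately show ?case using P_Suc[of _ "e + d"] by (simp del: poly_values.simps(2))
qed

lemma K_subset_P: "r \<in> K \<Longrightarrow> r \<in> P 1"
proof -
  assume r: "r \<in> K"
  then have "r = r \<otimes>\<^bsub>B\<^esub> x [^]\<^bsub>B\<^esub> (0::nat) \<oplus>\<^bsub>B\<^esub> \<zero>\<^bsub>B\<^esub>" using x by (simp add: K_carrier)
  then show ?thesis using r by auto
qed

lemma generated_subset_P:
  assumes "H \<subseteq> insert x K"
  shows "generate_ring B H \<subseteq> (\<Union>d. P d)"
proof
  fix y assume "y \<in> generate_ring B H"
  then show "y \<in> (\<Union>d. P d)"
  proof induction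
    case one
    then show ?case using K_subset_P subringE(3)[OF K] by blast
  next
    case (incl h)
    have "x \<otimes>\<^bsub>B\<^esub> \<one>\<^bsub>B\<^esub> \<in> P (Suc 1)" using K_subset_P subringE(3)[OF K] by (intro P_times_x)
    then have "x \<in> P (Suc 1)" using x by (simp del: poly_values.simps)
    then show ?case using incl assms K_subset_P by blast
  next
    case (a_inv h)
    then obtain d where d: "h \<in> P d" by blast
    have "\<ominus>\<^bsub>B\<^esub> \<one>\<^bsub>B\<^esub> \<in> K" using subringE(3,5)[OF K] by blast
    then have "(\<ominus>\<^bsub>B\<^esub> \<one>\<^bsub>B\<^esub>) \<otimes>\<^bsub>B\<^esub> h \<in> P d" using d by (rule P_smult)
    then have "\<ominus>\<^bsub>B\<^esub> h \<in> P d" using P_carrier[OF d] by (simp add: l_minus)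
    then show ?case by blast
  next
    case (eng_add h1 h2)
    then obtain d e where "h1 \<in> P d" "h2 \<in> P e" by blast
    then have "h1 \<in> P (max d e)" "h2 \<in> P (max d e)"
      using P_mono[of d "max d e"] P_mono[of e "max d e"] by auto
    then show ?case using P_add by blast
  next
    case (eng_mult h1 h2)
    then show ?case using P_mult by blast
  qed
qed

context
  fixes S
  assumes S: "subring S B" and KS: "K \<subseteq> S" and xS: "x \<in> S"
begin

lemma leading_coeffs_ideal:
  assumes "sub_ideal B S J"
  shows "sub_ideal B K (leading_coeffs B K x J d)"
proof -
  have J: "\<zero>\<^bsub>B\<^esub> \<in> J" "\<And>a b. a \<in> J \<Longrightarrow> b \<in> J \<Longrightarrow> a \<oplus>\<^bsub>B\<^esub> b \<in> J"
    "\<And>a b. a \<in> S \<Longrightarrow> b \<in> J \<Longrightarrow> a \<otimes>\<^bsub>B\<^esub> b \<in> J"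
    using assms unfolding sub_ideal_def by auto
  have "\<zero>\<^bsub>B\<^esub> \<in> leading_coeffs B K x J d"
  proof -
    have "\<zero>\<^bsub>B\<^esub> \<otimes>\<^bsub>B\<^esub> x [^]\<^bsub>B\<^esub> d \<oplus>\<^bsub>B\<^esub> \<zero>\<^bsub>B\<^esub> \<in> J" using x J by simp
    then show ?thesis using P_zero subringE(2)[OF K] unfolding leading_coeffs_def by blast
  qed
  moreover have "a \<oplus>\<^bsub>B\<^esub> b \<in> leading_coeffs B K x J d"
    if ab: "a \<in> leading_coeffs B K x J d" "b \<in> leading_coeffs B K x J d" for a b
  proof -
    obtain p q where *: "a \<in> K" "b \<in> K" "p \<in> P d" "q \<in> P d"
      "a \<otimes>\<^bsub>B\<^esub> x [^]\<^bsub>B\<^esub> d \<oplus>\<^bsub>B\<^esub> p \<in> J" "b \<otimes>\<^bsub>B\<^esub> x [^]\<^bsub>B\<^esub> d \<oplus>\<^bsub>B\<^esub> q \<in> J"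
      using ab unfolding leading_coeffs_def by blast
    have "(a \<otimes>\<^bsub>B\<^esub> x [^]\<^bsub>B\<^esub> d \<oplus>\<^bsub>B\<^esub> p) \<oplus>\<^bsub>B\<^esub> (b \<otimes>\<^bsub>B\<^esub> x [^]\<^bsub>B\<^esub> d \<oplus>\<^bsub>B\<^esub> q) =
        (a \<oplus>\<^bsub>B\<^esub> b) \<otimes>\<^bsub>B\<^esub> x [^]\<^bsub>B\<^esub> d \<oplus>\<^bsub>B\<^esub> (p \<oplus>\<^bsub>B\<^esub> q)"
      using * x by (simp add: K_carrier P_carrier l_distr a_ac)
    then have "(a \<oplus>\<^bsub>B\<^esub> b) \<otimes>\<^bsub>B\<^esub> x [^]\<^bsub>B\<^esub> d \<oplus>\<^bsub>B\<^esub> (p \<oplus>\<^bsub>B\<^esub> q) \<in> J" using J(2) * by metis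
    then show ?thesis using * P_add subringE(7)[OF K] unfolding leading_coeffs_def by blast
  qed
  moreover have "r \<otimes>\<^bsub>B\<^esub> a \<in> leading_coeffs B K x J d"
    if r: "r \<in> K" and a: "a \<in> leading_coeffs B K x J d" for r a
  proof -
    obtain p where *: "a \<in> K" "p \<in> P d" "a \<otimes>\<^bsub>B\<^esub> x [^]\<^bsub>B\<^esub> d \<oplus>\<^bsub>B\<^esub> p \<in> J"
      using a unfolding leading_coeffs_def by blast
    have "r \<otimes>\<^bsub>B\<^esub> (a \<otimes>\<^bsub>B\<^esub> x [^]\<^bsub>B\<^esub> d \<oplus>\<^bsub>B\<^esub> p) = (r \<otimes>\<^bsub>B\<^esub> a) \<otimes>\<^bsub>B\<^esub> x [^]\<^bsub>B\<^esub> d \<oplus>\<^bsub>B\<^esub> r \<otimes>\<^bsub>B\<^esub> p"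
      using * x r by (simp add: K_carrier P_carrier r_distr m_assoc)
    then have "(r \<otimes>\<^bsub>B\<^esub> a) \<otimes>\<^bsub>B\<^esub> x [^]\<^bsub>B\<^esub> d \<oplus>\<^bsub>B\<^esub> r \<otimes>\<^bsub>B\<^esub> p \<in> J"
      using J(3)[OF _ *(3), of r] r KS by (metis subsetD)
    then show ?thesis using * r P_smult subringE(6)[OF K] unfolding leading_coeffs_def by blast
  qed
  ultimately show ?thesis unfolding sub_ideal_def by (auto simp: leading_coeffs_def)
qed

text \<open>
  Multiply by \<open>x\<close>.
\<close>
lemma leading_coeffs_Suc:
  assumes "sub_ideal B S J"
  shows "leading_coeffs B K x J d \<subseteq> leading_coeffs B K x J (Suc d)"
proof
  fix a assume "a \<in> leading_coeffs B K x J d"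
  then obtain p where *: "a \<in> K" "p \<in> P d" "a \<otimes>\<^bsub>B\<^esub> x [^]\<^bsub>B\<^esub> d \<oplus>\<^bsub>B\<^esub> p \<in> J"
    unfolding leading_coeffs_def by blast
  have "x \<otimes>\<^bsub>B\<^esub> (a \<otimes>\<^bsub>B\<^esub> x [^]\<^bsub>B\<^esub> d \<oplus>\<^bsub>B\<^esub> p) = a \<otimes>\<^bsub>B\<^esub> x [^]\<^bsub>B\<^esub> Suc d \<oplus>\<^bsub>B\<^esub> x \<otimes>\<^bsub>B\<^esub> p"
    using * x by (simp add: K_carrier P_carrier r_distr m_ac)
  moreover have "x \<otimes>\<^bsub>B\<^esub> (a \<otimes>\<^bsub>B\<^esub> x [^]\<^bsub>B\<^esub> d \<oplus>\<^bsub>B\<^esub> p) \<in> J"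
    using assms *(3) xS unfolding sub_ideal_def by blast
  ultimately have "a \<otimes>\<^bsub>B\<^esub> x [^]\<^bsub>B\<^esub> Suc d \<oplus>\<^bsub>B\<^esub> x \<otimes>\<^bsub>B\<^esub> p \<in> J" by metis
  then show "a \<in> leading_coeffs B K x J (Suc d)"
    using *(1) P_times_x[OF *(2)] unfolding leading_coeffs_def by blast
qed

text \<open>
  Induction on the degree: an element of the larger ideal can be corrected by an element of the
  smaller one with the same leading coefficient, which lowers its degree.
\<close>
lemma ideal_determined_by_leading_coeffs:
  assumes J: "sub_ideal B S J" and J': "sub_ideal B S J'" and "J \<subseteq> J'"
    and lead: "\<And>d. leading_coeffs B K x J' d \<subseteq> leading_coeffs B K x J d"
    and SP: "S \<subseteq> (\<Union>d. P d)"
  shows "J' = J"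
proof -
  have neg: "\<ominus>\<^bsub>B\<^esub> \<one>\<^bsub>B\<^esub> \<in> K" using subringE(3,5)[OF K] by blast
  have step: "q \<in> J" if "q \<in> J'" "q \<in> P d" for q d
    using that
  proof (induction d arbitrary: q)
    case 0
    then show ?case using J unfolding sub_ideal_def by simp
  next
    case (Suc d)
    then obtain r p where rp: "r \<in> K" "p \<in> P d" and q: "q = r \<otimes>\<^bsub>B\<^esub> x [^]\<^bsub>B\<^esub> d \<oplus>\<^bsub>B\<^esub> p" by auto
    then have "r \<in> leading_coeffs B K x J' d" using Suc.prems unfolding leading_coeffs_def by blast
    then obtain p1 where p1: "p1 \<in> P d" and inJ: "r \<otimes>\<^bsub>B\<^esub> x [^]\<^bsub>B\<^esub> d \<oplus>\<^bsub>B\<^esub> p1 \<in> J" (is "?b \<in> J")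
      using lead unfolding leading_coeffs_def by blast
    let ?c = "p \<oplus>\<^bsub>B\<^esub> (\<ominus>\<^bsub>B\<^esub> \<one>\<^bsub>B\<^esub>) \<otimes>\<^bsub>B\<^esub> p1"
    have carr: "r \<in> carrier B" "p \<in> carrier B" "p1 \<in> carrier B" "x [^]\<^bsub>B\<^esub> d \<in> carrier B"
      using rp p1 x by (auto simp: K_carrier P_carrier)
    have "?c = q \<oplus>\<^bsub>B\<^esub> (\<ominus>\<^bsub>B\<^esub> \<one>\<^bsub>B\<^esub>) \<otimes>\<^bsub>B\<^esub> ?b" unfolding q using carr by algebra
    moreover have "(\<ominus>\<^bsub>B\<^esub> \<one>\<^bsub>B\<^esub>) \<otimes>\<^bsub>B\<^esub> ?b \<in> J'"
      using inJ assms(3) J' neg KS unfolding sub_ideal_def by blast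
    ultimately have "?c \<in> J'" using Suc.prems(1) J' unfolding sub_ideal_def by metis
    moreover have "?c \<in> P d" using rp p1 neg by (intro P_add P_smult)
    ultimately have "?c \<in> J" by (rule Suc.IH)
    then have "?c \<oplus>\<^bsub>B\<^esub> ?b \<in> J" using inJ J unfolding sub_ideal_def by blast
    moreover have "?c \<oplus>\<^bsub>B\<^esub> ?b = q" unfolding q using carr by algebra
    ultimately show ?case by simp
  qed
  have "J' \<subseteq> J"
  proof
    fix q assume q: "q \<in> J'"
    then have "q \<in> (\<Union>d. P d)" using J' SP unfolding sub_ideal_def by (meson subsetD)
    then obtain d where "q \<in> P d" by (elim UN_E)
    then show "q \<in> J" by (rule step[OF q])
  qed
  then show ?thesis using assms(3) by simp
qed

text \<open>
  For a chain of ideals \<open>J i\<close> the leading coefficients \<open>L i d\<close> increase in both arguments. The diagonal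
  \<open>L i i\<close> stabilises at some \<open>N\<close>, which settles all degrees \<open>d \<ge> N\<close> at once; the finitely many
  smaller degrees stabilise separately.
\<close>
theorem hilbert_basis:
  assumes acc: "acc_ideals B K" and SP: "S \<subseteq> (\<Union>d. P d)"
  shows "acc_ideals B S"
  unfolding acc_ideals_def
proof (intro allI impI)
  fix J :: "nat \<Rightarrow> 'r set"
  assume "\<forall>i. sub_ideal B S (J i)" and "\<forall>i. J i \<subseteq> J (Suc i)"
  then have J: "\<And>i. sub_ideal B S (J i)" and "\<And>i. J i \<subseteq> J (Suc i)" by auto
  then have Jmono: "i \<le> j \<Longrightarrow> J i \<subseteq> J j" for i j using lift_Suc_mono_le[of J] by blast
  define L where "L i d = leading_coeffs B K x (J i) d" for i d
  have Lid: "sub_ideal B K (L i d)" for i d unfolding L_def by (rule leading_coeffs_ideal[OF J])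
  have Lmono1: "L i d \<subseteq> L j d" if "i \<le> j" for i j d
    using Jmono[OF that] unfolding L_def leading_coeffs_def by blast
  have Lmono2: "L i d \<subseteq> L i e" if "d \<le> e" for i d e
    using lift_Suc_mono_le[of "L i", OF _ that] leading_coeffs_Suc[OF J] unfolding L_def by blast
  have diag: "L i i \<subseteq> L (Suc i) (Suc i)" for i
    using Lmono1[of i "Suc i" i] Lmono2[of i "Suc i" "Suc i"] by auto
  obtain N where N: "\<forall>i\<ge>N. L i i = L N N"
    using acc_idealsD[where J = "\<lambda>i. L i i", OF acc Lid diag] by (elim exE)
  have "\<exists>M. \<forall>i\<ge>M. L i d = L M d" for d
    using acc_idealsD[where J = "\<lambda>i. L i d", OF acc Lid Lmono1] by simp
  then obtain M where M: "\<And>d i. i \<ge> M d \<Longrightarrow> L i d = L (M d) d" by metis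
  (* beyond this index the leading coefficients of every degree are constant *)
  define Q where "Q = Max (insert N (M ` {..<N}))"
  have QN: "Q \<ge> N" and QM: "d < N \<Longrightarrow> Q \<ge> M d" for d unfolding Q_def by auto
  have "J i = J Q" if i: "i \<ge> Q" for i
  proof (rule ideal_determined_by_leading_coeffs[OF J J Jmono[OF i] _ SP])
    fix d
    show "leading_coeffs B K x (J i) d \<subseteq> leading_coeffs B K x (J Q) d"
    proof (cases "d < N")
      case True
      then show ?thesis using M[of d i] M[of d Q] QM[OF True] i unfolding L_def by auto
    next
      case False
      have "L i d \<subseteq> L (max i d) (max i d)"
        using Lmono1[of i "max i d" d] Lmono2[of d "max i d" "max i d"] by auto
      also have "\<dots> = L N N" using N[rule_format, of "max i d"] QN i by auto
      also have "\<dots> \<subseteq> L Q d" using Lmono1[of N Q N] Lmono2[of N d Q] QN False by auto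
      finally show ?thesis unfolding L_def .
    qed
  qed
  then show "\<exists>N. \<forall>i\<ge>N. J i = J N" by (intro exI[of _ Q] allI impI)
qed

end

end

text \<open>
  The image of a field has at most the two trivial ideals. The image may be the zero ring.
\<close>
lemma acc_ideals_field_image:
  assumes "field k" and "cring B" and \<phi>: "\<phi> \<in> ring_hom k B"
  shows "subring (\<phi> ` carrier k) B" and "acc_ideals B (\<phi> ` carrier k)"
proof -
  interpret k: field k by (rule assms(1))
  interpret B: cring B by (rule assms(2))
  interpret h: ring_hom_ring k B \<phi> by (rule ring_hom_ringI2[OF k.ring_axioms B.ring_axioms \<phi>])
  show "subring (\<phi> ` carrier k) B"
    using h.img_is_subring[OF k.carrier_is_subring] .
  have triv: "J = \<phi> ` carrier k" if J: "sub_ideal B (\<phi> ` carrier k) J" and ne: "J \<noteq> {\<zero>\<^bsub>B\<^esub>}" for J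
  proof -
    obtain a where a: "a \<in> carrier k" "\<phi> a \<in> J" "\<phi> a \<noteq> \<zero>\<^bsub>B\<^esub>"
      using J ne unfolding sub_ideal_def by blast
    have "a \<noteq> \<zero>\<^bsub>k\<^esub>" using a by auto
    then have u: "inv\<^bsub>k\<^esub> a \<in> carrier k" "inv\<^bsub>k\<^esub> a \<otimes>\<^bsub>k\<^esub> a = \<one>\<^bsub>k\<^esub>"
      using a k.field_Units by auto
    have "\<phi> b \<in> J" if b: "b \<in> carrier k" for b
    proof -
      have "\<phi> (b \<otimes>\<^bsub>k\<^esub> inv\<^bsub>k\<^esub> a) \<otimes>\<^bsub>B\<^esub> \<phi> a \<in> J"
        using J a b u unfolding sub_ideal_def by (metis imageI k.m_closed)
      moreover have "\<phi> (b \<otimes>\<^bsub>k\<^esub> inv\<^bsub>k\<^esub> a) \<otimes>\<^bsub>B\<^esub> \<phi> a = \<phi> (b \<otimes>\<^bsub>k\<^esub> inv\<^bsub>k\<^esub> a \<otimes>\<^bsub>k\<^esub> a)"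
        using a b u by simp
      moreover have "b \<otimes>\<^bsub>k\<^esub> inv\<^bsub>k\<^esub> a \<otimes>\<^bsub>k\<^esub> a = b" using a b u by (simp add: k.m_assoc)
      ultimately show ?thesis by simp
    qed
    then show ?thesis using J unfolding sub_ideal_def by blast
  qed
  show "acc_ideals B (\<phi> ` carrier k)"
    unfolding acc_ideals_def
  proof (intro allI impI)
    fix J :: "nat \<Rightarrow> _"
    assume J: "\<forall>i. sub_ideal B (\<phi> ` carrier k) (J i)" and "\<forall>i. J i \<subseteq> J (Suc i)"
    then have mono: "i \<le> j \<Longrightarrow> J i \<subseteq> J j" for i j using lift_Suc_mono_le[of J] by blast
    show "\<exists>N. \<forall>i\<ge>N. J i = J N"
    proof (cases "\<exists>N. J N \<noteq> {\<zero>\<^bsub>B\<^esub>}")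
      case True
      then obtain N where N: "J N \<noteq> {\<zero>\<^bsub>B\<^esub>}" by (elim exE)
      have "J i = J N" if "i \<ge> N" for i
      proof -
        have "J i \<noteq> {\<zero>\<^bsub>B\<^esub>}"
          using mono[OF that] N J[rule_format, of N] unfolding sub_ideal_def by blast
        then show ?thesis using triv[OF J[rule_format]] N by metis
      qed
      then show ?thesis by (intro exI[of _ N] allI impI)
    next
      case False
      then show ?thesis by simp
    qed
  qed
qed

text \<open>
  Adjoin the generators one at a time.
\<close>
lemma fin_gen_algebra_noetherian:
  assumes "field k" and "cring B" and \<phi>: "\<phi> \<in> ring_hom k B" and "fin_gen_algebra k B \<phi>"
  shows "acc_ideals B (carrier B)"
proof -
  interpret B: cring B by (rule assms(2))
  obtain S where S: "S \<subseteq> carrier B" "finite S" "generate_ring B (\<phi> ` carrier k \<union> S) = carrier B"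
    using assms(4) unfolding fin_gen_algebra_def by blast
  let ?G = "\<lambda>F. generate_ring B (\<phi> ` carrier k \<union> F)"
  have k: "\<phi> ` carrier k \<subseteq> carrier B" using \<phi> unfolding ring_hom_def by blast
  have sub: "subring (?G F) B" if "F \<subseteq> carrier B" for F
    using k that by (intro B.generate_ring_is_subring) blast
  have "acc_ideals B (?G F)" if "finite F" "F \<subseteq> carrier B" for F
    using that
  proof (induction F rule: finite_induct)
    case empty
    have "?G {} = \<phi> ` carrier k"
      using B.generate_ringI[OF k acc_ideals_field_image(1)[OF assms(1-3)] subset_refl] by simp
    then show ?case using acc_ideals_field_image(2)[OF assms(1-3)] by simp
  next
    case (insert x F)
    then have x: "x \<in> carrier B" and F: "F \<subseteq> carrier B" by auto
    interpret simple_ring_extension B "?G F" x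
      using B.is_cring sub[OF F] x
      by (intro simple_ring_extension.intro simple_ring_extension_axioms.intro)
    have "?G F \<subseteq> ?G (insert x F)" using k x F by (intro B.mono_generate_ring) auto
    moreover have "x \<in> ?G (insert x F)" by (rule generate_ring.incl) simp
    moreover have "?G (insert x F) \<subseteq> (\<Union>d. P d)"
      by (rule generated_subset_P) (auto intro: generate_ring.incl)
    ultimately show ?case
      using hilbert_basis[OF sub[of "insert x F"]] insert x F by auto
  qed
  then show ?thesis using S by metis
qed


section \<open>Fractions and sections on a spectrum\<close>

locale mult_subset = cring A for A :: "'r ring" +
  fixes S
  assumes S_carrier: "S \<subseteq> carrier A" and S_one: "\<one>\<^bsub>A\<^esub> \<in> S"
    and S_mult: "\<And>s t. s \<in> S \<Longrightarrow> t \<in> S \<Longrightarrow> s \<otimes>\<^bsub>A\<^esub> t \<in> S"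
begin

lemma SA: "s \<in> S \<Longrightarrow> s \<in> carrier A"
  using S_carrier by blast

lemma fraction_memI:
  "b \<in> carrier A \<Longrightarrow> t \<in> S \<Longrightarrow> u \<in> S \<Longrightarrow> u \<otimes>\<^bsub>A\<^esub> (t \<otimes>\<^bsub>A\<^esub> a) = u \<otimes>\<^bsub>A\<^esub> (s \<otimes>\<^bsub>A\<^esub> b) \<Longrightarrow>
    (b, t) \<in> fraction A S a s"
  unfolding fraction_def by auto

lemma fraction_refl: "a \<in> carrier A \<Longrightarrow> s \<in> S \<Longrightarrow> (a, s) \<in> fraction A S a s"
  using S_one by (auto intro: fraction_memI)

text \<open>
  Transitivity of the equality of fractions: the witness is the product of the two given ones with
  the middle denominator.
\<close>
lemma fraction_trans:
  assumes "a \<in> carrier A" "b \<in> carrier A" "c \<in> carrier A" "s \<in> S" "t \<in> S" "r \<in> S" "u \<in> S" "v \<in> S"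
    and 1: "u \<otimes>\<^bsub>A\<^esub> (t \<otimes>\<^bsub>A\<^esub> a) = u \<otimes>\<^bsub>A\<^esub> (s \<otimes>\<^bsub>A\<^esub> b)"
    and 2: "v \<otimes>\<^bsub>A\<^esub> (r \<otimes>\<^bsub>A\<^esub> b) = v \<otimes>\<^bsub>A\<^esub> (t \<otimes>\<^bsub>A\<^esub> c)"
  shows "(u \<otimes>\<^bsub>A\<^esub> v \<otimes>\<^bsub>A\<^esub> t) \<otimes>\<^bsub>A\<^esub> (r \<otimes>\<^bsub>A\<^esub> a) = (u \<otimes>\<^bsub>A\<^esub> v \<otimes>\<^bsub>A\<^esub> t) \<otimes>\<^bsub>A\<^esub> (s \<otimes>\<^bsub>A\<^esub> c)"
proof -
  note carr = assms(1-3) assms(4-8)[THEN SA]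
  have "(u \<otimes>\<^bsub>A\<^esub> v \<otimes>\<^bsub>A\<^esub> t) \<otimes>\<^bsub>A\<^esub> (r \<otimes>\<^bsub>A\<^esub> a) = (v \<otimes>\<^bsub>A\<^esub> r) \<otimes>\<^bsub>A\<^esub> (u \<otimes>\<^bsub>A\<^esub> (t \<otimes>\<^bsub>A\<^esub> a))"
    using carr by (simp add: m_ac)
  also have "\<dots> = (u \<otimes>\<^bsub>A\<^esub> s) \<otimes>\<^bsub>A\<^esub> (v \<otimes>\<^bsub>A\<^esub> (r \<otimes>\<^bsub>A\<^esub> b))"
    unfolding 1 using carr by (simp add: m_ac)
  also have "\<dots> = (u \<otimes>\<^bsub>A\<^esub> v \<otimes>\<^bsub>A\<^esub> t) \<otimes>\<^bsub>A\<^esub> (s \<otimes>\<^bsub>A\<^esub> c)"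
    unfolding 2 using carr by (simp add: m_ac)
  finally show ?thesis .
qed

lemma fraction_subset:
  assumes a: "a \<in> carrier A" "s \<in> S" and b: "(b, t) \<in> fraction A S a s"
  shows "fraction A S b t \<subseteq> fraction A S a s"
proof (rule subrelI)
  obtain u where u: "b \<in> carrier A" "t \<in> S" "u \<in> S"
    "u \<otimes>\<^bsub>A\<^esub> (t \<otimes>\<^bsub>A\<^esub> a) = u \<otimes>\<^bsub>A\<^esub> (s \<otimes>\<^bsub>A\<^esub> b)"
    using b unfolding fraction_def by auto
  fix c r assume "(c, r) \<in> fraction A S b t"
  then obtain v where v: "c \<in> carrier A" "r \<in> S" "v \<in> S"
    "v \<otimes>\<^bsub>A\<^esub> (r \<otimes>\<^bsub>A\<^esub> b) = v \<otimes>\<^bsub>A\<^esub> (t \<otimes>\<^bsub>A\<^esub> c)"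
    unfolding fraction_def by auto
  have "u \<otimes>\<^bsub>A\<^esub> v \<otimes>\<^bsub>A\<^esub> t \<in> S" using u v S_mult by simp
  from fraction_memI[OF v(1,2) this fraction_trans[OF a(1) u(1) v(1) a(2) u(2) v(2) u(3) v(3) u(4) v(4)]]
  show "(c, r) \<in> fraction A S a s" .
qed

lemma fraction_sym:
  assumes "a \<in> carrier A" "s \<in> S" and "(b, t) \<in> fraction A S a s"
  shows "(a, s) \<in> fraction A S b t"
proof -
  obtain u where "b \<in> carrier A" "t \<in> S" "u \<in> S"
    "u \<otimes>\<^bsub>A\<^esub> (t \<otimes>\<^bsub>A\<^esub> a) = u \<otimes>\<^bsub>A\<^esub> (s \<otimes>\<^bsub>A\<^esub> b)"
    using assms(3) unfolding fraction_def by auto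
  then show ?thesis using assms(1,2) by (intro fraction_memI[of _ _ u]) simp_all
qed

lemma fraction_eq_mem:
  assumes "a \<in> carrier A" "s \<in> S" and "(b, t) \<in> fraction A S a s"
  shows "fraction A S b t = fraction A S a s"
proof -
  have "b \<in> carrier A" "t \<in> S" using assms(3) unfolding fraction_def by auto
  then show ?thesis using fraction_subset[OF _ _ fraction_sym] fraction_subset assms by blast
qed

lemma fraction_eqD:
  assumes "a \<in> carrier A" "s \<in> S" "b \<in> carrier A" "t \<in> S" "fraction A S a s = fraction A S b t"
  shows "\<exists>u\<in>S. u \<otimes>\<^bsub>A\<^esub> (t \<otimes>\<^bsub>A\<^esub> a) = u \<otimes>\<^bsub>A\<^esub> (s \<otimes>\<^bsub>A\<^esub> b)"
proof -
  have "(b, t) \<in> fraction A S a s" using fraction_refl[OF assms(3,4)] assms(5) by simp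
  then show ?thesis unfolding fraction_def by auto
qed

lemma fraction_well_defined:
  assumes mem: "a \<in> carrier A" "s \<in> S" "b \<in> carrier A" "t \<in> S"
    and F: "\<And>a' s' b' t'. (a', s') \<in> fraction A S a s \<Longrightarrow> (b', t') \<in> fraction A S b t \<Longrightarrow>
      G a' s' b' t' = fraction A S c r"
  shows "(\<Union>(a, s)\<in>fraction A S a s. \<Union>(b, t)\<in>fraction A S b t. G a s b t) = fraction A S c r"
  using F fraction_refl[OF mem(1,2)] fraction_refl[OF mem(3,4)] by fastforce

lemma localization_mult:
  assumes "a \<in> carrier A" "s \<in> S" "b \<in> carrier A" "t \<in> S"
  shows "fraction A S a s \<otimes>\<^bsub>localization A S\<^esub> fraction A S b t =
    fraction A S (a \<otimes>\<^bsub>A\<^esub> b) (s \<otimes>\<^bsub>A\<^esub> t)"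
  unfolding localization_def monoid.simps
proof (rule fraction_well_defined[OF assms])
  fix a' s' b' t' assume "(a', s') \<in> fraction A S a s" "(b', t') \<in> fraction A S b t"
  then obtain u v where mem: "a' \<in> carrier A" "s' \<in> S" "b' \<in> carrier A" "t' \<in> S" "u \<in> S" "v \<in> S"
    and u: "u \<otimes>\<^bsub>A\<^esub> (s' \<otimes>\<^bsub>A\<^esub> a) = u \<otimes>\<^bsub>A\<^esub> (s \<otimes>\<^bsub>A\<^esub> a')"
    and v: "v \<otimes>\<^bsub>A\<^esub> (t' \<otimes>\<^bsub>A\<^esub> b) = v \<otimes>\<^bsub>A\<^esub> (t \<otimes>\<^bsub>A\<^esub> b')"
    unfolding fraction_def by auto
  note carr = assms(1,3) mem(1,3) assms(2,4)[THEN SA] mem(2,4-6)[THEN SA]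
  have "(u \<otimes>\<^bsub>A\<^esub> v) \<otimes>\<^bsub>A\<^esub> ((s' \<otimes>\<^bsub>A\<^esub> t') \<otimes>\<^bsub>A\<^esub> (a \<otimes>\<^bsub>A\<^esub> b)) =
      (u \<otimes>\<^bsub>A\<^esub> (s' \<otimes>\<^bsub>A\<^esub> a)) \<otimes>\<^bsub>A\<^esub> (v \<otimes>\<^bsub>A\<^esub> (t' \<otimes>\<^bsub>A\<^esub> b))"
    using carr by (simp add: m_ac)
  also have "\<dots> = (u \<otimes>\<^bsub>A\<^esub> v) \<otimes>\<^bsub>A\<^esub> ((s \<otimes>\<^bsub>A\<^esub> t) \<otimes>\<^bsub>A\<^esub> (a' \<otimes>\<^bsub>A\<^esub> b'))"
    unfolding u v using carr by (simp add: m_ac)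
  finally have "(a' \<otimes>\<^bsub>A\<^esub> b', s' \<otimes>\<^bsub>A\<^esub> t') \<in> fraction A S (a \<otimes>\<^bsub>A\<^esub> b) (s \<otimes>\<^bsub>A\<^esub> t)"
    using carr mem S_mult by (intro fraction_memI[of _ _ "u \<otimes>\<^bsub>A\<^esub> v"]) auto
  then show "fraction A S (a' \<otimes>\<^bsub>A\<^esub> b') (s' \<otimes>\<^bsub>A\<^esub> t') = fraction A S (a \<otimes>\<^bsub>A\<^esub> b) (s \<otimes>\<^bsub>A\<^esub> t)"
    using assms S_mult by (intro fraction_eq_mem) auto
qed

lemma localization_add:
  assumes "a \<in> carrier A" "s \<in> S" "b \<in> carrier A" "t \<in> S"
  shows "fraction A S a s \<oplus>\<^bsub>localization A S\<^esub> fraction A S b t =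
    fraction A S (t \<otimes>\<^bsub>A\<^esub> a \<oplus>\<^bsub>A\<^esub> s \<otimes>\<^bsub>A\<^esub> b) (s \<otimes>\<^bsub>A\<^esub> t)"
  unfolding localization_def ring.simps
proof (rule fraction_well_defined[OF assms])
  fix a' s' b' t' assume "(a', s') \<in> fraction A S a s" "(b', t') \<in> fraction A S b t"
  then obtain u v where mem: "a' \<in> carrier A" "s' \<in> S" "b' \<in> carrier A" "t' \<in> S" "u \<in> S" "v \<in> S"
    and u: "u \<otimes>\<^bsub>A\<^esub> (s' \<otimes>\<^bsub>A\<^esub> a) = u \<otimes>\<^bsub>A\<^esub> (s \<otimes>\<^bsub>A\<^esub> a')"
    and v: "v \<otimes>\<^bsub>A\<^esub> (t' \<otimes>\<^bsub>A\<^esub> b) = v \<otimes>\<^bsub>A\<^esub> (t \<otimes>\<^bsub>A\<^esub> b')"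
    unfolding fraction_def by auto
  note carr = assms(1,3) mem(1,3) assms(2,4)[THEN SA] mem(2,4-6)[THEN SA]
  let ?c = "t \<otimes>\<^bsub>A\<^esub> a \<oplus>\<^bsub>A\<^esub> s \<otimes>\<^bsub>A\<^esub> b" and ?c' = "t' \<otimes>\<^bsub>A\<^esub> a' \<oplus>\<^bsub>A\<^esub> s' \<otimes>\<^bsub>A\<^esub> b'"
  have "(u \<otimes>\<^bsub>A\<^esub> v) \<otimes>\<^bsub>A\<^esub> ((s' \<otimes>\<^bsub>A\<^esub> t') \<otimes>\<^bsub>A\<^esub> ?c) =
      (v \<otimes>\<^bsub>A\<^esub> t' \<otimes>\<^bsub>A\<^esub> t) \<otimes>\<^bsub>A\<^esub> (u \<otimes>\<^bsub>A\<^esub> (s' \<otimes>\<^bsub>A\<^esub> a)) \<oplus>\<^bsub>A\<^esub>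
      (u \<otimes>\<^bsub>A\<^esub> s' \<otimes>\<^bsub>A\<^esub> s) \<otimes>\<^bsub>A\<^esub> (v \<otimes>\<^bsub>A\<^esub> (t' \<otimes>\<^bsub>A\<^esub> b))"
    using carr by (simp add: m_ac r_distr)
  also have "\<dots> = (u \<otimes>\<^bsub>A\<^esub> v) \<otimes>\<^bsub>A\<^esub> ((s \<otimes>\<^bsub>A\<^esub> t) \<otimes>\<^bsub>A\<^esub> ?c')"
    unfolding u v using carr by (simp add: m_ac r_distr)
  finally have "(?c', s' \<otimes>\<^bsub>A\<^esub> t') \<in> fraction A S ?c (s \<otimes>\<^bsub>A\<^esub> t)"
    using carr mem S_mult by (intro fraction_memI[of _ _ "u \<otimes>\<^bsub>A\<^esub> v"]) auto
  then show "fraction A S ?c' (s' \<otimes>\<^bsub>A\<^esub> t') = fraction A S ?c (s \<otimes>\<^bsub>A\<^esub> t)"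
    using assms S_mult SA by (intro fraction_eq_mem) auto
qed

end

lemma mult_subset_prime:
  assumes "primeideal q A"
  shows "mult_subset A (carrier A - q)"
proof -
  interpret primeideal q A by (rule assms)
  have "\<one>\<^bsub>A\<^esub> \<notin> q" using I_notcarr one_imp_carrier by blast
  then show ?thesis using is_cring I_prime by (intro mult_subset.intro mult_subset_axioms.intro) auto
qed

lemma spec_sections_memI:
  assumes "s \<in> extensional U"
    and "\<And>p. p \<in> U \<Longrightarrow> \<exists>V a h. zariski_open A V \<and> p \<in> V \<and> V \<subseteq> U \<and> a \<in> carrier A \<and> h \<in> carrier A \<and>
          (\<forall>q\<in>V. h \<notin> q \<and> s q = fraction A (carrier A - q) a h)"
  shows "s \<in> spec_sections A U"
proof -
  have "s p \<in> carrier (localization A (carrier A - p))" if p: "p \<in> U" for p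
  proof -
    obtain V a h where "p \<in> V" "a \<in> carrier A" "h \<in> carrier A"
      "\<forall>q\<in>V. h \<notin> q \<and> s q = fraction A (carrier A - q) a h"
      using assms(2)[OF p] by (elim exE conjE)
    then show ?thesis unfolding localization_def by auto
  qed
  then have "s \<in> (\<Pi>\<^sub>E p\<in>U. carrier (localization A (carrier A - p)))" using assms(1) by (simp add: PiE_def)
  then show ?thesis using assms(2) unfolding spec_sections_def by simp
qed

lemma spec_sections_local:
  assumes "s \<in> spec_sections A U" and "p \<in> U"
  shows "\<exists>V a h. zariski_open A V \<and> p \<in> V \<and> V \<subseteq> U \<and> a \<in> carrier A \<and> h \<in> carrier A \<and>
      (\<forall>q\<in>V. h \<notin> q) \<and> (\<forall>q\<in>V. s q = fraction A (carrier A - q) a h)"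
  using assms unfolding spec_sections_def by (simp add: ball_conj_distrib)

lemma zariski_open_Int: "zariski_open A V \<Longrightarrow> zariski_open A W \<Longrightarrow> zariski_open A (V \<inter> W)"
  using istopology_zariski_open unfolding istopology_def by blast

lemma zariski_open_prime: "zariski_open A V \<Longrightarrow> q \<in> V \<Longrightarrow> primeideal q A"
  unfolding zariski_open_def by blast

text \<open>
  Addition and multiplication of sections are both pointwise and given on fractions by a formula
  with denominator \<open>h \<cdot> g\<close>; closure of the sections under either is proved here once.
\<close>
lemma spec_sections_binop:
  assumes s: "s \<in> spec_sections A U" and t: "t \<in> spec_sections A U"
    and op: "\<And>q a b h g. primeideal q A \<Longrightarrow> a \<in> carrier A \<Longrightarrow> b \<in> carrier A \<Longrightarrow> h \<in> carrier A - q \<Longrightarrow>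
        g \<in> carrier A - q \<Longrightarrow>
        F q (fraction A (carrier A - q) a h) (fraction A (carrier A - q) b g) =
        fraction A (carrier A - q) (N a h b g) (h \<otimes>\<^bsub>A\<^esub> g)"
    and N: "\<And>a b h g. a \<in> carrier A \<Longrightarrow> b \<in> carrier A \<Longrightarrow> h \<in> carrier A \<Longrightarrow> g \<in> carrier A \<Longrightarrow>
        N a h b g \<in> carrier A"
    and A: "cring A"
  shows "(\<lambda>q\<in>U. F q (s q) (t q)) \<in> spec_sections A U"
proof (rule spec_sections_memI)
  fix p assume p: "p \<in> U"
  obtain V a h where V: "zariski_open A V" "p \<in> V" "V \<subseteq> U" "a \<in> carrier A" "h \<in> carrier A"
    "\<forall>q\<in>V. h \<notin> q" "\<forall>q\<in>V. s q = fraction A (carrier A - q) a h"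
    using spec_sections_local[OF s p] by (elim exE conjE)
  obtain W b g where W: "zariski_open A W" "p \<in> W" "W \<subseteq> U" "b \<in> carrier A" "g \<in> carrier A"
    "\<forall>q\<in>W. g \<notin> q" "\<forall>q\<in>W. t q = fraction A (carrier A - q) b g"
    using spec_sections_local[OF t p] by (elim exE conjE)
  interpret cring A by (rule A)
  have "h \<otimes>\<^bsub>A\<^esub> g \<notin> q \<and>
      (\<lambda>q\<in>U. F q (s q) (t q)) q = fraction A (carrier A - q) (N a h b g) (h \<otimes>\<^bsub>A\<^esub> g)"
    if q: "q \<in> V \<inter> W" for q
  proof -
    have pr: "primeideal q A" using zariski_open_prime V(1) q by blast
    have "h \<in> carrier A - q" "g \<in> carrier A - q" using V W q by auto
    then show ?thesis
      using op[OF pr V(4) W(4)] V(3,7) W(7) q mult_subset.S_mult[OF mult_subset_prime[OF pr], of h g] by auto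
  qed
  then have "\<forall>q\<in>V \<inter> W. h \<otimes>\<^bsub>A\<^esub> g \<notin> q \<and>
      (\<lambda>q\<in>U. F q (s q) (t q)) q = fraction A (carrier A - q) (N a h b g) (h \<otimes>\<^bsub>A\<^esub> g)" by blast
  moreover have "p \<in> V \<inter> W" "V \<inter> W \<subseteq> U" using V(2,3) W(2) by auto
  moreover have "N a h b g \<in> carrier A" "h \<otimes>\<^bsub>A\<^esub> g \<in> carrier A" using N V(4,5) W(4,5) by simp_all
  ultimately show "\<exists>V a h. zariski_open A V \<and> p \<in> V \<and> V \<subseteq> U \<and> a \<in> carrier A \<and> h \<in> carrier A \<and>
      (\<forall>q\<in>V. h \<notin> q \<and> (\<lambda>q\<in>U. F q (s q) (t q)) q = fraction A (carrier A - q) a h)"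
    using zariski_open_Int[OF V(1) W(1)]
    by (intro exI[of _ "V \<inter> W"] exI[of _ "N a h b g"] exI[of _ "h \<otimes>\<^bsub>A\<^esub> g"] conjI)
qed auto

lemma spec_sections_fraction:
  assumes "zariski_open A V" "a \<in> carrier A" "h \<in> carrier A" "\<forall>q\<in>V. h \<notin> q"
  shows "(\<lambda>q\<in>V. fraction A (carrier A - q) a h) \<in> spec_sections A V"
  using assms by (intro spec_sections_memI exI[of _ V] exI[of _ a] exI[of _ h]) auto

lemma spec_sections_restrict:
  assumes s: "s \<in> spec_sections A V" and W: "zariski_open A W" "W \<subseteq> V"
  shows "restrict s W \<in> spec_sections A W"
proof (rule spec_sections_memI)
  fix q assume q: "q \<in> W"
  obtain V' b g where V': "zariski_open A V'" "q \<in> V'" and bg: "b \<in> carrier A" "g \<in> carrier A"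
    "\<forall>q\<in>V'. g \<notin> q" "\<forall>q\<in>V'. s q = fraction A (carrier A - q) b g"
    using spec_sections_local[OF s subsetD[OF W(2) q]] by (elim exE conjE)
  show "\<exists>V a h. zariski_open A V \<and> q \<in> V \<and> V \<subseteq> W \<and> a \<in> carrier A \<and> h \<in> carrier A \<and>
      (\<forall>q\<in>V. h \<notin> q \<and> restrict s W q = fraction A (carrier A - q) a h)"
    by (intro exI[of _ "V' \<inter> W"] exI[of _ b] exI[of _ g] conjI ballI zariski_open_Int[OF V'(1) W(1)])
      (use V'(2) bg q in simp_all)
qed auto

lemma Spec_simps [simp]:
  "top_of (Spec A) = zariski_topology A"
  "carrier (fun_ring (Spec A) U) = spec_sections A U"
  "s \<otimes>\<^bsub>fun_ring (Spec A) U\<^esub> t = (\<lambda>p\<in>U. s p \<otimes>\<^bsub>localization A (carrier A - p)\<^esub> t p)"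
  "s \<oplus>\<^bsub>fun_ring (Spec A) U\<^esub> t = (\<lambda>p\<in>U. s p \<oplus>\<^bsub>localization A (carrier A - p)\<^esub> t p)"
  "\<one>\<^bsub>fun_ring (Spec A) U\<^esub> = (\<lambda>p\<in>U. \<one>\<^bsub>localization A (carrier A - p)\<^esub>)"
  "fun_res (Spec A) U V s = restrict s V"
  unfolding Spec_def by simp_all

lemma localization_one: "\<one>\<^bsub>localization A S\<^esub> = fraction A S \<one>\<^bsub>A\<^esub> \<one>\<^bsub>A\<^esub>"
  unfolding localization_def by simp

lemma Spec_mult_closed:
  assumes "cring A" "s \<in> spec_sections A U" "t \<in> spec_sections A U"
  shows "s \<otimes>\<^bsub>fun_ring (Spec A) U\<^esub> t \<in> spec_sections A U"
proof -
  interpret cring A by (rule assms)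
  show ?thesis unfolding Spec_simps
    by (rule spec_sections_binop[OF assms(2,3) mult_subset.localization_mult[OF mult_subset_prime]])
      (auto intro: assms)
qed

lemma Spec_add_closed:
  assumes "cring A" "s \<in> spec_sections A U" "t \<in> spec_sections A U"
  shows "s \<oplus>\<^bsub>fun_ring (Spec A) U\<^esub> t \<in> spec_sections A U"
proof -
  interpret cring A by (rule assms)
  show ?thesis unfolding Spec_simps
    by (rule spec_sections_binop[OF assms(2,3) mult_subset.localization_add[OF mult_subset_prime]])
      (auto intro: assms)
qed

lemma Spec_one_closed:
  assumes "cring A" "zariski_open A U"
  shows "\<one>\<^bsub>fun_ring (Spec A) U\<^esub> \<in> spec_sections A U"
proof -
  interpret cring A by (rule assms)
  have "\<one>\<^bsub>A\<^esub> \<notin> q" if "q \<in> U" for q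
    using mult_subset.S_one[OF mult_subset_prime[OF zariski_open_prime[OF assms(2) that]]] by blast
  then show ?thesis unfolding Spec_simps localization_one
    by (intro spec_sections_fraction assms) auto
qed


section \<open>Germs of functions and local rings\<close>

text \<open>
  Invertibility of the germ of \<open>g\<close> at \<open>p\<close>, expressed without forming the stalk.
\<close>
definition unit_near :: "('a, 'r) ringed \<Rightarrow> 'a \<Rightarrow> 'a set \<Rightarrow> 'r \<Rightarrow> bool" where
  "unit_near X p W g \<longleftrightarrow>
     (\<exists>W' b. openin (top_of X) W' \<and> p \<in> W' \<and> W' \<subseteq> W \<and> b \<in> carrier (fun_ring X W') \<and>
        fun_res X W W' g \<otimes>\<^bsub>fun_ring X W'\<^esub> b = \<one>\<^bsub>fun_ring X W'\<^esub>)"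

text \<open>
  The stalks are local rings. A ring is local when it is nonzero and one of \<open>g\<close>, \<open>h\<close> is a unit
  whenever \<open>g + h = 1\<close>.
\<close>
definition locally_ringed :: "('a, 'r) ringed \<Rightarrow> bool" where
  "locally_ringed X \<longleftrightarrow>
     (\<forall>W p. openin (top_of X) W \<longrightarrow> p \<in> W \<longrightarrow>
        \<one>\<^bsub>fun_ring X W\<^esub> \<noteq> \<zero>\<^bsub>fun_ring X W\<^esub> \<and>
        (\<forall>g\<in>carrier (fun_ring X W). \<forall>h\<in>carrier (fun_ring X W).
           g \<oplus>\<^bsub>fun_ring X W\<^esub> h = \<one>\<^bsub>fun_ring X W\<^esub> \<longrightarrow> unit_near X p W g \<or> unit_near X p W h))"

text \<open>
  The preimage in the functions on \<open>W\<close> of the maximal ideal of the stalk at \<open>p\<close>.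
\<close>
definition nonunits :: "('a, 'r) ringed \<Rightarrow> 'a \<Rightarrow> 'a set \<Rightarrow> 'r set" where
  "nonunits X p W = {g \<in> carrier (fun_ring X W). \<not> unit_near X p W g}"

locale ringed_space_on =
  fixes X :: "('a, 'r) ringed"
  assumes ringed: "ringed_space X"
begin

lemma cring_fun: "openin (top_of X) U \<Longrightarrow> cring (fun_ring X U)"
  using ringed unfolding ringed_space_def by simp

lemma res_hom:
  "openin (top_of X) U \<Longrightarrow> openin (top_of X) V \<Longrightarrow> V \<subseteq> U \<Longrightarrow>
    fun_res X U V \<in> ring_hom (fun_ring X U) (fun_ring X V)"
  using ringed unfolding ringed_space_def by simp

lemma sheaf_fun: "sheaf (top_of X) (\<lambda>U. carrier (fun_ring X U)) (fun_res X)"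
  using ringed unfolding ringed_space_def by simp

lemma res_res:
  "openin (top_of X) U \<Longrightarrow> openin (top_of X) V \<Longrightarrow> openin (top_of X) W \<Longrightarrow> W \<subseteq> V \<Longrightarrow> V \<subseteq> U \<Longrightarrow>
    g \<in> carrier (fun_ring X U) \<Longrightarrow> fun_res X V W (fun_res X U V g) = fun_res X U W g"
  using sheaf_fun unfolding sheaf_def by simp

lemma res_closed:
  "openin (top_of X) U \<Longrightarrow> openin (top_of X) V \<Longrightarrow> V \<subseteq> U \<Longrightarrow> g \<in> carrier (fun_ring X U) \<Longrightarrow>
    fun_res X U V g \<in> carrier (fun_ring X V)"
  using ring_hom_closed[OF res_hom] by blast

lemma res_mult:
  "openin (top_of X) U \<Longrightarrow> openin (top_of X) V \<Longrightarrow> V \<subseteq> U \<Longrightarrow> g \<in> carrier (fun_ring X U) \<Longrightarrow>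
    h \<in> carrier (fun_ring X U) \<Longrightarrow>
    fun_res X U V (g \<otimes>\<^bsub>fun_ring X U\<^esub> h) = fun_res X U V g \<otimes>\<^bsub>fun_ring X V\<^esub> fun_res X U V h"
  using ring_hom_mult[OF res_hom] by blast

lemma res_add:
  "openin (top_of X) U \<Longrightarrow> openin (top_of X) V \<Longrightarrow> V \<subseteq> U \<Longrightarrow> g \<in> carrier (fun_ring X U) \<Longrightarrow>
    h \<in> carrier (fun_ring X U) \<Longrightarrow>
    fun_res X U V (g \<oplus>\<^bsub>fun_ring X U\<^esub> h) = fun_res X U V g \<oplus>\<^bsub>fun_ring X V\<^esub> fun_res X U V h"
  using ring_hom_add[OF res_hom] by blast

lemma res_one:
  "openin (top_of X) U \<Longrightarrow> openin (top_of X) V \<Longrightarrow> V \<subseteq> U \<Longrightarrow>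
    fun_res X U V \<one>\<^bsub>fun_ring X U\<^esub> = \<one>\<^bsub>fun_ring X V\<^esub>"
  using ring_hom_one[OF res_hom] by blast

lemma res_zero:
  "openin (top_of X) U \<Longrightarrow> openin (top_of X) V \<Longrightarrow> V \<subseteq> U \<Longrightarrow>
    fun_res X U V \<zero>\<^bsub>fun_ring X U\<^esub> = \<zero>\<^bsub>fun_ring X V\<^esub>"
  using ring_hom_zero[OF res_hom] cring_fun cring.axioms(1) by blast

lemma unit_nearI:
  assumes "openin (top_of X) W'" "p \<in> W'" "W' \<subseteq> W" "b \<in> carrier (fun_ring X W')"
    and "fun_res X W W' g \<otimes>\<^bsub>fun_ring X W'\<^esub> b = \<one>\<^bsub>fun_ring X W'\<^esub>"
  shows "unit_near X p W g"
  using assms unfolding unit_near_def by blast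

lemma unit_near_factor:
  assumes W: "openin (top_of X) W" and c: "c \<in> carrier (fun_ring X W)" "g \<in> carrier (fun_ring X W)"
    and u: "unit_near X p W (c \<otimes>\<^bsub>fun_ring X W\<^esub> g)"
  shows "unit_near X p W g"
proof -
  obtain W' b where W': "openin (top_of X) W'" "p \<in> W'" "W' \<subseteq> W" and b: "b \<in> carrier (fun_ring X W')"
    and eq: "fun_res X W W' (c \<otimes>\<^bsub>fun_ring X W\<^esub> g) \<otimes>\<^bsub>fun_ring X W'\<^esub> b = \<one>\<^bsub>fun_ring X W'\<^esub>"
    using u unfolding unit_near_def by blast
  interpret R: cring "fun_ring X W'" by (rule cring_fun[OF W'(1)])
  note rc = res_closed[OF W W'(1,3)]
  have "fun_res X W W' g \<otimes>\<^bsub>fun_ring X W'\<^esub> (fun_res X W W' c \<otimes>\<^bsub>fun_ring X W'\<^esub> b) = \<one>\<^bsub>fun_ring X W'\<^esub>"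
    using eq b rc[OF c(1)] rc[OF c(2)] by (simp add: res_mult[OF W W'(1,3) c] R.m_ac)
  then show ?thesis using W' b rc[OF c(1)] by (intro unit_nearI[of W']) auto
qed

lemma unit_near_res:
  assumes "openin (top_of X) W" "openin (top_of X) V" "V \<subseteq> W" "g \<in> carrier (fun_ring X W)" "p \<in> V"
  shows "unit_near X p V (fun_res X W V g) \<longleftrightarrow> unit_near X p W g"
proof
  assume "unit_near X p V (fun_res X W V g)"
  then show "unit_near X p W g"
    unfolding unit_near_def using assms res_res by (metis (no_types, lifting) order_trans)
next
  assume "unit_near X p W g"
  then obtain W' b where W': "openin (top_of X) W'" "p \<in> W'" "W' \<subseteq> W" and b: "b \<in> carrier (fun_ring X W')"
    and eq: "fun_res X W W' g \<otimes>\<^bsub>fun_ring X W'\<^esub> b = \<one>\<^bsub>fun_ring X W'\<^esub>"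
    unfolding unit_near_def by blast
  have O: "openin (top_of X) (W' \<inter> V)" using W' assms by blast
  have g: "fun_res X W W' g \<in> carrier (fun_ring X W')" using assms W' by (intro res_closed)
  have "fun_res X W' (W' \<inter> V) (fun_res X W W' g \<otimes>\<^bsub>fun_ring X W'\<^esub> b) = \<one>\<^bsub>fun_ring X (W' \<inter> V)\<^esub>"
    unfolding eq using W'(1) O by (intro res_one) auto
  then have "fun_res X W (W' \<inter> V) g \<otimes>\<^bsub>fun_ring X (W' \<inter> V)\<^esub> fun_res X W' (W' \<inter> V) b = \<one>\<^bsub>fun_ring X (W' \<inter> V)\<^esub>"
    using res_mult[OF W'(1) O _ g b] res_res[OF assms(1) W'(1) O _ W'(3) assms(4)] by simp
  moreover have "fun_res X V (W' \<inter> V) (fun_res X W V g) = fun_res X W (W' \<inter> V) g"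
    using assms O by (intro res_res) auto
  ultimately show "unit_near X p V (fun_res X W V g)"
    using O W' assms(5) res_closed[OF W'(1) O _ b] by (intro unit_nearI[of "W' \<inter> V"]) auto
qed

lemma nonunits_mult:
  assumes "openin (top_of X) W" "c \<in> carrier (fun_ring X W)" "g \<in> nonunits X p W"
  shows "c \<otimes>\<^bsub>fun_ring X W\<^esub> g \<in> nonunits X p W"
proof -
  interpret R: cring "fun_ring X W" by (rule cring_fun[OF assms(1)])
  show ?thesis using assms unit_near_factor unfolding nonunits_def by blast
qed

lemma nonunits_zero:
  assumes "locally_ringed X" "openin (top_of X) W" "p \<in> W"
  shows "\<zero>\<^bsub>fun_ring X W\<^esub> \<in> nonunits X p W"
proof -
  interpret R: cring "fun_ring X W" by (rule cring_fun[OF assms(2)])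
  have "\<not> unit_near X p W \<zero>\<^bsub>fun_ring X W\<^esub>"
  proof
    assume "unit_near X p W \<zero>\<^bsub>fun_ring X W\<^esub>"
    then obtain W' b where W': "openin (top_of X) W'" "p \<in> W'" "W' \<subseteq> W" and b: "b \<in> carrier (fun_ring X W')"
      and eq: "fun_res X W W' \<zero>\<^bsub>fun_ring X W\<^esub> \<otimes>\<^bsub>fun_ring X W'\<^esub> b = \<one>\<^bsub>fun_ring X W'\<^esub>"
      unfolding unit_near_def by blast
    interpret R': cring "fun_ring X W'" by (rule cring_fun[OF W'(1)])
    have "\<one>\<^bsub>fun_ring X W'\<^esub> = \<zero>\<^bsub>fun_ring X W'\<^esub>"
      using eq b by (simp add: res_zero[OF assms(2) W'(1,3)])
    then show False using assms(1) W' unfolding locally_ringed_def by blast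
  qed
  then show ?thesis unfolding nonunits_def by simp
qed

text \<open>
  If \<open>g + h\<close> has an inverse \<open>b\<close> near \<open>p\<close>, then \<open>b g + b h = 1\<close> there.
\<close>
lemma nonunits_add:
  assumes "locally_ringed X" "openin (top_of X) W" "g \<in> nonunits X p W" "h \<in> nonunits X p W"
  shows "g \<oplus>\<^bsub>fun_ring X W\<^esub> h \<in> nonunits X p W"
proof -
  interpret R: cring "fun_ring X W" by (rule cring_fun[OF assms(2)])
  have gh: "g \<in> carrier (fun_ring X W)" "h \<in> carrier (fun_ring X W)"
    using assms(3,4) unfolding nonunits_def by auto
  have "\<not> unit_near X p W (g \<oplus>\<^bsub>fun_ring X W\<^esub> h)"
  proof
    assume "unit_near X p W (g \<oplus>\<^bsub>fun_ring X W\<^esub> h)"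
    then obtain W' b where W': "openin (top_of X) W'" "p \<in> W'" "W' \<subseteq> W" and b: "b \<in> carrier (fun_ring X W')"
      and eq: "fun_res X W W' (g \<oplus>\<^bsub>fun_ring X W\<^esub> h) \<otimes>\<^bsub>fun_ring X W'\<^esub> b = \<one>\<^bsub>fun_ring X W'\<^esub>"
      unfolding unit_near_def by blast
    interpret R': cring "fun_ring X W'" by (rule cring_fun[OF W'(1)])
    let ?g = "fun_res X W W' g" and ?h = "fun_res X W W' h"
    have carr: "?g \<in> carrier (fun_ring X W')" "?h \<in> carrier (fun_ring X W')"
      using res_closed[OF assms(2) W'(1,3)] gh by auto
    have "b \<otimes>\<^bsub>fun_ring X W'\<^esub> ?g \<oplus>\<^bsub>fun_ring X W'\<^esub> b \<otimes>\<^bsub>fun_ring X W'\<^esub> ?h = \<one>\<^bsub>fun_ring X W'\<^esub>"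
      using eq carr b by (simp add: res_add[OF assms(2) W'(1,3) gh] R'.r_distr R'.m_comm)
    then have "unit_near X p W' (b \<otimes>\<^bsub>fun_ring X W'\<^esub> ?g) \<or> unit_near X p W' (b \<otimes>\<^bsub>fun_ring X W'\<^esub> ?h)"
      using assms(1) W' carr b unfolding locally_ringed_def by blast
    then have "unit_near X p W' ?g \<or> unit_near X p W' ?h"
      using unit_near_factor[OF W'(1) b] carr by blast
    then show False
      using assms(3,4) unit_near_res[OF assms(2) W'(1,3) _ W'(2)] gh unfolding nonunits_def by blast
  qed
  then show ?thesis using gh unfolding nonunits_def by simp
qed

end


section \<open>Affine charts\<close>

locale affine_chart = ringed_space_on X for X :: "('a, 'r) ringed" +
  fixes U and A :: "'b ring" and f \<theta>
  assumes U: "openin (top_of X) U" and A: "cring A"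
    and iso: "ringed_space_iso (open_subspace X U) (Spec A) f \<theta>"
begin

lemma homeo: "homeomorphic_map (subtopology (top_of X) U) (zariski_topology A) f"
  using iso unfolding ringed_space_iso_def open_subspace_def by simp

lemma topspace_U: "topspace (subtopology (top_of X) U) = U"
  using openin_subset[OF U] by auto

definition pullback :: "'b set set \<Rightarrow> 'a set" where
  "pullback V = f -` V \<inter> U"

lemma pullback_open: "zariski_open A V \<Longrightarrow> openin (top_of X) (pullback V)"
proof -
  assume "zariski_open A V"
  then have "openin (zariski_topology A) V" unfolding openin_zariski_topology .
  then have "openin (subtopology (top_of X) U) {x \<in> topspace (subtopology (top_of X) U). f x \<in> V}"
    by (rule openin_continuous_map_preimage[OF homeomorphic_imp_continuous_map[OF homeo]])
  moreover have "{x \<in> topspace (subtopology (top_of X) U). f x \<in> V} = pullback V"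
    unfolding topspace_U pullback_def by auto
  ultimately show ?thesis using openin_open_subtopology[OF U] by simp
qed

lemma image_open: "openin (top_of X) W \<Longrightarrow> W \<subseteq> U \<Longrightarrow> zariski_open A (f ` W)"
  using homeomorphic_imp_open_map[OF homeo] openin_open_subtopology[OF U]
  unfolding open_map_def openin_zariski_topology by simp

lemma pullback_image: "W \<subseteq> U \<Longrightarrow> pullback (f ` W) = W"
  using homeomorphic_imp_injective_map[OF homeo] unfolding topspace_U pullback_def inj_on_def by blast

lemma \<theta>_iso:
  assumes "zariski_open A V"
  shows "\<theta> V \<in> ring_iso (fun_ring (Spec A) V) (fun_ring X (pullback V))"
proof -
  have "\<theta> V \<in> ring_iso (fun_ring (Spec A) V)
      (fun_ring (open_subspace X U) (f -` V \<inter> points (open_subspace X U)))"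
    using iso assms unfolding ringed_space_iso_def by (simp add: openin_zariski_topology)
  moreover have "f -` V \<inter> points (open_subspace X U) = pullback V"
    unfolding open_subspace_def pullback_def by (simp add: topspace_U[simplified])
  ultimately show ?thesis unfolding open_subspace_def by simp
qed

lemma \<theta>_res:
  assumes "zariski_open A V" "zariski_open A W" "W \<subseteq> V" "s \<in> spec_sections A V"
  shows "\<theta> W (restrict s W) = fun_res X (pullback V) (pullback W) (\<theta> V s)"
proof -
  have "\<theta> W (fun_res (Spec A) V W s) = fun_res (open_subspace X U)
      (f -` V \<inter> points (open_subspace X U)) (f -` W \<inter> points (open_subspace X U)) (\<theta> V s)"
    using iso assms unfolding ringed_space_iso_def by (simp add: openin_zariski_topology)
  moreover have "f -` V \<inter> points (open_subspace X U) = pullback V" for V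
    unfolding open_subspace_def pullback_def by (simp add: topspace_U[simplified])
  ultimately show ?thesis unfolding open_subspace_def by simp
qed

lemma \<theta>_hom: "zariski_open A V \<Longrightarrow> \<theta> V \<in> ring_hom (fun_ring (Spec A) V) (fun_ring X (pullback V))"
  using \<theta>_iso unfolding ring_iso_def by blast

lemma \<theta>_inj: "zariski_open A V \<Longrightarrow> inj_on (\<theta> V) (spec_sections A V)"
  using \<theta>_iso unfolding ring_iso_def bij_betw_def by simp

lemma \<theta>_surj: "zariski_open A V \<Longrightarrow> \<theta> V ` spec_sections A V = carrier (fun_ring X (pullback V))"
  using \<theta>_iso unfolding ring_iso_def bij_betw_def by simp

lemma prime_image: "p \<in> U \<Longrightarrow> primeideal (f p) A"
  using image_open[OF U subset_refl] zariski_open_prime by blast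

text \<open>
  A section equal to \<open>b / g\<close> near a prime not containing \<open>b\<close> has the inverse \<open>g / b\<close> where \<open>b\<close>
  does not vanish. The numerator \<open>b\<close> of the expression valid on a neighbourhood need not be the given \<open>a\<close>,
  but avoids the prime just as \<open>a\<close> does.
\<close>
lemma unit_near_if_nonzero:
  assumes V: "zariski_open A V" "f p \<in> V" and p: "p \<in> U"
    and s: "s \<in> spec_sections A V" "s (f p) = fraction A (carrier A - f p) a h"
    and a: "a \<in> carrier A" "a \<notin> f p" and h: "h \<in> carrier A" "h \<notin> f p"
  shows "unit_near X p (pullback V) (\<theta> V s)"
proof -
  interpret A: cring A by (rule A)
  interpret P: mult_subset A "carrier A - f p" by (rule mult_subset_prime[OF prime_image[OF p]])
  interpret Pp: primeideal "f p" A by (rule prime_image[OF p])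
  obtain V' b g where V': "zariski_open A V'" "f p \<in> V'" "V' \<subseteq> V" and bg: "b \<in> carrier A" "g \<in> carrier A"
    and "\<forall>q\<in>V'. g \<notin> q" and "\<forall>q\<in>V'. s q = fraction A (carrier A - q) b g"
    using spec_sections_local[OF s(1) V(2)] by (elim exE conjE)
  then have g: "\<And>q. q \<in> V' \<Longrightarrow> g \<notin> q"
    and sq: "\<And>q. q \<in> V' \<Longrightarrow> s q = fraction A (carrier A - q) b g" by auto
  have "b \<notin> f p"
  proof
    assume b: "b \<in> f p"
    have "fraction A (carrier A - f p) a h = fraction A (carrier A - f p) b g"
      using s(2) sq[OF V'(2)] by simp
    then obtain u where u: "u \<in> carrier A - f p"
      "u \<otimes>\<^bsub>A\<^esub> (g \<otimes>\<^bsub>A\<^esub> a) = u \<otimes>\<^bsub>A\<^esub> (h \<otimes>\<^bsub>A\<^esub> b)"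
      using P.fraction_eqD[of a h b g] a h bg g[OF V'(2)] by blast
    have "u \<otimes>\<^bsub>A\<^esub> (h \<otimes>\<^bsub>A\<^esub> b) \<in> f p" using u b h by (simp add: Pp.I_l_closed)
    then have "u \<otimes>\<^bsub>A\<^esub> (g \<otimes>\<^bsub>A\<^esub> a) \<in> f p" using u(2) by simp
    moreover have "u \<otimes>\<^bsub>A\<^esub> (g \<otimes>\<^bsub>A\<^esub> a) \<in> carrier A - f p"
      using u a bg g[OF V'(2)] by (intro P.S_mult) auto
    ultimately show False by blast
  qed
  define W where "W = V' \<inter> {q. primeideal q A \<and> \<not> {b} \<subseteq> q}"
  have "zariski_open A {q. primeideal q A \<and> \<not> {b} \<subseteq> q}"
    using bg unfolding zariski_open_def by blast
  then have W: "zariski_open A W" using V'(1) zariski_open_Int unfolding W_def by blast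
  have WV: "W \<subseteq> V" and pW: "f p \<in> W"
    using V' \<open>b \<notin> f p\<close> prime_image[OF p] unfolding W_def by auto
  let ?r = "\<lambda>q\<in>W. fraction A (carrier A - q) g b"
  have r: "?r \<in> spec_sections A W"
    using W bg by (intro spec_sections_fraction) (auto simp: W_def)
  have sW: "restrict s W = (\<lambda>q\<in>W. fraction A (carrier A - q) b g)"
    by (rule restrict_ext) (simp add: W_def sq)
  have sWin: "restrict s W \<in> spec_sections A W"
    unfolding sW using W bg g by (intro spec_sections_fraction) (auto simp: W_def)
  have "restrict s W \<otimes>\<^bsub>fun_ring (Spec A) W\<^esub> ?r = \<one>\<^bsub>fun_ring (Spec A) W\<^esub>"
    unfolding Spec_simps localization_one sW
  proof (rule restrict_ext)
    fix q assume q: "q \<in> W"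
    interpret Q: mult_subset A "carrier A - q"
      by (rule mult_subset_prime[OF zariski_open_prime[OF W q]])
    have bS: "b \<in> carrier A - q" and gS: "g \<in> carrier A - q" using q bg g unfolding W_def by auto
    have "fraction A (carrier A - q) b g \<otimes>\<^bsub>localization A (carrier A - q)\<^esub> fraction A (carrier A - q) g b =
      fraction A (carrier A - q) (b \<otimes>\<^bsub>A\<^esub> g) (g \<otimes>\<^bsub>A\<^esub> b)"
      using bg bS gS by (intro Q.localization_mult) auto
    also have "\<dots> = fraction A (carrier A - q) \<one>\<^bsub>A\<^esub> \<one>\<^bsub>A\<^esub>"
    proof (rule Q.fraction_eq_mem[OF _ Q.S_one])
      show "(b \<otimes>\<^bsub>A\<^esub> g, g \<otimes>\<^bsub>A\<^esub> b) \<in> fraction A (carrier A - q) \<one>\<^bsub>A\<^esub> \<one>\<^bsub>A\<^esub>"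
        using bg Q.S_mult[OF gS bS] Q.S_one by (intro Q.fraction_memI[of _ _ "\<one>\<^bsub>A\<^esub>"]) (auto simp: A.m_comm)
    qed simp
    finally show "(\<lambda>q\<in>W. fraction A (carrier A - q) b g) q \<otimes>\<^bsub>localization A (carrier A - q)\<^esub>
        (\<lambda>q\<in>W. fraction A (carrier A - q) g b) q = fraction A (carrier A - q) \<one>\<^bsub>A\<^esub> \<one>\<^bsub>A\<^esub>"
      using q by simp
  qed
  then have "\<theta> W (restrict s W) \<otimes>\<^bsub>fun_ring X (pullback W)\<^esub> \<theta> W ?r = \<one>\<^bsub>fun_ring X (pullback W)\<^esub>"
    using ring_hom_mult[OF \<theta>_hom[OF W], of "restrict s W" ?r] ring_hom_one[OF \<theta>_hom[OF W]] sWin r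
    by (simp del: Spec_simps(3-5))
  moreover have "\<theta> W ?r \<in> carrier (fun_ring X (pullback W))" using \<theta>_surj[OF W] r by blast
  ultimately show ?thesis
    using pullback_open[OF W] p pW WV unfolding \<theta>_res[OF V(1) W WV s(1)]
    by (intro unit_nearI[of "pullback W"]) (auto simp: pullback_def)
qed

lemma value_fraction:
  assumes "s \<in> spec_sections A V" "q \<in> V"
  obtains a h where "a \<in> carrier A" "h \<in> carrier A - q" "s q = fraction A (carrier A - q) a h"
proof -
  obtain W a h where "q \<in> W" "a \<in> carrier A" "h \<in> carrier A"
    "\<forall>q\<in>W. h \<notin> q" "\<forall>q\<in>W. s q = fraction A (carrier A - q) a h"
    using spec_sections_local[OF assms] by (elim exE conjE)
  then show ?thesis by (intro that[of a h]) auto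
qed

text \<open>
  A multiple of a fraction with numerator in the prime has numerator in the prime, so it is not \<open>1\<close>.
\<close>
lemma not_unit_near_if_zero:
  assumes V: "zariski_open A V" "f p \<in> V" and p: "p \<in> U"
    and s: "s \<in> spec_sections A V" "s (f p) = fraction A (carrier A - f p) a h"
    and a: "a \<in> f p" and h: "h \<in> carrier A" "h \<notin> f p"
  shows "\<not> unit_near X p (pullback V) (\<theta> V s)"
proof
  interpret P: mult_subset A "carrier A - f p" by (rule mult_subset_prime[OF prime_image[OF p]])
  interpret Pp: primeideal "f p" A by (rule prime_image[OF p])
  assume "unit_near X p (pullback V) (\<theta> V s)"
  then obtain W' c where W': "openin (top_of X) W'" "p \<in> W'" "W' \<subseteq> pullback V"
    and c: "c \<in> carrier (fun_ring X W')"
    and eq: "fun_res X (pullback V) W' (\<theta> V s) \<otimes>\<^bsub>fun_ring X W'\<^esub> c = \<one>\<^bsub>fun_ring X W'\<^esub>"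
    unfolding unit_near_def by blast
  define W where "W = f ` W'"
  have W'U: "W' \<subseteq> U" using W'(3) unfolding pullback_def by blast
  have W: "zariski_open A W" "pullback W = W'" "f p \<in> W" "W \<subseteq> V"
    using image_open[OF W'(1) W'U] pullback_image[OF W'U] W'(2,3) unfolding W_def pullback_def by auto
  obtain r where r: "r \<in> spec_sections A W" "c = \<theta> W r"
    using \<theta>_surj[OF W(1)] c W(2) by blast
  have sW: "restrict s W \<in> spec_sections A W"
    by (rule spec_sections_restrict[OF s(1) W(1,4)])
  have "\<theta> W (restrict s W \<otimes>\<^bsub>fun_ring (Spec A) W\<^esub> r) = \<theta> W \<one>\<^bsub>fun_ring (Spec A) W\<^esub>"
    using ring_hom_mult[OF \<theta>_hom[OF W(1)], of "restrict s W" r] ring_hom_one[OF \<theta>_hom[OF W(1)]] sW r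
      eq \<theta>_res[OF V(1) W(1,4) s(1)] unfolding W(2) by (simp del: Spec_simps(3-5))
  then have "restrict s W \<otimes>\<^bsub>fun_ring (Spec A) W\<^esub> r = \<one>\<^bsub>fun_ring (Spec A) W\<^esub>"
    using inj_onD[OF \<theta>_inj[OF W(1)]] Spec_mult_closed[OF A sW r(1)] Spec_one_closed[OF A W(1)] by blast
  then have "(restrict s W \<otimes>\<^bsub>fun_ring (Spec A) W\<^esub> r) (f p) = \<one>\<^bsub>fun_ring (Spec A) W\<^esub> (f p)" by simp
  then have *: "s (f p) \<otimes>\<^bsub>localization A (carrier A - f p)\<^esub> r (f p) = fraction A (carrier A - f p) \<one>\<^bsub>A\<^esub> \<one>\<^bsub>A\<^esub>"
    using W(3) by (simp add: localization_one)
  obtain b g where bg: "b \<in> carrier A" "g \<in> carrier A - f p" "r (f p) = fraction A (carrier A - f p) b g"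
    using value_fraction[OF r(1) W(3)] by metis
  have aA: "a \<in> carrier A" using a Pp.Icarr by blast
  have "fraction A (carrier A - f p) (a \<otimes>\<^bsub>A\<^esub> b) (h \<otimes>\<^bsub>A\<^esub> g) = fraction A (carrier A - f p) \<one>\<^bsub>A\<^esub> \<one>\<^bsub>A\<^esub>"
    using * P.localization_mult[of a h b g] aA h bg unfolding s(2) bg(3) by simp
  then obtain u where u: "u \<in> carrier A - f p"
    "u \<otimes>\<^bsub>A\<^esub> (\<one>\<^bsub>A\<^esub> \<otimes>\<^bsub>A\<^esub> (a \<otimes>\<^bsub>A\<^esub> b)) = u \<otimes>\<^bsub>A\<^esub> ((h \<otimes>\<^bsub>A\<^esub> g) \<otimes>\<^bsub>A\<^esub> \<one>\<^bsub>A\<^esub>)"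
    using P.fraction_eqD[of "a \<otimes>\<^bsub>A\<^esub> b" "h \<otimes>\<^bsub>A\<^esub> g" "\<one>\<^bsub>A\<^esub>" "\<one>\<^bsub>A\<^esub>"] P.S_mult[of h g] P.S_one h aA bg
    by auto
  have "u \<otimes>\<^bsub>A\<^esub> (\<one>\<^bsub>A\<^esub> \<otimes>\<^bsub>A\<^esub> (a \<otimes>\<^bsub>A\<^esub> b)) \<in> f p"
    using u(1) a bg(1) by (intro Pp.I_l_closed Pp.I_r_closed) auto
  moreover have "u \<otimes>\<^bsub>A\<^esub> ((h \<otimes>\<^bsub>A\<^esub> g) \<otimes>\<^bsub>A\<^esub> \<one>\<^bsub>A\<^esub>) \<in> carrier A - f p"
    using u h bg P.S_one by (intro P.S_mult) auto
  ultimately show False using u(2) by simp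
qed

text \<open>
  If both numerators were in the prime, so would be the numerator of the sum.
\<close>
lemma sum_one_unit:
  assumes W: "openin (top_of X) W" "W \<subseteq> U" "p \<in> W"
    and g: "g \<in> carrier (fun_ring X W)" and h: "h \<in> carrier (fun_ring X W)"
    and eq: "g \<oplus>\<^bsub>fun_ring X W\<^esub> h = \<one>\<^bsub>fun_ring X W\<^esub>"
  shows "unit_near X p W g \<or> unit_near X p W h"
proof -
  define V where "V = f ` W"
  have V: "zariski_open A V" "pullback V = W" "f p \<in> V"
    using image_open[OF W(1,2)] pullback_image[OF W(2)] W(3) unfolding V_def by auto
  have p: "p \<in> U" using W by blast
  interpret P: mult_subset A "carrier A - f p" by (rule mult_subset_prime[OF prime_image[OF p]])
  interpret Pp: primeideal "f p" A by (rule prime_image[OF p])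
  obtain s t where s: "s \<in> spec_sections A V" "g = \<theta> V s" and t: "t \<in> spec_sections A V" "h = \<theta> V t"
    using \<theta>_surj[OF V(1)] g h unfolding V(2) by blast
  have "\<theta> V (s \<oplus>\<^bsub>fun_ring (Spec A) V\<^esub> t) = \<theta> V \<one>\<^bsub>fun_ring (Spec A) V\<^esub>"
    using ring_hom_add[OF \<theta>_hom[OF V(1)], of s t] ring_hom_one[OF \<theta>_hom[OF V(1)]] s t eq
    unfolding V(2) by (simp del: Spec_simps(3-5))
  then have "s \<oplus>\<^bsub>fun_ring (Spec A) V\<^esub> t = \<one>\<^bsub>fun_ring (Spec A) V\<^esub>"
    using inj_onD[OF \<theta>_inj[OF V(1)]] Spec_add_closed[OF A s(1) t(1)] Spec_one_closed[OF A V(1)] by blast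
  then have "(s \<oplus>\<^bsub>fun_ring (Spec A) V\<^esub> t) (f p) = \<one>\<^bsub>fun_ring (Spec A) V\<^esub> (f p)" by simp
  then have *: "s (f p) \<oplus>\<^bsub>localization A (carrier A - f p)\<^esub> t (f p) = fraction A (carrier A - f p) \<one>\<^bsub>A\<^esub> \<one>\<^bsub>A\<^esub>"
    using V(3) by (simp add: localization_one)
  obtain a k where ak: "a \<in> carrier A" "k \<in> carrier A - f p" "s (f p) = fraction A (carrier A - f p) a k"
    using value_fraction[OF s(1) V(3)] by metis
  obtain b l where bl: "b \<in> carrier A" "l \<in> carrier A - f p" "t (f p) = fraction A (carrier A - f p) b l"
    using value_fraction[OF t(1) V(3)] by metis
  have "a \<notin> f p \<or> b \<notin> f p"
  proof (rule ccontr)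
    assume "\<not> (a \<notin> f p \<or> b \<notin> f p)"
    then have ab: "a \<in> f p" "b \<in> f p" by auto
    let ?c = "l \<otimes>\<^bsub>A\<^esub> a \<oplus>\<^bsub>A\<^esub> k \<otimes>\<^bsub>A\<^esub> b"
    have c: "?c \<in> f p" using ab ak bl by (simp add: Pp.I_l_closed Pp.a_closed)
    have "fraction A (carrier A - f p) ?c (k \<otimes>\<^bsub>A\<^esub> l) = fraction A (carrier A - f p) \<one>\<^bsub>A\<^esub> \<one>\<^bsub>A\<^esub>"
      using * P.localization_add[of a k b l] ak bl unfolding ak(3) bl(3) by simp
    then obtain u where u: "u \<in> carrier A - f p"
      "u \<otimes>\<^bsub>A\<^esub> (\<one>\<^bsub>A\<^esub> \<otimes>\<^bsub>A\<^esub> ?c) = u \<otimes>\<^bsub>A\<^esub> ((k \<otimes>\<^bsub>A\<^esub> l) \<otimes>\<^bsub>A\<^esub> \<one>\<^bsub>A\<^esub>)"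
      using P.fraction_eqD[of ?c "k \<otimes>\<^bsub>A\<^esub> l" "\<one>\<^bsub>A\<^esub>" "\<one>\<^bsub>A\<^esub>"] P.S_mult[of k l] P.S_one ak bl
      by auto
    have "u \<otimes>\<^bsub>A\<^esub> (\<one>\<^bsub>A\<^esub> \<otimes>\<^bsub>A\<^esub> ?c) \<in> f p"
      using u(1) c by (intro Pp.I_l_closed) auto
    moreover have "u \<otimes>\<^bsub>A\<^esub> ((k \<otimes>\<^bsub>A\<^esub> l) \<otimes>\<^bsub>A\<^esub> \<one>\<^bsub>A\<^esub>) \<in> carrier A - f p"
      using u ak bl P.S_one by (intro P.S_mult) auto
    ultimately show False using u(2) by simp
  qed
  then show ?thesis
  proof
    assume "a \<notin> f p"
    then have "unit_near X p (pullback V) (\<theta> V s)"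
      using unit_near_if_nonzero[OF V(1,3) p s(1) ak(3,1)] ak(2) by blast
    then show ?thesis unfolding V(2) s(2) by simp
  next
    assume "b \<notin> f p"
    then have "unit_near X p (pullback V) (\<theta> V t)"
      using unit_near_if_nonzero[OF V(1,3) p t(1) bl(3,1)] bl(2) by blast
    then show ?thesis unfolding V(2) t(2) by simp
  qed
qed

text \<open>
  If \<open>1 = 0\<close> on \<open>W\<close>, the section \<open>0 / 1\<close> would be invertible.
\<close>
lemma one_not_zero:
  assumes W: "openin (top_of X) W" "W \<subseteq> U" "p \<in> W"
  shows "\<one>\<^bsub>fun_ring X W\<^esub> \<noteq> \<zero>\<^bsub>fun_ring X W\<^esub>"
proof
  assume eq: "\<one>\<^bsub>fun_ring X W\<^esub> = \<zero>\<^bsub>fun_ring X W\<^esub>"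
  define V where "V = f ` W"
  have V: "zariski_open A V" "pullback V = W" "f p \<in> V"
    using image_open[OF W(1,2)] pullback_image[OF W(2)] W(3) unfolding V_def by auto
  have p: "p \<in> U" using W by blast
  interpret A: cring A by (rule A)
  interpret R: cring "fun_ring X W" by (rule cring_fun[OF W(1)])
  interpret Pp: primeideal "f p" A by (rule prime_image[OF p])
  interpret P: mult_subset A "carrier A - f p" by (rule mult_subset_prime[OF prime_image[OF p]])
  let ?s = "\<lambda>q\<in>V. fraction A (carrier A - q) \<zero>\<^bsub>A\<^esub> \<one>\<^bsub>A\<^esub>"
  have "\<one>\<^bsub>A\<^esub> \<notin> q" if "q \<in> V" for q
    using mult_subset.S_one[OF mult_subset_prime[OF zariski_open_prime[OF V(1) that]]] by blast
  then have s: "?s \<in> spec_sections A V" using V by (intro spec_sections_fraction) auto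
  then have "\<theta> V ?s \<in> carrier (fun_ring X W)" using \<theta>_surj[OF V(1)] V(2) by blast
  then have "\<theta> V ?s = \<one>\<^bsub>fun_ring X W\<^esub>" by (metis R.l_one R.l_null eq)
  then have "unit_near X p W (\<theta> V ?s)"
    using W res_one[OF W(1) W(1)] by (intro unit_nearI[of W _ _ "\<one>\<^bsub>fun_ring X W\<^esub>"]) auto
  then show False
    using not_unit_near_if_zero[OF V(1,3) p s, of "\<zero>\<^bsub>A\<^esub>" "\<one>\<^bsub>A\<^esub>"] V(2,3) P.S_one by auto
qed

text \<open>
  The complement of \<open>Z\<close> is given by a set of ring elements, one of which is not in the prime of \<open>p\<close>
  but in the primes of all points of \<open>Z\<close>. It is a global function \<open>e / 1\<close> on \<open>U\<close>.
\<close>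
lemma separate:
  assumes Z: "closedin (subtopology (top_of X) U) Z" and p: "p \<in> U" "p \<notin> Z"
  shows "\<exists>g\<in>carrier (fun_ring X U). unit_near X p U g \<and> (\<forall>z\<in>Z. g \<in> nonunits X z U)"
proof -
  interpret A: cring A by (rule A)
  have ZU: "Z \<subseteq> U" using Z closedin_subset topspace_U by blast
  have "openin (subtopology (top_of X) U) (U - Z)" using Z topspace_U by (metis openin_closedin_eq closedin_def)
  then have "openin (top_of X) (U - Z)" using openin_open_subtopology[OF U] by simp
  then have "zariski_open A (f ` (U - Z))" by (rule image_open) auto
  then obtain E where E: "E \<subseteq> carrier A" "f ` (U - Z) = {q. primeideal q A \<and> \<not> E \<subseteq> q}"
    unfolding zariski_open_def by blast
  have "f p \<in> f ` (U - Z)" using p by blast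
  then have "\<not> E \<subseteq> f p" unfolding E(2) by simp
  then obtain e where e: "e \<in> E" "e \<notin> f p" by blast
  then have eA: "e \<in> carrier A" using E(1) by blast
  define V where "V = f ` U"
  have V: "zariski_open A V" "pullback V = U"
    using image_open[OF U subset_refl] pullback_image[of U] unfolding V_def by auto
  have one: "\<one>\<^bsub>A\<^esub> \<notin> q" if "q \<in> V" for q
    using mult_subset.S_one[OF mult_subset_prime[OF zariski_open_prime[OF V(1) that]]] by blast
  let ?s = "\<lambda>q\<in>V. fraction A (carrier A - q) e \<one>\<^bsub>A\<^esub>"
  have s: "?s \<in> spec_sections A V" using one by (intro spec_sections_fraction V(1) eA) auto
  have g: "\<theta> V ?s \<in> carrier (fun_ring X U)" using imageI[OF s, of "\<theta> V"] \<theta>_surj[OF V(1)] V(2) by simp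
  have fV: "f q \<in> V" if "q \<in> U" for q using that unfolding V_def by blast
  have "unit_near X p U (\<theta> V ?s)"
    using unit_near_if_nonzero[OF V(1) fV[OF p(1)] p(1) s, of e "\<one>\<^bsub>A\<^esub>"] eA e(2) one[OF fV[OF p(1)]] fV[OF p(1)] V(2)
    by auto
  moreover have "\<theta> V ?s \<in> nonunits X z U" if z: "z \<in> Z" for z
  proof -
    have zU: "z \<in> U" using z ZU by blast
    have "f z \<notin> f ` (U - Z)"
      using homeomorphic_imp_injective_map[OF homeo] z zU unfolding topspace_U inj_on_def by blast
    then have "E \<subseteq> f z" unfolding E(2) using prime_image[OF zU] by simp
    then have "e \<in> f z" using e(1) by blast
    then have "\<not> unit_near X z U (\<theta> V ?s)"
      using not_unit_near_if_zero[OF V(1) fV[OF zU] zU s, of e "\<one>\<^bsub>A\<^esub>"] one[OF fV[OF zU]] fV[OF zU] V(2) by auto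
    then show ?thesis using g unfolding nonunits_def by simp
  qed
  ultimately show ?thesis using g by blast
qed

text \<open>
  Sending a closed set to the ideal of functions that are non-units at all its points is injective by
  the previous lemma and reverses inclusions.
\<close>
lemma noetherian_chart:
  assumes lr: "locally_ringed X" and acc: "acc_ideals (fun_ring X U) (carrier (fun_ring X U))"
  shows "noetherian_topology (subtopology (top_of X) U)"
  unfolding noetherian_topology_def
proof (intro allI impI)
  interpret R: cring "fun_ring X U" by (rule cring_fun[OF U])
  fix C :: "nat \<Rightarrow> 'a set"
  assume "(\<forall>i. closedin (subtopology (top_of X) U) (C i)) \<and> (\<forall>i. C (Suc i) \<subseteq> C i)"
  then have C: "\<And>i. closedin (subtopology (top_of X) U) (C i)" and dec: "\<And>i. C (Suc i) \<subseteq> C i" by auto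
  have CU: "C i \<subseteq> U" for i using C[of i] closedin_subset topspace_U by blast
  define J where "J i = {g \<in> carrier (fun_ring X U). \<forall>z\<in>C i. g \<in> nonunits X z U}" for i
  have "sub_ideal (fun_ring X U) (carrier (fun_ring X U)) (J i)" for i
    using CU[of i] nonunits_zero[OF lr U] nonunits_add[OF lr U] nonunits_mult[OF U]
    unfolding sub_ideal_def J_def by auto
  moreover have "J i \<subseteq> J (Suc i)" for i using dec[of i] unfolding J_def by blast
  ultimately have "\<exists>N. \<forall>i\<ge>N. J i = J N" by (rule acc_idealsD[OF acc])
  then obtain N where N: "\<forall>i\<ge>N. J i = J N" by (elim exE)
  have sub: "C j \<subseteq> C i" if eq: "J i = J j" for i j
  proof
    fix p assume p: "p \<in> C j"
    show "p \<in> C i"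
    proof (rule ccontr)
      assume "p \<notin> C i"
      then obtain g where g: "g \<in> carrier (fun_ring X U)" "unit_near X p U g" "\<forall>z\<in>C i. g \<in> nonunits X z U"
        using separate[OF C[of i], of p] p CU[of j] by blast
      then have "g \<in> J i" unfolding J_def by simp
      then have "g \<in> J j" by (simp only: eq)
      then have "g \<in> nonunits X p U" using p unfolding J_def by simp
      then show False using g(2) unfolding nonunits_def by simp
    qed
  qed
  have "C i = C N" if "i \<ge> N" for i
  proof -
    have "J i = J N" by (rule N[rule_format, OF that])
    then show ?thesis using sub[of i N] sub[of N i] by simp
  qed
  then show "\<exists>N. \<forall>i\<ge>N. C i = C N" by (intro exI[of _ N] allI impI)
qed

end

lemma scheme_locally_ringed:
  fixes X :: "('a, 'r) ringed"
  assumes "is_scheme X"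
  shows "locally_ringed X"
proof -
  interpret ringed_space_on X using assms unfolding is_scheme_def by unfold_locales simp
  have "\<one>\<^bsub>fun_ring X W\<^esub> \<noteq> \<zero>\<^bsub>fun_ring X W\<^esub> \<and>
        (\<forall>g\<in>carrier (fun_ring X W). \<forall>h\<in>carrier (fun_ring X W).
           g \<oplus>\<^bsub>fun_ring X W\<^esub> h = \<one>\<^bsub>fun_ring X W\<^esub> \<longrightarrow> unit_near X p W g \<or> unit_near X p W h)"
    if W: "openin (top_of X) W" "p \<in> W" for W p
  proof -
    have "p \<in> points X" using W openin_subset by blast
    then obtain U where chart: "openin (top_of X) U" "p \<in> U" "affine_scheme (open_subspace X U)"
      using assms unfolding is_scheme_def by blast
    then obtain A :: "'r ring" and f \<theta> where "cring A" "ringed_space_iso (open_subspace X U) (Spec A) f \<theta>"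
      unfolding affine_scheme_def by (elim exE conjE)
    then interpret affine_chart X U A f \<theta>
      using chart(1) ringed_space_on_axioms by (intro affine_chart.intro affine_chart_axioms.intro)
    have O: "openin (top_of X) (W \<inter> U)" using W chart by blast
    have sub: "W \<inter> U \<subseteq> W" "W \<inter> U \<subseteq> U" "p \<in> W \<inter> U" using W chart by auto
    have "\<one>\<^bsub>fun_ring X W\<^esub> \<noteq> \<zero>\<^bsub>fun_ring X W\<^esub>"
      using one_not_zero[OF O sub(2,3)] res_one[OF W(1) O sub(1)] res_zero[OF W(1) O sub(1)] by metis
    moreover have "unit_near X p W g \<or> unit_near X p W h"
      if gh: "g \<in> carrier (fun_ring X W)" "h \<in> carrier (fun_ring X W)" "g \<oplus>\<^bsub>fun_ring X W\<^esub> h = \<one>\<^bsub>fun_ring X W\<^esub>"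
      for g h
      using sum_one_unit[OF O sub(2,3), of "fun_res X W (W \<inter> U) g" "fun_res X W (W \<inter> U) h"]
        res_closed[OF W(1) O sub(1)] res_add[OF W(1) O sub(1) gh(1,2)] res_one[OF W(1) O sub(1)]
        unit_near_res[OF W(1) O sub(1) _ sub(3)] gh by metis
    ultimately show ?thesis by blast
  qed
  then show ?thesis unfolding locally_ringed_def by blast
qed

lemma finite_type_noetherian:
  fixes X :: "('a, 'r) ringed"
  assumes "field k" and "finite_type_scheme k X \<phi>"
  shows "noetherian_topology (top_of X)"
proof (rule noetherian_topology_local)
  have sch: "is_scheme X" and \<phi>: "\<phi> \<in> ring_hom k (fun_ring X (points X))"
    using assms(2) unfolding finite_type_scheme_def scheme_over_def by auto
  interpret ringed_space_on X using sch unfolding is_scheme_def by unfold_locales simp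
  show "compact_space (top_of X)" using assms(2) unfolding finite_type_scheme_def by simp
  fix x assume "x \<in> points X"
  then obtain U where chart: "openin (top_of X) U" "x \<in> U" "affine_scheme (open_subspace X U)"
    and fg: "fin_gen_algebra k (fun_ring X U) (fun_res X (points X) U \<circ> \<phi>)"
    using assms(2) unfolding finite_type_scheme_def by blast
  obtain A :: "'r ring" and f \<theta> where "cring A" "ringed_space_iso (open_subspace X U) (Spec A) f \<theta>"
    using chart(3) unfolding affine_scheme_def by (elim exE conjE)
  then interpret affine_chart X U A f \<theta>
    using chart(1) ringed_space_on_axioms by (intro affine_chart.intro affine_chart_axioms.intro)
  have "fun_res X (points X) U \<circ> \<phi> \<in> ring_hom k (fun_ring X U)"
    using ring_hom_trans[OF \<phi> res_hom[OF openin_topspace chart(1)]] openin_subset[OF chart(1)] by simp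
  then have "acc_ideals (fun_ring X U) (carrier (fun_ring X U))"
    using fin_gen_algebra_noetherian[OF assms(1) cring_fun[OF chart(1)]] fg by blast
  then show "\<exists>U. openin (top_of X) U \<and> x \<in> U \<and> noetherian_topology (subtopology (top_of X) U)"
    using noetherian_chart[OF scheme_locally_ringed[OF sch]] chart by blast
qed


section \<open>Linear spans in modules\<close>

inductive_set lin_span :: "'r ring \<Rightarrow> ('r, 'm) module \<Rightarrow> 'm set \<Rightarrow> 'm set" for R M T where
  zero: "\<zero>\<^bsub>M\<^esub> \<in> lin_span R M T"
| gen: "x \<in> T \<Longrightarrow> x \<in> lin_span R M T"
| add: "x \<in> lin_span R M T \<Longrightarrow> y \<in> lin_span R M T \<Longrightarrow> x \<oplus>\<^bsub>M\<^esub> y \<in> lin_span R M T"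
| smult: "a \<in> carrier R \<Longrightarrow> x \<in> lin_span R M T \<Longrightarrow> a \<odot>\<^bsub>M\<^esub> x \<in> lin_span R M T"

lemma lin_span_least:
  assumes "x \<in> lin_span R M T" and "T \<subseteq> lin_span R M T'"
  shows "x \<in> lin_span R M T'"
  using assms(1) by induction (use assms(2) in \<open>auto intro: lin_span.intros\<close>)

lemma lin_span_mono: "T \<subseteq> T' \<Longrightarrow> lin_span R M T \<subseteq> lin_span R M T'"
proof
  fix x assume "T \<subseteq> T'" "x \<in> lin_span R M T"
  then show "x \<in> lin_span R M T'" by (elim lin_span_least) (blast intro: lin_span.gen)
qed

locale span_module = module R M for R :: "'r ring" and M :: "('r, 'm) module"
begin

lemma span_carrier: "T \<subseteq> carrier M \<Longrightarrow> x \<in> lin_span R M T \<Longrightarrow> x \<in> carrier M"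
  by (erule lin_span.induct) auto

lemma span_insert:
  assumes x: "x \<in> lin_span R M (insert y T)" and y: "y \<in> carrier M" and T: "T \<subseteq> carrier M"
  shows "\<exists>b\<in>carrier R. \<exists>\<tau>\<in>lin_span R M T. x = \<tau> \<oplus>\<^bsub>M\<^esub> b \<odot>\<^bsub>M\<^esub> y"
  using x
proof induction
  case zero
  have "\<zero>\<^bsub>M\<^esub> = \<zero>\<^bsub>M\<^esub> \<oplus>\<^bsub>M\<^esub> \<zero>\<^bsub>R\<^esub> \<odot>\<^bsub>M\<^esub> y" using y by simp
  then show ?case using lin_span.zero R.zero_closed by metis
next
  case (gen z)
  show ?case
  proof (cases "z = y")
    case True
    then have "z = \<zero>\<^bsub>M\<^esub> \<oplus>\<^bsub>M\<^esub> \<one>\<^bsub>R\<^esub> \<odot>\<^bsub>M\<^esub> y" using y by simp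
    then show ?thesis using lin_span.zero R.one_closed by metis
  next
    case False
    then have z: "z \<in> T" using gen by blast
    then have "z = z \<oplus>\<^bsub>M\<^esub> \<zero>\<^bsub>R\<^esub> \<odot>\<^bsub>M\<^esub> y" using y T by auto
    then show ?thesis using lin_span.gen[OF z] R.zero_closed by metis
  qed
next
  case (add u v)
  then obtain b \<tau> c \<sigma> where *: "b \<in> carrier R" "c \<in> carrier R" "\<tau> \<in> lin_span R M T" "\<sigma> \<in> lin_span R M T"
    and eq: "u = \<tau> \<oplus>\<^bsub>M\<^esub> b \<odot>\<^bsub>M\<^esub> y" "v = \<sigma> \<oplus>\<^bsub>M\<^esub> c \<odot>\<^bsub>M\<^esub> y" by blast
  have "u \<oplus>\<^bsub>M\<^esub> v = (\<tau> \<oplus>\<^bsub>M\<^esub> \<sigma>) \<oplus>\<^bsub>M\<^esub> (b \<oplus>\<^bsub>R\<^esub> c) \<odot>\<^bsub>M\<^esub> y"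
    using * y span_carrier[OF T] by (simp add: eq smult_l_distr M.a_ac)
  then show ?case using * lin_span.add[OF *(3,4)] R.a_closed by metis
next
  case (smult a u)
  then obtain b \<tau> where *: "b \<in> carrier R" "\<tau> \<in> lin_span R M T"
    and eq: "u = \<tau> \<oplus>\<^bsub>M\<^esub> b \<odot>\<^bsub>M\<^esub> y" by blast
  have "a \<odot>\<^bsub>M\<^esub> u = a \<odot>\<^bsub>M\<^esub> \<tau> \<oplus>\<^bsub>M\<^esub> (a \<otimes>\<^bsub>R\<^esub> b) \<odot>\<^bsub>M\<^esub> y"
    using * y smult(1) span_carrier[OF T] by (simp add: eq smult_r_distr smult_assoc1)
  then show ?case using * smult(1) lin_span.smult[OF smult(1) *(2)] R.m_closed by metis
qed

lemma span_finsum: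
  assumes "finite F" "T \<subseteq> carrier M" "\<And>i. i \<in> F \<Longrightarrow> g i \<in> lin_span R M T"
  shows "(\<Oplus>\<^bsub>M\<^esub>i\<in>F. g i) \<in> lin_span R M T"
  using assms(1,3)
proof (induction F rule: finite_induct)
  case empty
  then show ?case by (simp add: lin_span.zero)
next
  case (insert i F)
  then have "(\<Oplus>\<^bsub>M\<^esub>i\<in>insert i F. g i) = g i \<oplus>\<^bsub>M\<^esub> (\<Oplus>\<^bsub>M\<^esub>i\<in>F. g i)"
    using span_carrier[OF assms(2)] by (intro M.finsum_insert) auto
  then show ?case using insert by (simp add: lin_span.add)
qed

lemma span_lessThan:
  fixes t :: nat
  assumes "m \<in> {..<t} \<rightarrow> carrier M" and "x \<in> lin_span R M (m ` {..<t})"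
  shows "\<exists>a\<in>{..<t} \<rightarrow>\<^sub>E carrier R. x = (\<Oplus>\<^bsub>M\<^esub>i\<in>{..<t}. a i \<odot>\<^bsub>M\<^esub> m i)"
  using assms
proof (induction t arbitrary: x)
  case 0
  have "x \<in> lin_span R M {}" using 0(2) by simp
  then have "x = \<zero>\<^bsub>M\<^esub>" by induction auto
  then show ?case by auto
next
  case (Suc t)
  have m: "m \<in> {..<t} \<rightarrow> carrier M" "m t \<in> carrier M" using Suc.prems(1) by auto
  have "x \<in> lin_span R M (insert (m t) (m ` {..<t}))"
    using Suc.prems(2) by (simp add: lessThan_Suc)
  then obtain b \<tau> where b: "b \<in> carrier R" and \<tau>: "\<tau> \<in> lin_span R M (m ` {..<t})"
    and x: "x = \<tau> \<oplus>\<^bsub>M\<^esub> b \<odot>\<^bsub>M\<^esub> m t"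
    using span_insert m by (metis funcset_image)
  obtain a where a: "a \<in> {..<t} \<rightarrow>\<^sub>E carrier R" "\<tau> = (\<Oplus>\<^bsub>M\<^esub>i\<in>{..<t}. a i \<odot>\<^bsub>M\<^esub> m i)"
    using Suc.IH[OF m(1) \<tau>] by blast
  let ?a = "a(t := b)"
  have a': "?a \<in> {..<Suc t} \<rightarrow>\<^sub>E carrier R"
    using a(1) b by (auto simp: PiE_iff extensional_def)
  have aR: "a i \<in> carrier R" if "i < t" for i using a(1) that by (auto simp: PiE_iff)
  have "(\<Oplus>\<^bsub>M\<^esub>i\<in>{..<Suc t}. ?a i \<odot>\<^bsub>M\<^esub> m i) =
      b \<odot>\<^bsub>M\<^esub> m t \<oplus>\<^bsub>M\<^esub> (\<Oplus>\<^bsub>M\<^esub>i\<in>{..<t}. ?a i \<odot>\<^bsub>M\<^esub> m i)"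
    unfolding lessThan_Suc using m b aR by (subst M.finsum_insert) (auto simp: Pi_iff)
  also have "(\<Oplus>\<^bsub>M\<^esub>i\<in>{..<t}. ?a i \<odot>\<^bsub>M\<^esub> m i) = \<tau>"
    unfolding a(2) using m aR by (intro M.finsum_cong') (auto simp: Pi_iff)
  also have "b \<odot>\<^bsub>M\<^esub> m t \<oplus>\<^bsub>M\<^esub> \<tau> = x"
    unfolding x using b m \<tau> span_carrier[of "m ` {..<t}" \<tau>] by (intro M.a_comm) auto
  finally show ?case using a' by blast
qed

text \<open>
  Write \<open>x\<close> as a combination of \<open>T\<close> and \<open>Y\<close>. Either all coefficients at \<open>Y\<close> can be taken in \<open>I\<close>, or
  one of them, at \<open>y\<close> say, is outside \<open>I\<close>; for \<open>I\<close> the non-units of a local ring, \<open>x\<close> can then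
  replace \<open>y\<close>.
\<close>
lemma span_split:
  assumes "finite Y" and "I \<subseteq> carrier R" and "T \<subseteq> carrier M" "Y \<subseteq> carrier M"
    and "x \<in> lin_span R M (T \<union> Y)"
  shows "x \<in> lin_span R M (T \<union> {b \<odot>\<^bsub>M\<^esub> y | b y. b \<in> I \<and> y \<in> Y}) \<or>
    (\<exists>y\<in>Y. \<exists>b\<in>carrier R - I. \<exists>\<tau>\<in>lin_span R M (T \<union> (Y - {y})). x = \<tau> \<oplus>\<^bsub>M\<^esub> b \<odot>\<^bsub>M\<^esub> y)"
  using assms(1,4,5)
proof (induction Y arbitrary: x rule: finite_induct)
  case empty
  then show ?case by simp
next
  case (insert y Y)
  have Y: "y \<in> carrier M" "Y \<subseteq> carrier M" using insert.prems by auto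
  obtain b \<tau> where b: "b \<in> carrier R" and \<tau>: "\<tau> \<in> lin_span R M (T \<union> Y)" and x: "x = \<tau> \<oplus>\<^bsub>M\<^esub> b \<odot>\<^bsub>M\<^esub> y"
    using span_insert[of x y "T \<union> Y"] insert.prems assms(3) by auto
  show ?case
  proof (cases "b \<in> I")
    case False
    have "insert y Y - {y} = Y" using insert.hyps by blast
    then have "\<tau> \<in> lin_span R M (T \<union> (insert y Y - {y}))" using \<tau> by (simp only:)
    moreover have "b \<in> carrier R - I" "y \<in> insert y Y" using b False by simp_all
    ultimately show ?thesis
      using x by (intro disjI2 bexI[of _ y] bexI[of _ b] bexI[of _ \<tau>])
  next
    case True
    let ?I = "\<lambda>Y. {b \<odot>\<^bsub>M\<^esub> y | b y. b \<in> I \<and> y \<in> Y}"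
    from insert.IH[OF Y(2) \<tau>] show ?thesis
    proof
      assume "\<tau> \<in> lin_span R M (T \<union> ?I Y)"
      moreover have "T \<union> ?I Y \<subseteq> T \<union> ?I (insert y Y)" by blast
      ultimately have "\<tau> \<in> lin_span R M (T \<union> ?I (insert y Y))" using lin_span_mono by blast
      moreover have "b \<odot>\<^bsub>M\<^esub> y \<in> lin_span R M (T \<union> ?I (insert y Y))"
        using True by (intro lin_span.gen) blast
      ultimately have "x \<in> lin_span R M (T \<union> ?I (insert y Y))" unfolding x by (rule lin_span.add)
      then show ?thesis by (rule disjI1)
    next
      assume "\<exists>y\<in>Y. \<exists>b\<in>carrier R - I. \<exists>\<sigma>\<in>lin_span R M (T \<union> (Y - {y})). \<tau> = \<sigma> \<oplus>\<^bsub>M\<^esub> b \<odot>\<^bsub>M\<^esub> y"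
      then obtain y' b' \<sigma> where *: "y' \<in> Y" "b' \<in> carrier R - I" "\<sigma> \<in> lin_span R M (T \<union> (Y - {y'}))"
        "\<tau> = \<sigma> \<oplus>\<^bsub>M\<^esub> b' \<odot>\<^bsub>M\<^esub> y'" by blast
      let ?T = "T \<union> (insert y Y - {y'})"
      have "y \<noteq> y'" using * insert.hyps by blast
      have "T \<union> (Y - {y'}) \<subseteq> ?T" by blast
      then have "\<sigma> \<in> lin_span R M ?T" using *(3) lin_span_mono by blast
      moreover have "b \<odot>\<^bsub>M\<^esub> y \<in> lin_span R M ?T"
        using b \<open>y \<noteq> y'\<close> by (intro lin_span.smult lin_span.gen) auto
      ultimately have "\<sigma> \<oplus>\<^bsub>M\<^esub> b \<odot>\<^bsub>M\<^esub> y \<in> lin_span R M ?T" by (rule lin_span.add)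
      moreover have "x = (\<sigma> \<oplus>\<^bsub>M\<^esub> b \<odot>\<^bsub>M\<^esub> y) \<oplus>\<^bsub>M\<^esub> b' \<odot>\<^bsub>M\<^esub> y'"
      proof -
        have "\<sigma> \<in> carrier M" using *(3) Y assms(3) span_carrier[of "T \<union> (Y - {y'})" \<sigma>] by blast
        moreover have "y' \<in> carrier M" using * Y by blast
        ultimately show ?thesis unfolding x *(4) using b * Y by (simp add: M.a_ac)
      qed
      moreover have "y' \<in> insert y Y" using *(1) by simp
      ultimately show ?thesis using *(2)
        by (intro disjI2 bexI[of _ y'] bexI[of _ b'] bexI[of _ "\<sigma> \<oplus>\<^bsub>M\<^esub> b \<odot>\<^bsub>M\<^esub> y"])
    qed
  qed
qed

text \<open>
  Applied to \<open>x = y\<close>, this gives \<open>y = \<tau> + b y\<close> with \<open>b \<in> I\<close>, which is where Nakayama's lemma comes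
  from.
\<close>
lemma span_ideal_coefficient:
  assumes I: "sub_ideal R (carrier R) I" and T: "T \<subseteq> carrier M" and Y: "Y \<subseteq> carrier M" and y: "y \<in> Y"
    and x: "x \<in> lin_span R M (T \<union> {b \<odot>\<^bsub>M\<^esub> y | b y. b \<in> I \<and> y \<in> Y})"
  shows "\<exists>b\<in>I. \<exists>\<tau>\<in>lin_span R M (T \<union> (Y - {y})). x = \<tau> \<oplus>\<^bsub>M\<^esub> b \<odot>\<^bsub>M\<^esub> y"
  using x
proof induction
  have yM: "y \<in> carrier M" and I0: "\<zero>\<^bsub>R\<^esub> \<in> I" and IR: "I \<subseteq> carrier R"
    and Iadd: "\<And>a b. a \<in> I \<Longrightarrow> b \<in> I \<Longrightarrow> a \<oplus>\<^bsub>R\<^esub> b \<in> I"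
    and Imult: "\<And>a b. a \<in> carrier R \<Longrightarrow> b \<in> I \<Longrightarrow> a \<otimes>\<^bsub>R\<^esub> b \<in> I"
    using I Y y unfolding sub_ideal_def by auto
  let ?T = "T \<union> (Y - {y})"
  have sp: "\<tau> \<in> lin_span R M ?T \<Longrightarrow> \<tau> \<in> carrier M" for \<tau>
    using span_carrier[of ?T \<tau>] T Y by blast
  {
    case zero
    have "\<zero>\<^bsub>M\<^esub> = \<zero>\<^bsub>M\<^esub> \<oplus>\<^bsub>M\<^esub> \<zero>\<^bsub>R\<^esub> \<odot>\<^bsub>M\<^esub> y" using yM by simp
    then show ?case using lin_span.zero I0 by metis
  next
    case (gen z)
    then consider "z \<in> T" | b y' where "z = b \<odot>\<^bsub>M\<^esub> y'" "b \<in> I" "y' \<in> Y" by blast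
    then show ?case
    proof cases
      case 1
      then have "z \<in> lin_span R M ?T" by (intro lin_span.gen) blast
      moreover have "z = z \<oplus>\<^bsub>M\<^esub> \<zero>\<^bsub>R\<^esub> \<odot>\<^bsub>M\<^esub> y" using yM T 1 by auto
      ultimately show ?thesis using I0 by metis
    next
      case 2
      have bR: "b \<in> carrier R" and y'M: "y' \<in> carrier M" using 2 IR Y by auto
      show ?thesis
      proof (cases "y' = y")
        case True
        then have "z = \<zero>\<^bsub>M\<^esub> \<oplus>\<^bsub>M\<^esub> b \<odot>\<^bsub>M\<^esub> y" using 2 bR yM by simp
        then show ?thesis using lin_span.zero 2(2) by metis
      next
        case False
        then have "z \<in> lin_span R M ?T" unfolding 2(1) using 2 bR
          by (intro lin_span.smult lin_span.gen) auto
        moreover have "z = z \<oplus>\<^bsub>M\<^esub> \<zero>\<^bsub>R\<^esub> \<odot>\<^bsub>M\<^esub> y" using yM bR y'M 2(1) by auto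
        ultimately show ?thesis using I0 by metis
      qed
    qed
  next
    case (add u v)
    then obtain b \<tau> c \<sigma> where *: "b \<in> I" "c \<in> I" "\<tau> \<in> lin_span R M ?T" "\<sigma> \<in> lin_span R M ?T"
      and eq: "u = \<tau> \<oplus>\<^bsub>M\<^esub> b \<odot>\<^bsub>M\<^esub> y" "v = \<sigma> \<oplus>\<^bsub>M\<^esub> c \<odot>\<^bsub>M\<^esub> y" by blast
    have "b \<in> carrier R" "c \<in> carrier R" using * IR by auto
    then have "u \<oplus>\<^bsub>M\<^esub> v = (\<tau> \<oplus>\<^bsub>M\<^esub> \<sigma>) \<oplus>\<^bsub>M\<^esub> (b \<oplus>\<^bsub>R\<^esub> c) \<odot>\<^bsub>M\<^esub> y"
      using * yM sp by (simp add: eq smult_l_distr M.a_ac)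
    then show ?case using lin_span.add[OF *(3,4)] Iadd[OF *(1,2)] by metis
  next
    case (smult a u)
    then obtain b \<tau> where *: "b \<in> I" "\<tau> \<in> lin_span R M ?T"
      and eq: "u = \<tau> \<oplus>\<^bsub>M\<^esub> b \<odot>\<^bsub>M\<^esub> y" by blast
    have "b \<in> carrier R" using * IR by auto
    then have "a \<odot>\<^bsub>M\<^esub> u = a \<odot>\<^bsub>M\<^esub> \<tau> \<oplus>\<^bsub>M\<^esub> (a \<otimes>\<^bsub>R\<^esub> b) \<odot>\<^bsub>M\<^esub> y"
      using * yM smult(1) sp by (simp add: eq smult_r_distr smult_assoc1)
    then show ?case using lin_span.smult[OF smult(1) *(2)] Imult[OF smult(1) *(1)] by metis
  }
qed

end


section \<open>Avoiding finitely many submodules\<close>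

text \<open>
  Induction on the number of submodules: if \<open>x\<close> lies in \<open>B\<close> but avoids the others, and \<open>y\<close> avoids \<open>B\<close>, then \<open>y + c x\<close>
  avoids \<open>B\<close> for every scalar \<open>c\<close>, and meets each of the others for at most one \<open>c\<close>, since the
  difference of two values is an invertible multiple of \<open>x\<close>.
\<close>
lemma (in module) avoid_submodules:
  assumes k: "field k" "infinite (carrier k)" and \<phi>: "\<phi> \<in> ring_hom k R"
    and "finite F" and "\<And>B. B \<in> F \<Longrightarrow> submodule B R M \<and> B \<noteq> carrier M"
  shows "\<exists>x\<in>carrier M. \<forall>B\<in>F. x \<notin> B"
  using assms(4,5)
proof (induction F rule: finite_induct)
  case empty
  then show ?case using M.zero_closed by blast
next
  case (insert B F)
  interpret k: field k by (rule k(1))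
  interpret h: ring_hom_ring k R \<phi> by (rule ring_hom_ringI2[OF k.ring_axioms R.ring_axioms \<phi>])
  obtain x where x: "x \<in> carrier M" "\<forall>C\<in>F. x \<notin> C" using insert by blast
  have B: "submodule B R M" "B \<noteq> carrier M" using insert.prems by auto
  show ?case
  proof (cases "x \<in> B")
    case False
    then show ?thesis using x by blast
  next
    case True
    obtain y where y: "y \<in> carrier M" "y \<notin> B" using B submoduleE(1)[OF B(1)] by blast
    (* the line through y in the direction x, which is parallel to B *)
    define z where "z c = y \<oplus>\<^bsub>M\<^esub> \<phi> c \<odot>\<^bsub>M\<^esub> x" for c
    have zM: "z c \<in> carrier M" if "c \<in> carrier k" for c using that x y unfolding z_def by simp
    have zB: "z c \<notin> B" if c: "c \<in> carrier k" for c
    proof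
      assume "z c \<in> B"
      then have "z c \<oplus>\<^bsub>M\<^esub> \<ominus>\<^bsub>M\<^esub> (\<phi> c \<odot>\<^bsub>M\<^esub> x) \<in> B"
        using submoduleE[OF B(1)] True c by simp
      moreover have "z c \<oplus>\<^bsub>M\<^esub> \<ominus>\<^bsub>M\<^esub> (\<phi> c \<odot>\<^bsub>M\<^esub> x) = y"
        unfolding z_def using x y c by (simp add: M.a_assoc M.r_neg)
      ultimately show False using y(2) by simp
    qed
    have unique: "b = c" if bc: "b \<in> carrier k" "c \<in> carrier k" "z b \<in> C" "z c \<in> C" and C: "C \<in> F" for b c C
    proof (rule ccontr)
      assume "b \<noteq> c"
      let ?d = "b \<ominus>\<^bsub>k\<^esub> c"
      have sC: "submodule C R M" using insert.prems C by blast
      have d: "?d \<in> carrier k" "?d \<noteq> \<zero>\<^bsub>k\<^esub>" using bc(1,2) \<open>b \<noteq> c\<close> by auto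
      then have u: "inv\<^bsub>k\<^esub> ?d \<in> carrier k" "inv\<^bsub>k\<^esub> ?d \<otimes>\<^bsub>k\<^esub> ?d = \<one>\<^bsub>k\<^esub>"
        using k.field_Units by auto
      have "z b \<oplus>\<^bsub>M\<^esub> \<ominus>\<^bsub>M\<^esub> z c \<in> C" using submoduleE[OF sC] bc by simp
      moreover have "z b \<oplus>\<^bsub>M\<^esub> \<ominus>\<^bsub>M\<^esub> z c = \<phi> ?d \<odot>\<^bsub>M\<^esub> x"
      proof -
        have carr: "\<phi> b \<odot>\<^bsub>M\<^esub> x \<in> carrier M" "\<phi> c \<odot>\<^bsub>M\<^esub> x \<in> carrier M" using x bc by simp_all
        have "\<phi> ?d \<odot>\<^bsub>M\<^esub> x = \<phi> b \<odot>\<^bsub>M\<^esub> x \<oplus>\<^bsub>M\<^esub> \<ominus>\<^bsub>M\<^esub> (\<phi> c \<odot>\<^bsub>M\<^esub> x)"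
          using x bc(1,2) by (simp add: k.minus_eq smult_l_distr smult_l_minus)
        moreover have "z b \<oplus>\<^bsub>M\<^esub> \<ominus>\<^bsub>M\<^esub> z c = \<phi> b \<odot>\<^bsub>M\<^esub> x \<oplus>\<^bsub>M\<^esub> \<ominus>\<^bsub>M\<^esub> (\<phi> c \<odot>\<^bsub>M\<^esub> x)"
        proof -
          have "z b \<oplus>\<^bsub>M\<^esub> \<ominus>\<^bsub>M\<^esub> z c =
              (y \<oplus>\<^bsub>M\<^esub> \<ominus>\<^bsub>M\<^esub> y) \<oplus>\<^bsub>M\<^esub> (\<phi> b \<odot>\<^bsub>M\<^esub> x \<oplus>\<^bsub>M\<^esub> \<ominus>\<^bsub>M\<^esub> (\<phi> c \<odot>\<^bsub>M\<^esub> x))"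
            unfolding z_def using carr y by (simp only: M.minus_add M.a_closed M.a_inv_closed M.a_ac)
          then show ?thesis using carr y by (simp add: M.r_neg)
        qed
        ultimately show ?thesis by simp
      qed
      ultimately have "\<phi> (inv\<^bsub>k\<^esub> ?d) \<odot>\<^bsub>M\<^esub> (\<phi> ?d \<odot>\<^bsub>M\<^esub> x) \<in> C"
        using submoduleE(4)[OF sC] u(1) by simp
      moreover have "\<phi> (inv\<^bsub>k\<^esub> ?d) \<odot>\<^bsub>M\<^esub> (\<phi> ?d \<odot>\<^bsub>M\<^esub> x) = x"
      proof -
        have "\<phi> (inv\<^bsub>k\<^esub> ?d) \<otimes>\<^bsub>R\<^esub> \<phi> ?d = \<one>\<^bsub>R\<^esub>"
          using h.hom_mult[OF u(1) d(1)] u(2) by simp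
        then show ?thesis using smult_assoc1[of "\<phi> (inv\<^bsub>k\<^esub> ?d)" "\<phi> ?d" x] u(1) d(1) x(1) by simp
      qed
      ultimately show False using x(2) C by simp
    qed
    have "finite {c \<in> carrier k. z c \<in> C}" if C: "C \<in> F" for C
    proof (cases "{c \<in> carrier k. z c \<in> C} = {}")
      case True
      then show ?thesis by (simp only: finite.emptyI)
    next
      case False
      then obtain c where c: "c \<in> carrier k" "z c \<in> C" by blast
      have "{c \<in> carrier k. z c \<in> C} \<subseteq> {c}" using unique[OF _ c(1) _ c(2) C] by blast
      then show ?thesis using finite_subset by blast
    qed
    then have "finite (\<Union>C\<in>F. {c \<in> carrier k. z c \<in> C})" using insert.hyps by blast
    then obtain c where c: "c \<in> carrier k" "c \<notin> (\<Union>C\<in>F. {c \<in> carrier k. z c \<in> C})"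
      using k(2) by (meson finite_subset subsetI)
    then show ?thesis using zM[OF c(1)] zB[OF c(1)] by (intro bexI[of _ "z c"]) auto
  qed
qed


section \<open>Generation of a sheaf of modules near a point\<close>

locale module_sheaf_on = ringed_space_on X for X :: "('a, 'r) ringed" +
  fixes M :: "('a, 'r, 'm) sheaf_mod"
  assumes module_sheaf: "module_sheaf X M"
begin

abbreviation S :: "'a set \<Rightarrow> 'm set" where
  "S W \<equiv> carrier (sec M W)"

abbreviation span_on :: "'a set \<Rightarrow> 'm set \<Rightarrow> 'm set" where
  "span_on W T \<equiv> lin_span (fun_ring X W) (sec M W) T"

lemma sheaf_sec: "sheaf (top_of X) S (sec_res M)"
  using module_sheaf unfolding module_sheaf_def by simp

lemma module_sec: "openin (top_of X) W \<Longrightarrow> span_module (fun_ring X W) (sec M W)"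
  using module_sheaf unfolding module_sheaf_def span_module_def by simp

lemma sres_closed:
  assumes "openin (top_of X) U" "openin (top_of X) V" "V \<subseteq> U" "x \<in> S U"
  shows "sec_res M U V x \<in> S V"
proof -
  have "sec_res M U V \<in> S U \<rightarrow> S V" using sheaf_sec assms(1-3) unfolding sheaf_def by simp
  then show ?thesis using assms(4) by (rule funcset_mem)
qed

lemma sres_id: "openin (top_of X) U \<Longrightarrow> x \<in> S U \<Longrightarrow> sec_res M U U x = x"
  using sheaf_sec unfolding sheaf_def by simp

lemma sres_sres:
  "openin (top_of X) U \<Longrightarrow> openin (top_of X) V \<Longrightarrow> openin (top_of X) W \<Longrightarrow> W \<subseteq> V \<Longrightarrow> V \<subseteq> U \<Longrightarrow>
    x \<in> S U \<Longrightarrow> sec_res M V W (sec_res M U V x) = sec_res M U W x"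
  using sheaf_sec unfolding sheaf_def by simp

lemma sres_add:
  "openin (top_of X) U \<Longrightarrow> openin (top_of X) V \<Longrightarrow> V \<subseteq> U \<Longrightarrow> x \<in> S U \<Longrightarrow> y \<in> S U \<Longrightarrow>
    sec_res M U V (x \<oplus>\<^bsub>sec M U\<^esub> y) = sec_res M U V x \<oplus>\<^bsub>sec M V\<^esub> sec_res M U V y"
  using module_sheaf unfolding module_sheaf_def by simp

lemma sres_smult:
  "openin (top_of X) U \<Longrightarrow> openin (top_of X) V \<Longrightarrow> V \<subseteq> U \<Longrightarrow> a \<in> carrier (fun_ring X U) \<Longrightarrow> x \<in> S U \<Longrightarrow>
    sec_res M U V (a \<odot>\<^bsub>sec M U\<^esub> x) = fun_res X U V a \<odot>\<^bsub>sec M V\<^esub> sec_res M U V x"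
  using module_sheaf unfolding module_sheaf_def by simp

lemma sres_zero:
  assumes "openin (top_of X) U" "openin (top_of X) V" "V \<subseteq> U"
  shows "sec_res M U V \<zero>\<^bsub>sec M U\<^esub> = \<zero>\<^bsub>sec M V\<^esub>"
proof -
  interpret U: span_module "fun_ring X U" "sec M U" by (rule module_sec[OF assms(1)])
  interpret V: span_module "fun_ring X V" "sec M V" by (rule module_sec[OF assms(2)])
  have "sec_res M U V \<zero>\<^bsub>sec M U\<^esub> = sec_res M U V (\<zero>\<^bsub>fun_ring X U\<^esub> \<odot>\<^bsub>sec M U\<^esub> \<zero>\<^bsub>sec M U\<^esub>)" by simp
  also have "\<dots> = \<zero>\<^bsub>sec M V\<^esub>"
    using sres_closed[OF assms, of "\<zero>\<^bsub>sec M U\<^esub>"]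
    by (subst sres_smult[OF assms]) (simp_all add: res_zero[OF assms])
  finally show ?thesis .
qed

lemma span_res:
  assumes "openin (top_of X) U" "openin (top_of X) V" "V \<subseteq> U" and T: "T \<subseteq> S U" and x: "x \<in> span_on U T"
  shows "sec_res M U V x \<in> span_on V (sec_res M U V ` T)"
proof -
  interpret U: span_module "fun_ring X U" "sec M U" by (rule module_sec[OF assms(1)])
  show ?thesis using x
  proof induction
    case zero
    then show ?case by (simp add: sres_zero[OF assms(1-3)] lin_span.zero)
  next
    case (gen x)
    then show ?case by (intro lin_span.gen) simp
  next
    case (add x y)
    then show ?case using U.span_carrier[OF T] sres_add[OF assms(1-3)] lin_span.add by metis
  next
    case (smult a x)
    then show ?case
      using U.span_carrier[OF T] sres_smult[OF assms(1-3)] lin_span.smult res_closed[OF assms(1-3)] by metis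
  qed
qed

lemma sres_image_image:
  assumes "openin (top_of X) U" "openin (top_of X) V" "openin (top_of X) W" "W \<subseteq> V" "V \<subseteq> U" "T \<subseteq> S U"
  shows "sec_res M V W ` sec_res M U V ` T = sec_res M U W ` T"
  unfolding image_image using assms sres_sres by (intro image_cong) auto

lemma sres_image_closed:
  "openin (top_of X) U \<Longrightarrow> openin (top_of X) V \<Longrightarrow> V \<subseteq> U \<Longrightarrow> T \<subseteq> S U \<Longrightarrow> sec_res M U V ` T \<subseteq> S V"
  using sres_closed by blast

lemma sres_image_id: "openin (top_of X) U \<Longrightarrow> T \<subseteq> S U \<Longrightarrow> sec_res M U U ` T = T"
  using sres_id by force

text \<open>
  Generation over every open subset of \<open>W\<close>, without passing to smaller neighbourhoods. Near a point
  this is no stronger than generation of the stalk for a locally free sheaf of finite rank, because only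
  a basis has to be expressed by the generators.
\<close>
definition spans :: "'a set \<Rightarrow> 'm set \<Rightarrow> bool" where
  "spans W T \<longleftrightarrow> (\<forall>W'. openin (top_of X) W' \<longrightarrow> W' \<subseteq> W \<longrightarrow> S W' \<subseteq> span_on W' (sec_res M W W' ` T))"

lemma spansD:
  assumes "spans W T" "openin (top_of X) W" "T \<subseteq> S W" "x \<in> S W"
  shows "x \<in> span_on W T"
proof -
  have "S W \<subseteq> span_on W (sec_res M W W ` T)" using assms(1,2) unfolding spans_def by simp
  then show ?thesis using assms(4) unfolding sres_image_id[OF assms(2,3)] by (rule subsetD)
qed

lemma spans_res:
  assumes "openin (top_of X) U" "openin (top_of X) V" "V \<subseteq> U" "T \<subseteq> S U" "spans U T"
  shows "spans V (sec_res M U V ` T)"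
  unfolding spans_def
proof (intro allI impI)
  fix W assume W: "openin (top_of X) W" "W \<subseteq> V"
  have "S W \<subseteq> span_on W (sec_res M U W ` T)"
    using assms(3,5) W unfolding spans_def by simp
  then show "S W \<subseteq> span_on W (sec_res M V W ` sec_res M U V ` T)"
    using sres_image_image[OF assms(1,2) W(1,2) assms(3,4)] by simp
qed

lemma spans_trans:
  assumes "openin (top_of X) U" "spans U T" "T' \<subseteq> S U" and sub: "T \<subseteq> span_on U T'"
  shows "spans U T'"
  unfolding spans_def
proof (intro allI impI subsetI)
  fix W x assume W: "openin (top_of X) W" "W \<subseteq> U" and x: "x \<in> S W"
  have "x \<in> span_on W (sec_res M U W ` T)" using assms(2) W x unfolding spans_def by blast
  moreover have "sec_res M U W ` T \<subseteq> span_on W (sec_res M U W ` T')"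
    using sub span_res[OF assms(1) W assms(3)] by blast
  ultimately show "x \<in> span_on W (sec_res M U W ` T')" by (rule lin_span_least)
qed

lemma spans_eliminate:
  assumes W: "openin (top_of X) W" and W': "openin (top_of X) W'" "W' \<subseteq> W"
    and sp: "spans W T" and T: "T \<subseteq> S W" and T': "T' \<subseteq> S W" and sub: "T \<subseteq> insert y T'"
    and y: "sec_res M W W' y \<in> span_on W' (sec_res M W W' ` T')"
  shows "spans W' (sec_res M W W' ` T')"
proof (rule spans_trans[OF W'(1) spans_res[OF W W' T sp] sres_image_closed[OF W W' T']])
  show "sec_res M W W' ` T \<subseteq> span_on W' (sec_res M W W' ` T')"
  proof (rule image_subsetI)
    fix z assume "z \<in> T"
    then consider "z = y" | "z \<in> T'" using sub by blast
    then show "sec_res M W W' z \<in> span_on W' (sec_res M W W' ` T')"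
      using y by cases (auto intro!: lin_span.gen)
  qed
qed

lemma spans_mono:
  assumes "openin (top_of X) U" "spans U T" "T' \<subseteq> S U" "T \<subseteq> T'"
  shows "spans U T'"
  using assms by (intro spans_trans[OF assms(1-3)]) (auto intro: lin_span.gen)

lemma nonunits_ideal:
  assumes "locally_ringed X" "openin (top_of X) W" "p \<in> W"
  shows "sub_ideal (fun_ring X W) (carrier (fun_ring X W)) (nonunits X p W)"
  using nonunits_zero[OF assms] nonunits_add[OF assms(1,2)] nonunits_mult[OF assms(2)]
  unfolding sub_ideal_def by (auto simp: nonunits_def)

text \<open>
  The germs at \<open>p\<close> of its elements lie in \<open>\<langle>T\<rangle> + \<mm> M\<close>, where \<open>\<mm>\<close> is the maximal ideal of the stalk.
  Conversely, if \<open>T\<close> and \<open>Y\<close> generate \<open>M\<close>, any section outside it is a combination of them in which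
  some element of \<open>Y\<close> has a coefficient that is a unit near \<open>p\<close>.
\<close>
definition nonunit_span :: "'a \<Rightarrow> 'a set \<Rightarrow> 'm set \<Rightarrow> 'm set \<Rightarrow> 'm set" where
  "nonunit_span p W T Y = span_on W (T \<union> {b \<odot>\<^bsub>sec M W\<^esub> y | b y. b \<in> nonunits X p W \<and> y \<in> Y})"

lemma solve_near:
  assumes W: "openin (top_of X) W" and T: "T \<subseteq> S W" and y: "y \<in> S W" and b: "b \<in> carrier (fun_ring X W)"
    and u: "unit_near X p W b" and by_span: "b \<odot>\<^bsub>sec M W\<^esub> y \<in> span_on W T"
  shows "\<exists>W'. openin (top_of X) W' \<and> p \<in> W' \<and> W' \<subseteq> W \<and> sec_res M W W' y \<in> span_on W' (sec_res M W W' ` T)"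
proof -
  obtain W' c where W': "openin (top_of X) W'" "p \<in> W'" "W' \<subseteq> W" and c: "c \<in> carrier (fun_ring X W')"
    and eq: "fun_res X W W' b \<otimes>\<^bsub>fun_ring X W'\<^esub> c = \<one>\<^bsub>fun_ring X W'\<^esub>"
    using u unfolding unit_near_def by blast
  interpret W': span_module "fun_ring X W'" "sec M W'" by (rule module_sec[OF W'(1)])
  have b': "fun_res X W W' b \<in> carrier (fun_ring X W')" and y': "sec_res M W W' y \<in> S W'"
    using res_closed[OF W W'(1,3) b] sres_closed[OF W W'(1,3) y] .
  have "c \<odot>\<^bsub>sec M W'\<^esub> sec_res M W W' (b \<odot>\<^bsub>sec M W\<^esub> y) \<in> span_on W' (sec_res M W W' ` T)"
    using span_res[OF W W'(1,3) T by_span] c by (intro lin_span.smult)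
  also have "c \<odot>\<^bsub>sec M W'\<^esub> sec_res M W W' (b \<odot>\<^bsub>sec M W\<^esub> y) =
      (c \<otimes>\<^bsub>fun_ring X W'\<^esub> fun_res X W W' b) \<odot>\<^bsub>sec M W'\<^esub> sec_res M W W' y"
    using b' y' c by (simp add: sres_smult[OF W W'(1,3) b y] W'.smult_assoc1)
  also have "\<dots> = sec_res M W W' y" using eq b' y' c by (simp add: W'.R.m_comm)
  finally show ?thesis using W' by blast
qed

lemma span_diff:
  assumes W: "openin (top_of X) W" and "\<tau> \<in> span_on W T" "x \<in> span_on W T" "T \<subseteq> S W" "z \<in> S W"
    and "x = \<tau> \<oplus>\<^bsub>sec M W\<^esub> z"
  shows "z \<in> span_on W T"
proof -
  interpret W: span_module "fun_ring X W" "sec M W" by (rule module_sec[OF W])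
  have carr: "\<tau> \<in> S W" using W.span_carrier assms by blast
  have "x \<oplus>\<^bsub>sec M W\<^esub> (\<ominus>\<^bsub>fun_ring X W\<^esub> \<one>\<^bsub>fun_ring X W\<^esub>) \<odot>\<^bsub>sec M W\<^esub> \<tau> \<in> span_on W T"
    using assms(2,3) by (intro lin_span.add lin_span.smult) auto
  moreover have "x \<oplus>\<^bsub>sec M W\<^esub> (\<ominus>\<^bsub>fun_ring X W\<^esub> \<one>\<^bsub>fun_ring X W\<^esub>) \<odot>\<^bsub>sec M W\<^esub> \<tau> = z"
  proof -
    have "(\<ominus>\<^bsub>fun_ring X W\<^esub> \<one>\<^bsub>fun_ring X W\<^esub>) \<odot>\<^bsub>sec M W\<^esub> \<tau> = \<ominus>\<^bsub>sec M W\<^esub> \<tau>"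
      using carr by (simp add: W.smult_l_minus)
    moreover have "x = z \<oplus>\<^bsub>sec M W\<^esub> \<tau>" unfolding assms(6) using carr assms(5) by (rule W.M.a_comm)
    ultimately show ?thesis using carr assms(5) by (simp add: W.M.a_assoc W.M.r_neg)
  qed
  ultimately show ?thesis by simp
qed

text \<open>
  Steinitz exchange: the element of \<open>Y\<close> at which \<open>x\<close> has a unit coefficient near \<open>p\<close> is expressed by
  \<open>x\<close> and the other generators.
\<close>
lemma exchange:
  assumes lr: "locally_ringed X" and W: "openin (top_of X) W" "p \<in> W"
    and T: "T \<subseteq> S W" and Y: "Y \<subseteq> S W" "finite Y" and sp: "spans W (T \<union> Y)"
    and x: "x \<in> S W" "x \<notin> nonunit_span p W T Y"
  shows "\<exists>W' y. openin (top_of X) W' \<and> p \<in> W' \<and> W' \<subseteq> W \<and> y \<in> Y \<and>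
    spans W' (sec_res M W W' ` (insert x T \<union> (Y - {y})))"
proof -
  interpret W: span_module "fun_ring X W" "sec M W" by (rule module_sec[OF W(1)])
  let ?R = "fun_ring X W"
  have "x \<in> span_on W (T \<union> Y)" using spansD[OF sp W(1)] T Y x by blast
  moreover have "nonunits X p W \<subseteq> carrier ?R" unfolding nonunits_def by blast
  ultimately have "\<exists>y\<in>Y. \<exists>b\<in>carrier ?R - nonunits X p W. \<exists>\<tau>\<in>span_on W (T \<union> (Y - {y})).
      x = \<tau> \<oplus>\<^bsub>sec M W\<^esub> b \<odot>\<^bsub>sec M W\<^esub> y"
    using W.span_split[OF Y(2) _ T Y(1), of "nonunits X p W" x] x(2) unfolding nonunit_span_def by blast
  then obtain y b \<tau> where y: "y \<in> Y" and b: "b \<in> carrier ?R" "b \<notin> nonunits X p W"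
    and \<tau>: "\<tau> \<in> span_on W (T \<union> (Y - {y}))" and eq: "x = \<tau> \<oplus>\<^bsub>sec M W\<^esub> b \<odot>\<^bsub>sec M W\<^esub> y"
    by (elim bexE DiffE)
  let ?T = "insert x T \<union> (Y - {y})"
  have T': "?T \<subseteq> S W" using T Y x by blast
  have yS: "y \<in> S W" using y Y by blast
  have "T \<union> (Y - {y}) \<subseteq> ?T" by blast
  then have "\<tau> \<in> span_on W ?T" using \<tau> lin_span_mono by blast
  moreover have "x \<in> span_on W ?T" by (intro lin_span.gen) simp
  ultimately have "b \<odot>\<^bsub>sec M W\<^esub> y \<in> span_on W ?T"
    using T' b yS eq by (intro span_diff[OF W(1) _ _ T' _ eq]) auto
  moreover have "unit_near X p W b" using b unfolding nonunits_def by blast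
  ultimately obtain W' where W': "openin (top_of X) W'" "p \<in> W'" "W' \<subseteq> W"
    and y': "sec_res M W W' y \<in> span_on W' (sec_res M W W' ` ?T)"
    using solve_near[OF W(1) T' yS b(1)] by blast
  have "spans W' (sec_res M W W' ` ?T)"
    using T Y by (intro spans_eliminate[OF W(1) W'(1,3) sp _ T' _ y']) auto
  then show ?thesis using W' y by blast
qed

text \<open>
  Nakayama's lemma in the form used here: \<open>y = \<tau> + b y\<close> with a non-unit \<open>b\<close>, and \<open>1 - b\<close> is invertible
  near \<open>p\<close> because the stalk is local.
\<close>
lemma drop_generator:
  assumes lr: "locally_ringed X" and W: "openin (top_of X) W" "p \<in> W"
    and T: "T \<subseteq> S W" and Y: "Y \<subseteq> S W" and sp: "spans W (T \<union> Y)"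
    and y: "y \<in> Y" "y \<in> nonunit_span p W T Y"
  shows "\<exists>W'. openin (top_of X) W' \<and> p \<in> W' \<and> W' \<subseteq> W \<and>
    spans W' (sec_res M W W' ` (T \<union> (Y - {y})))"
proof -
  interpret W: span_module "fun_ring X W" "sec M W" by (rule module_sec[OF W(1)])
  let ?R = "fun_ring X W" and ?T = "T \<union> (Y - {y})"
  have T': "?T \<subseteq> S W" using T Y by blast
  have yS: "y \<in> S W" using y Y by blast
  obtain b \<tau> where b: "b \<in> nonunits X p W" and \<tau>: "\<tau> \<in> span_on W ?T"
    and eq: "y = \<tau> \<oplus>\<^bsub>sec M W\<^esub> b \<odot>\<^bsub>sec M W\<^esub> y"
    using W.span_ideal_coefficient[OF nonunits_ideal[OF lr W] T Y y(1)] y(2)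
    unfolding nonunit_span_def by blast
  have bR: "b \<in> carrier ?R" using b unfolding nonunits_def by blast
  define c where "c = \<one>\<^bsub>?R\<^esub> \<ominus>\<^bsub>?R\<^esub> b"
  have cR: "c \<in> carrier ?R" unfolding c_def using bR by simp
  have cb: "c \<oplus>\<^bsub>?R\<^esub> b = \<one>\<^bsub>?R\<^esub>" unfolding c_def using bR by (simp add: W.R.minus_eq W.R.a_assoc W.R.l_neg)
  have \<tau>S: "\<tau> \<in> S W" using W.span_carrier[OF T' \<tau>] .
  have "c \<odot>\<^bsub>sec M W\<^esub> y = \<tau>"
  proof -
    have "c \<odot>\<^bsub>sec M W\<^esub> y \<oplus>\<^bsub>sec M W\<^esub> b \<odot>\<^bsub>sec M W\<^esub> y = y"
      using W.smult_l_distr[OF cR bR yS] cb yS by simp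
    then have "c \<odot>\<^bsub>sec M W\<^esub> y \<oplus>\<^bsub>sec M W\<^esub> b \<odot>\<^bsub>sec M W\<^esub> y = \<tau> \<oplus>\<^bsub>sec M W\<^esub> b \<odot>\<^bsub>sec M W\<^esub> y"
      using eq by (rule trans)
    then show ?thesis using cR bR yS \<tau>S by (simp add: W.M.add.right_cancel)
  qed
  moreover have "unit_near X p W c"
    using lr W cR bR cb b unfolding locally_ringed_def nonunits_def by blast
  ultimately obtain W' where W': "openin (top_of X) W'" "p \<in> W'" "W' \<subseteq> W"
    and y': "sec_res M W W' y \<in> span_on W' (sec_res M W W' ` ?T)"
    using solve_near[OF W(1) T' yS cR] \<tau> by auto
  have "spans W' (sec_res M W W' ` ?T)"
    using T Y by (intro spans_eliminate[OF W(1) W'(1,3) sp _ T' _ y']) auto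
  then show ?thesis using W' by blast
qed

text \<open>
  For a vector bundle: the values of \<open>T\<close> at \<open>p\<close> span a subspace of the fibre of codimension at most \<open>c\<close>. The
  added generators \<open>Y\<close> are only local, so that a local basis shows that the corank is at most the rank.
\<close>
definition corank_le :: "'m set \<Rightarrow> 'a \<Rightarrow> nat \<Rightarrow> bool" where
  "corank_le T p c \<longleftrightarrow> (\<exists>W Y. openin (top_of X) W \<and> p \<in> W \<and> Y \<subseteq> S W \<and> finite Y \<and> card Y \<le> c \<and>
     spans W (sec_res M (points X) W ` T \<union> Y))"

lemma corank_leI:
  assumes "openin (top_of X) W" "p \<in> W" "Y \<subseteq> S W" "finite Y" "card Y \<le> c"
    "spans W (sec_res M (points X) W ` T \<union> Y)"
  shows "corank_le T p c"
  using assms unfolding corank_le_def by blast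

lemma global_res_closed: "openin (top_of X) W \<Longrightarrow> T \<subseteq> S (points X) \<Longrightarrow> sec_res M (points X) W ` T \<subseteq> S W"
  using openin_subset by (intro sres_image_closed) auto

lemma global_res_res:
  "openin (top_of X) V \<Longrightarrow> openin (top_of X) W \<Longrightarrow> W \<subseteq> V \<Longrightarrow> T \<subseteq> S (points X) \<Longrightarrow>
    sec_res M V W ` sec_res M (points X) V ` T = sec_res M (points X) W ` T"
  by (intro sres_image_image openin_topspace openin_subset)

lemma corank_open: "openin (top_of X) {p \<in> points X. corank_le T p c}"
proof (subst openin_subopen, intro ballI)
  fix p assume "p \<in> {p \<in> points X. corank_le T p c}"
  then obtain W Y where W: "openin (top_of X) W" "p \<in> W" "Y \<subseteq> S W" "finite Y" "card Y \<le> c"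
    "spans W (sec_res M (points X) W ` T \<union> Y)" unfolding corank_le_def by blast
  then have "W \<subseteq> {p \<in> points X. corank_le T p c}"
    using corank_leI openin_subset by blast
  then show "\<exists>W. openin (top_of X) W \<and> p \<in> W \<and> W \<subseteq> {p \<in> points X. corank_le T p c}" using W by blast
qed

lemma corank_mono:
  assumes "T \<subseteq> T'" "T' \<subseteq> S (points X)" "corank_le T p c"
  shows "corank_le T' p c"
proof -
  obtain W Y where W: "openin (top_of X) W" "p \<in> W" "Y \<subseteq> S W" "finite Y" "card Y \<le> c"
    and sp: "spans W (sec_res M (points X) W ` T \<union> Y)" using assms(3) unfolding corank_le_def by blast
  have "spans W (sec_res M (points X) W ` T' \<union> Y)"
    using assms W global_res_closed[OF W(1) assms(2)] by (intro spans_mono[OF W(1) sp]) auto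
  then show ?thesis using corank_leI W by blast
qed

lemma corank_le_leq: "corank_le T p c \<Longrightarrow> c \<le> c' \<Longrightarrow> corank_le T p c'"
  unfolding corank_le_def using le_trans by blast

text \<open>
  Take \<open>c + 1\<close> sections that generate near \<open>p\<close> together with \<open>T\<close>, and let \<open>B\<close> consist of the global
  sections whose coefficients at them can be chosen to be non-units. A section outside \<open>B\<close> replaces one
  of the \<open>c + 1\<close> by exchange. If all global sections were in \<open>B\<close>, so would be, near \<open>p\<close>, everything that
  they generate, in particular the \<open>c + 1\<close> sections themselves, and one of these could be dropped.
\<close>
lemma generic_section:
  assumes lr: "locally_ringed X" and T: "T \<subseteq> S (points X)"
    and c: "corank_le T p (Suc c)" "\<not> corank_le T p c"
    and glob: "\<exists>W. openin (top_of X) W \<and> p \<in> W \<and> spans W (sec_res M (points X) W ` S (points X))"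
  shows "\<exists>B. submodule B (fun_ring X (points X)) (sec M (points X)) \<and> B \<noteq> S (points X) \<and> (\<forall>x\<in>S (points X) - B. corank_le (insert x T) p c)"
proof -
  let ?P = "points X"
  obtain W0 Y0 where W0: "openin (top_of X) W0" "p \<in> W0" "Y0 \<subseteq> S W0" "finite Y0" "card Y0 \<le> Suc c"
    and sp0: "spans W0 (sec_res M ?P W0 ` T \<union> Y0)" using c(1) unfolding corank_le_def by blast
  obtain W1 where W1: "openin (top_of X) W1" "p \<in> W1" and sp1: "spans W1 (sec_res M ?P W1 ` S ?P)"
    using glob by blast
  define W where "W = W0 \<inter> W1"
  have W: "openin (top_of X) W" "p \<in> W" "W \<subseteq> W0" "W \<subseteq> W1" "W \<subseteq> ?P"
    using W0 W1 openin_subset unfolding W_def by auto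
  define Y where "Y = sec_res M W0 W ` Y0"
  define T' where "T' = sec_res M ?P W ` T"
  have Y: "Y \<subseteq> S W" "finite Y" "card Y \<le> Suc c"
    using sres_image_closed[OF W0(1) W(1,3) W0(3)] W0(4,5) card_image_le[OF W0(4)] unfolding Y_def
    by (auto intro: le_trans)
  have T': "T' \<subseteq> S W" unfolding T'_def by (rule global_res_closed[OF W(1) T])
  have sp: "spans W (T' \<union> Y)"
    using spans_res[OF W0(1) W(1,3) _ sp0] global_res_closed[OF W0(1) T] W0(3)
    unfolding Y_def T'_def image_Un global_res_res[OF W0(1) W(1,3) T] by blast
  have gsp: "spans W (sec_res M ?P W ` S ?P)"
    using spans_res[OF W1(1) W(1,4) global_res_closed[OF W1(1) subset_refl] sp1]
    unfolding global_res_res[OF W1(1) W(1,4) subset_refl] .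
  have Wres: "sec_res M W W' ` T' = sec_res M ?P W' ` T" if "openin (top_of X) W'" "W' \<subseteq> W" for W'
    unfolding T'_def using global_res_res[OF W(1) that T] .
  define B where "B = {x \<in> S ?P. sec_res M ?P W x \<in> nonunit_span p W T' Y}"
  note PW = openin_topspace[of "top_of X"] W(1) W(5)
  interpret P: span_module "fun_ring X ?P" "sec M ?P" by (rule module_sec) simp
  have B_smult: "a \<odot>\<^bsub>sec M ?P\<^esub> x \<in> B" if "a \<in> carrier (fun_ring X ?P)" "x \<in> B" for a x
    using that sres_smult[OF PW] res_closed[OF PW] unfolding B_def nonunit_span_def
    by (auto intro: lin_span.smult)
  have "submodule B (fun_ring X ?P) (sec M ?P)"
  proof (rule P.submoduleI)
    show "\<zero>\<^bsub>sec M ?P\<^esub> \<in> B"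
      using sres_zero[OF PW] unfolding B_def nonunit_span_def by (simp add: lin_span.zero)
    show "x \<oplus>\<^bsub>sec M ?P\<^esub> y \<in> B" if "x \<in> B" "y \<in> B" for x y
      using that sres_add[OF PW] unfolding B_def nonunit_span_def by (auto intro: lin_span.add)
    show "\<ominus>\<^bsub>sec M ?P\<^esub> x \<in> B" if x: "x \<in> B" for x
    proof -
      have "x \<in> S ?P" using x unfolding B_def by blast
      then have "\<ominus>\<^bsub>sec M ?P\<^esub> x = (\<ominus>\<^bsub>fun_ring X ?P\<^esub> \<one>\<^bsub>fun_ring X ?P\<^esub>) \<odot>\<^bsub>sec M ?P\<^esub> x"
        by (simp add: P.smult_l_minus)
      then show ?thesis using B_smult[OF _ x] by simp
    qed
    show "B \<subseteq> S ?P" unfolding B_def by blast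
    show "a \<odot>\<^bsub>sec M ?P\<^esub> x \<in> B" if "a \<in> carrier (fun_ring X ?P)" "x \<in> B" for a x
      by (rule B_smult[OF that])
  qed
  moreover have "B \<noteq> S ?P"
  proof
    assume B: "B = S ?P"
    have "Y \<noteq> {}"
    proof
      assume "Y = {}"
      then have "corank_le T p c" using W sp unfolding T'_def by (intro corank_leI[of W p "{}"]) auto
      then show False using c(2) by simp
    qed
    then obtain y where y: "y \<in> Y" by blast
    have "y \<in> span_on W (sec_res M ?P W ` S ?P)"
      using spansD[OF gsp W(1) global_res_closed[OF W(1) subset_refl]] y Y by blast
    moreover have "sec_res M ?P W ` S ?P \<subseteq> nonunit_span p W T' Y" using B unfolding B_def by blast
    ultimately have "y \<in> nonunit_span p W T' Y" unfolding nonunit_span_def by (rule lin_span_least)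
    then obtain W' where W': "openin (top_of X) W'" "p \<in> W'" "W' \<subseteq> W"
      and s: "spans W' (sec_res M W W' ` (T' \<union> (Y - {y})))"
      using drop_generator[OF lr W(1,2) T' Y(1) sp y] by blast
    have "spans W' (sec_res M ?P W' ` T \<union> sec_res M W W' ` (Y - {y}))"
      using s unfolding image_Un Wres[OF W'(1,3)] .
    moreover have "card (sec_res M W W' ` (Y - {y})) \<le> c"
      using card_image_le[of "Y - {y}" "sec_res M W W'"] Y y by (simp add: card_Diff_singleton)
    moreover have "sec_res M W W' ` (Y - {y}) \<subseteq> S W'"
      using Y by (intro sres_image_closed[OF W(1) W'(1,3)]) blast
    ultimately have "corank_le T p c" using W' Y by (intro corank_leI) auto
    then show False using c(2) by simp
  qed
  moreover have "corank_le (insert x T) p c" if x: "x \<in> S ?P - B" for x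
  proof -
    let ?x = "sec_res M ?P W x"
    have xW: "?x \<in> S W" using sres_closed[OF PW] x by blast
    have "?x \<notin> nonunit_span p W T' Y" using x unfolding B_def by blast
    then obtain W' y where W': "openin (top_of X) W'" "p \<in> W'" "W' \<subseteq> W" and y: "y \<in> Y"
      and s: "spans W' (sec_res M W W' ` (insert ?x T' \<union> (Y - {y})))"
      using exchange[OF lr W(1,2) T' Y(1,2) sp xW] by blast
    have "sec_res M W W' ` insert ?x T' = sec_res M ?P W' ` insert x T"
      using Wres[OF W'(1,3)] sres_sres[OF PW(1,2) W'(1,3) PW(3)] x by simp
    then have "spans W' (sec_res M ?P W' ` insert x T \<union> sec_res M W W' ` (Y - {y}))"
      using s unfolding image_Un by simp
    moreover have "card (sec_res M W W' ` (Y - {y})) \<le> c"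
      using card_image_le[of "Y - {y}" "sec_res M W W'"] Y y by (simp add: card_Diff_singleton)
    moreover have "sec_res M W W' ` (Y - {y}) \<subseteq> S W'"
      using Y by (intro sres_image_closed[OF W(1) W'(1,3)]) blast
    ultimately show ?thesis using W' Y by (intro corank_leI) auto
  qed
  ultimately show ?thesis by blast
qed


section \<open>Vector bundles and generic sections\<close>

lemma sections_map_in_span:
  assumes W: "openin (top_of X) W" and m: "m \<in> {..<t} \<rightarrow> S (points X)"
    and a: "a \<in> carrier (sec (free_sheaf X t) W)"
  shows "sections_map X M t m W a \<in> span_on W (sec_res M (points X) W ` m ` {..<t})"
proof -
  interpret W: span_module "fun_ring X W" "sec M W" by (rule module_sec[OF W])
  have aR: "a i \<in> carrier (fun_ring X W)" if "i < t" for i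
    using a that unfolding free_sheaf_def free_module_def by (auto simp: PiE_iff)
  have sub: "sec_res M (points X) W ` m ` {..<t} \<subseteq> S W"
    using m by (intro global_res_closed[OF W]) auto
  show ?thesis unfolding sections_map_def
    by (intro W.span_finsum[OF _ sub] lin_span.smult lin_span.gen) (auto intro: aR)
qed

text \<open>
  The images of the unit vectors generate over every smaller open set. Instead of summing, one clears
  the coordinates one at a time: \<open>l\<close> bounds the indices at which \<open>a\<close> may be nonzero.
\<close>
lemma local_basis:
  assumes vb: "vector_bundle X M n" and p: "p \<in> points X"
  shows "\<exists>U E. openin (top_of X) U \<and> p \<in> U \<and> E \<subseteq> S U \<and> finite E \<and> card E \<le> n \<and> spans U E"
proof -
  obtain U \<psi> where U: "openin (top_of X) U" "p \<in> U"
    and iso: "module_sheaf_iso (open_subspace X U) (free_sheaf (open_subspace X U) n) M \<psi>"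
    using vb p unfolding vector_bundle_def by blast
  let ?F = "\<lambda>W. {..<n} \<rightarrow>\<^sub>E carrier (fun_ring X W)"
  have opU: "openin (top_of (open_subspace X U)) W" if "openin (top_of X) W" "W \<subseteq> U" for W
    using that openin_open_subtopology[OF U(1)] unfolding open_subspace_def by simp
  note iso_simps = module_sheaf_iso_def module_sheaf_hom_def free_sheaf_def free_module_def
  have \<psi>_add: "\<psi> W (\<lambda>i\<in>{..<n}. a i \<oplus>\<^bsub>fun_ring X W\<^esub> b i) = \<psi> W a \<oplus>\<^bsub>sec M W\<^esub> \<psi> W b"
    if "openin (top_of X) W" "W \<subseteq> U" "a \<in> ?F W" "b \<in> ?F W" for W a b
    using iso opU[OF that(1,2)] that(3,4) unfolding iso_simps by (simp add: open_subspace_def)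
  have \<psi>_smult: "\<psi> W (\<lambda>i\<in>{..<n}. c \<otimes>\<^bsub>fun_ring X W\<^esub> a i) = c \<odot>\<^bsub>sec M W\<^esub> \<psi> W a"
    if "openin (top_of X) W" "W \<subseteq> U" "c \<in> carrier (fun_ring X W)" "a \<in> ?F W" for W a c
    using iso opU[OF that(1,2)] that(3,4) unfolding iso_simps by (simp add: open_subspace_def)
  have \<psi>_res: "\<psi> W (\<lambda>i\<in>{..<n}. fun_res X U W (a i)) = sec_res M U W (\<psi> U a)"
    if "openin (top_of X) W" "W \<subseteq> U" "a \<in> ?F U" for W a
    using iso opU[OF that(1,2)] opU[OF U(1) subset_refl] that(2,3) unfolding iso_simps
    by (simp add: open_subspace_def)
  have \<psi>_bij: "bij_betw (\<psi> W) (?F W) (S W)" if "openin (top_of X) W" "W \<subseteq> U" for W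
    using iso opU[OF that(1,2)] unfolding iso_simps by (simp add: open_subspace_def)
  define unit where "unit W j = (\<lambda>i\<in>{..<n}. if i = j then \<one>\<^bsub>fun_ring X W\<^esub> else \<zero>\<^bsub>fun_ring X W\<^esub>)" for W and j :: nat
  have unitF: "unit W j \<in> ?F W" if "openin (top_of X) W" for W j
  proof -
    interpret cring "fun_ring X W" by (rule cring_fun[OF that])
    show ?thesis unfolding unit_def by auto
  qed
  define e where "e j = \<psi> U (unit U j)" for j
  have eS: "e j \<in> S U" for j
    using \<psi>_bij[OF U(1) subset_refl] unitF[OF U(1)] unfolding e_def by (rule bij_betw_apply)
  have e_res: "sec_res M U W (e j) = \<psi> W (unit W j)" if W: "openin (top_of X) W" "W \<subseteq> U" for W j
  proof -
    have "(\<lambda>i\<in>{..<n}. fun_res X U W (unit U j i)) = unit W j"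
      unfolding unit_def by (rule restrict_ext) (simp add: res_one[OF U(1) W] res_zero[OF U(1) W])
    then show ?thesis using \<psi>_res[OF W unitF[OF U(1), of j]] unfolding e_def by simp
  qed
  have "spans U (e ` {..<n})"
    unfolding spans_def
  proof (intro allI impI subsetI)
    fix W x assume W: "openin (top_of X) W" "W \<subseteq> U" and x: "x \<in> S W"
    interpret W: span_module "fun_ring X W" "sec M W" by (rule module_sec[OF W(1)])
    let ?E = "sec_res M U W ` e ` {..<n}"
    have step: "\<psi> W a \<in> span_on W ?E" if "a \<in> ?F W" "\<And>i. l \<le> i \<Longrightarrow> i < n \<Longrightarrow> a i = \<zero>\<^bsub>fun_ring X W\<^esub>" "l \<le> n" for l a
      using that
    proof (induction l arbitrary: a)
      case 0
      have aR: "a i \<in> carrier (fun_ring X W)" if "i < n" for i using 0(1) that by (auto simp: PiE_iff)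
      have "a = (\<lambda>i\<in>{..<n}. \<zero>\<^bsub>fun_ring X W\<^esub> \<otimes>\<^bsub>fun_ring X W\<^esub> a i)"
      proof
        fix i show "a i = (\<lambda>i\<in>{..<n}. \<zero>\<^bsub>fun_ring X W\<^esub> \<otimes>\<^bsub>fun_ring X W\<^esub> a i) i"
          using 0(1) 0(2)[of i] aR[of i] by (cases "i < n") (auto simp: PiE_iff extensional_def)
      qed
      then have "\<psi> W a = \<psi> W (\<lambda>i\<in>{..<n}. \<zero>\<^bsub>fun_ring X W\<^esub> \<otimes>\<^bsub>fun_ring X W\<^esub> a i)"
        by (rule arg_cong)
      also have "\<dots> = \<zero>\<^bsub>fun_ring X W\<^esub> \<odot>\<^bsub>sec M W\<^esub> \<psi> W a"
        by (rule \<psi>_smult[OF W W.R.zero_closed 0(1)])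
      also have "\<dots> = \<zero>\<^bsub>sec M W\<^esub>" using bij_betw_apply[OF \<psi>_bij[OF W] 0(1)] by simp
      finally show ?case by (simp add: lin_span.zero)
    next
      case (Suc l)
      have aR: "a i \<in> carrier (fun_ring X W)" if "i < n" for i using Suc.prems(1) that by (auto simp: PiE_iff)
      have ln: "l < n" using Suc.prems(3) by simp
      let ?b = "\<lambda>i\<in>{..<n}. if i = l then \<zero>\<^bsub>fun_ring X W\<^esub> else a i"
      let ?c = "\<lambda>i\<in>{..<n}. a l \<otimes>\<^bsub>fun_ring X W\<^esub> unit W l i"
      have b: "?b \<in> ?F W" using aR by auto
      have unitR: "unit W l i \<in> carrier (fun_ring X W)" if "i < n" for i
        using unitF[OF W(1), of l] that by (auto simp: PiE_iff)
      then have c: "?c \<in> ?F W" using aR[OF ln] by auto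
      have "a = (\<lambda>i\<in>{..<n}. ?b i \<oplus>\<^bsub>fun_ring X W\<^esub> ?c i)"
      proof
        fix i show "a i = (\<lambda>i\<in>{..<n}. ?b i \<oplus>\<^bsub>fun_ring X W\<^esub> ?c i) i"
          using Suc.prems(1) aR[of i] aR[OF ln]
          by (cases "i < n") (auto simp: PiE_iff extensional_def unit_def)
      qed
      then have "\<psi> W a = \<psi> W (\<lambda>i\<in>{..<n}. ?b i \<oplus>\<^bsub>fun_ring X W\<^esub> ?c i)" by (rule arg_cong)
      also have "\<dots> = \<psi> W ?b \<oplus>\<^bsub>sec M W\<^esub> \<psi> W ?c" by (rule \<psi>_add[OF W b c])
      finally have "\<psi> W a = \<psi> W ?b \<oplus>\<^bsub>sec M W\<^esub> \<psi> W ?c" .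
      moreover have "\<psi> W ?c = a l \<odot>\<^bsub>sec M W\<^esub> sec_res M U W (e l)"
        using \<psi>_smult[OF W aR[OF ln] unitF[OF W(1), of l]] e_res[OF W] by simp
      moreover have "a l \<odot>\<^bsub>sec M W\<^esub> sec_res M U W (e l) \<in> span_on W ?E"
        using aR[OF ln] ln by (intro lin_span.smult lin_span.gen) auto
      moreover have "\<psi> W ?b \<in> span_on W ?E"
      proof (rule Suc.IH[OF b])
        fix i assume "l \<le> i" "i < n"
        then show "?b i = \<zero>\<^bsub>fun_ring X W\<^esub>" using Suc.prems(2)[of i] by (cases "i = l") auto
      qed (use ln in simp)
      ultimately show ?case by (simp add: lin_span.add)
    qed
    have "x \<in> \<psi> W ` ?F W" using \<psi>_bij[OF W] x unfolding bij_betw_def by simp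
    then obtain a where "a \<in> ?F W" "x = \<psi> W a" by blast
    then show "x \<in> span_on W ?E" using step[of a n] by simp
  qed
  moreover have "card (e ` {..<n}) \<le> n" using card_image_le[of "{..<n}" e] by simp
  moreover have "e ` {..<n} \<subseteq> S U" using eS by blast
  ultimately show ?thesis using U by (intro exI[of _ U] exI[of _ "e ` {..<n}"]) simp
qed

text \<open>
  Each of the finitely many elements of a local basis is a combination of global sections near \<open>p\<close>.
\<close>
lemma globally_generated_spans:
  assumes vb: "vector_bundle X M n" and gg: "globally_generated X M" and p: "p \<in> points X"
  shows "\<exists>W. openin (top_of X) W \<and> p \<in> W \<and> spans W (sec_res M (points X) W ` S (points X))"
proof -
  let ?G = "\<lambda>W. sec_res M (points X) W ` S (points X)"
  obtain U E where U: "openin (top_of X) U" "p \<in> U" and E: "E \<subseteq> S U" "finite E" "spans U E"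
    using local_basis[OF vb p] by blast
  have "\<exists>W. openin (top_of X) W \<and> p \<in> W \<and> W \<subseteq> U \<and> (\<forall>e\<in>E. sec_res M U W e \<in> span_on W (?G W))"
    using E(2,1)
  proof (induction E rule: finite_induct)
    case empty
    then show ?case using U by blast
  next
    case (insert e E)
    then obtain W where W: "openin (top_of X) W" "p \<in> W" "W \<subseteq> U"
      "\<forall>e\<in>E. sec_res M U W e \<in> span_on W (?G W)" by blast
    have "openin (top_of X) U \<and> e \<in> S U \<and> p \<in> U" using U insert.prems by simp
    from gg[unfolded globally_generated_def, rule_format, OF this]
    obtain V t m where V: "openin (top_of X) V" "p \<in> V" "V \<subseteq> U" and m: "m \<in> {..<t} \<rightarrow> S (points X)"
      and im: "sec_res M U V e \<in> sections_map X M t m V ` carrier (sec (free_sheaf X t) V)"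
      by (elim exE conjE)
    then obtain a where "a \<in> carrier (sec (free_sheaf X t) V)" "sec_res M U V e = sections_map X M t m V a"
      by blast
    then have "sec_res M U V e \<in> span_on V (sec_res M (points X) V ` m ` {..<t})"
      using sections_map_in_span[OF V(1) m] by simp
    moreover have "sec_res M (points X) V ` m ` {..<t} \<subseteq> ?G V" using m by auto
    ultimately have eV: "sec_res M U V e \<in> span_on V (?G V)" using lin_span_mono by blast
    have O: "openin (top_of X) (W \<inter> V)" using W V by blast
    have small: "sec_res M U (W \<inter> V) s \<in> span_on (W \<inter> V) (?G (W \<inter> V))"
      if A: "openin (top_of X) A" "A \<subseteq> U" "W \<inter> V \<subseteq> A" and s: "s \<in> S U" "sec_res M U A s \<in> span_on A (?G A)" for A s
      using span_res[OF A(1) O A(3) global_res_closed[OF A(1) subset_refl] s(2)]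
      unfolding global_res_res[OF A(1) O A(3) subset_refl] sres_sres[OF U(1) A(1) O A(3,2) s(1)] .
    have "sec_res M U (W \<inter> V) s \<in> span_on (W \<inter> V) (?G (W \<inter> V))" if s: "s \<in> insert e E" for s
    proof (cases "s = e")
      case True
      then show ?thesis using small[OF V(1,3) _ _ eV] insert.prems by simp
    next
      case False
      then show ?thesis using small[OF W(1,3), of s] W(4) s insert.prems by auto
    qed
    then show ?case using O W V by blast
  qed
  then obtain W where W: "openin (top_of X) W" "p \<in> W" "W \<subseteq> U"
    and e: "\<forall>e\<in>E. sec_res M U W e \<in> span_on W (?G W)" by blast
  have "spans W (?G W)"
    using spans_res[OF U(1) W(1,3) E(1,3)] e
    by (intro spans_trans[OF W(1) _ global_res_closed[OF W(1) subset_refl], of "sec_res M U W ` E"]) auto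
  then show ?thesis using W by blast
qed

lemma corank_le_rank:
  assumes "vector_bundle X M n" "p \<in> points X"
  shows "corank_le {} p n"
  using local_basis[OF assms] unfolding corank_le_def by simp

definition degeneracy :: "'m set \<Rightarrow> nat \<Rightarrow> 'a set" where
  "degeneracy T i = {p \<in> points X. \<not> corank_le T p i}"

lemma degeneracy_closed: "closedin (top_of X) (degeneracy T i)"
proof -
  have "degeneracy T i = points X - {p \<in> points X. corank_le T p i}" unfolding degeneracy_def by blast
  then show ?thesis using corank_open by auto
qed

lemma degeneracy_rank:
  assumes "vector_bundle X M n" "n \<le> i" "T \<subseteq> S (points X)"
  shows "degeneracy T i = {}"
  using corank_mono[OF empty_subsetI assms(3) corank_le_leq[OF corank_le_rank[OF assms(1)] assms(2)]]
  unfolding degeneracy_def by blast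

text \<open>
  Each further section raises the bound on the codimension of every degeneracy locus by one, as soon as \<open>m + i \<ge> n\<close>;
  before, the truncated subtraction makes the claim trivial. The induction on \<open>m\<close> treats all \<open>i\<close> together,
  since a part of the \<open>i\<close>-th locus that lies in the next one is handled by the hypothesis for \<open>i + 1\<close>.
\<close>
theorem generic_sections:
  assumes noeth: "noetherian_topology (top_of X)" and lr: "locally_ringed X"
    and k: "field k" "infinite (carrier k)" and \<phi>: "\<phi> \<in> ring_hom k (fun_ring X (points X))"
    and vb: "vector_bundle X M n" and gg: "globally_generated X M"
  shows "\<exists>t. t \<in> {..<m} \<rightarrow> S (points X) \<and>
    (\<forall>i X' Y. X' \<in> irreducible_components (top_of X) (points X) \<longrightarrow> closedin (top_of X) Y \<longrightarrow>
       irreducible_in (top_of X) Y \<longrightarrow> Y \<subseteq> degeneracy (t ` {..<m}) i \<inter> X' \<longrightarrow>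
       chain_from (top_of X) X' Y (m + i + 1 - n))"
proof (induction m)
  case 0
  have "chain_from (top_of X) X' Y (0 + i + 1 - n)"
    if Y: "closedin (top_of X) Y" "irreducible_in (top_of X) Y" "Y \<subseteq> degeneracy {} i \<inter> X'" for i X' Y
  proof (cases "n \<le> i")
    case True
    then have "Y = {}" using degeneracy_rank[OF vb True, of "{}"] Y(3) by blast
    then show ?thesis using Y(2) unfolding irreducible_in_def by blast
  next
    case False
    then show ?thesis using chain_from_0[of "top_of X" Y X'] Y by simp
  qed
  then show ?case by simp
next
  case (Suc m)
  then obtain t where t: "t \<in> {..<m} \<rightarrow> S (points X)"
    and IH: "\<And>i X' Y. X' \<in> irreducible_components (top_of X) (points X) \<Longrightarrow> closedin (top_of X) Y \<Longrightarrow>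
       irreducible_in (top_of X) Y \<Longrightarrow> Y \<subseteq> degeneracy (t ` {..<m}) i \<inter> X' \<Longrightarrow>
       chain_from (top_of X) X' Y (m + i + 1 - n)" by metis
  let ?I = "irreducible_components (top_of X) (points X)"
  define T where "T = t ` {..<m}"
  have T: "T \<subseteq> S (points X)" using t unfolding T_def by auto
  have Icl: "closedin (top_of X) X'" if "X' \<in> ?I" for X'
    using that by (rule irreducible_component_closed[OF closedin_topspace])
  let ?decomp = "\<lambda>i X' F. finite F \<and> (\<forall>Y\<in>F. closedin (top_of X) Y \<and> irreducible_in (top_of X) Y) \<and>
      \<Union>F = degeneracy T i \<inter> X'"
  define F where "F i X' = (SOME F. ?decomp i X' F)" for i X'
  have decomp: "?decomp i X' (F i X')" if "X' \<in> ?I" for i X'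
    unfolding F_def
    by (rule someI_ex)
      (rule noetherian_irreducible_decomposition[OF noeth closedin_Int[OF degeneracy_closed Icl[OF that]]])
  have F: "finite (F i X')" "\<And>Y. Y \<in> F i X' \<Longrightarrow> closedin (top_of X) Y \<and> irreducible_in (top_of X) Y"
    "\<Union>(F i X') = degeneracy T i \<inter> X'" if "X' \<in> ?I" for i X'
    using decomp[OF that] by blast+
  (* the pairs (i, A), with A a piece of the i-th locus, at which the corank has to be lowered *)
  define Q where "Q = (SIGMA i:{..<n}. \<Union>X'\<in>?I. {A \<in> F i X'. \<not> A \<subseteq> degeneracy T (Suc i)})"
  have "finite Q"
    unfolding Q_def using finite_irreducible_components[OF noeth] F(1) by (intro finite_SigmaI) auto
  have "\<exists>B. submodule B (fun_ring X (points X)) (sec M (points X)) \<and> B \<noteq> S (points X) \<and>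
      (\<forall>x\<in>S (points X) - B. \<exists>p\<in>A. corank_le (insert x T) p i)" if q: "(i, A) \<in> Q" for i A
  proof -
    obtain X' where X': "X' \<in> ?I" "A \<in> F i X'" "\<not> A \<subseteq> degeneracy T (Suc i)"
      using q unfolding Q_def by blast
    then obtain p where p: "p \<in> A" "p \<notin> degeneracy T (Suc i)" by blast
    have "p \<in> degeneracy T i" using p(1) X' F(3) by blast
    then have "p \<in> points X" "\<not> corank_le T p i" "corank_le T p (Suc i)"
      using p(2) unfolding degeneracy_def by auto
    then show ?thesis
      using generic_section[OF lr T _ _ globally_generated_spans[OF vb gg]] p(1) by meson
  qed
  then have "\<forall>q\<in>Q. \<exists>B. submodule B (fun_ring X (points X)) (sec M (points X)) \<and> B \<noteq> S (points X) \<and>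
      (\<forall>x\<in>S (points X) - B. \<exists>p\<in>snd q. corank_le (insert x T) p (fst q))" by auto
  then obtain B where B: "\<forall>q\<in>Q. submodule (B q) (fun_ring X (points X)) (sec M (points X)) \<and>
      B q \<noteq> S (points X) \<and> (\<forall>x\<in>S (points X) - B q. \<exists>p\<in>snd q. corank_le (insert x T) p (fst q))"
    by (rule bchoice[THEN exE])
  interpret P: span_module "fun_ring X (points X)" "sec M (points X)"
    by (rule module_sec[OF openin_topspace])
  obtain x where x: "x \<in> S (points X)" and avoid: "\<forall>C\<in>B ` Q. x \<notin> C"
    using P.avoid_submodules[OF k \<phi> finite_imageI[OF \<open>finite Q\<close>, of B]] B by blast
  have drop: "\<exists>p\<in>A. corank_le (insert x T) p i" if "(i, A) \<in> Q" for i A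
    using bspec[OF B that] x avoid that by auto
  let ?t = "t(m := x)"
  have tT: "?t ` {..<Suc m} = insert x T"
    unfolding T_def by (auto simp: lessThan_Suc)
  have xT: "insert x T \<subseteq> S (points X)" using x T by blast
  have "chain_from (top_of X) X' Y (Suc m + i + 1 - n)"
    if X': "X' \<in> ?I" and Y: "closedin (top_of X) Y" "irreducible_in (top_of X) Y"
      "Y \<subseteq> degeneracy (insert x T) i \<inter> X'" for i X' Y
  proof -
    have Yne: "Y \<noteq> {}" using Y(2) unfolding irreducible_in_def by simp
    (* for larger i the locus is empty, so finitely many i suffice *)
    have i: "i < n"
    proof (rule ccontr)
      assume "\<not> i < n"
      then have "degeneracy (insert x T) i = {}" using degeneracy_rank[OF vb _ xT] by simp
      then show False using Y(3) Yne by simp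
    qed
    have "degeneracy (insert x T) i \<subseteq> degeneracy T i"
      unfolding degeneracy_def using corank_mono[OF subset_insertI xT] by blast
    then have "Y \<subseteq> \<Union>(F i X')" using Y(3) F(3)[OF X'] by blast
    then obtain A where A: "A \<in> F i X'" "Y \<subseteq> A"
      using irreducible_in_finite_Union[OF Y(2) F(1)[OF X']] F(2)[OF X'] by blast
    have Acl: "closedin (top_of X) A" "irreducible_in (top_of X) A" using F(2)[OF X' A(1)] by auto
    have AX': "A \<subseteq> degeneracy T i \<inter> X'" using F(3)[OF X'] A(1) by blast
    show ?thesis
    proof (cases "A \<subseteq> degeneracy T (Suc i)")
      case True
      then have "Y \<subseteq> degeneracy T (Suc i) \<inter> X'" using A AX' by blast
      then show ?thesis using IH[OF X' Y(1,2), of "Suc i"] unfolding T_def by simp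
    next
      case False
      then have "(i, A) \<in> Q" using i X' A(1) unfolding Q_def by blast
      then obtain p where p: "p \<in> A" "corank_le (insert x T) p i" using drop by blast
      then have "p \<notin> Y" using Y(3) unfolding degeneracy_def by blast
      then have "Y \<subset> A" using A p by blast
      moreover have "chain_from (top_of X) X' A (m + i + 1 - n)"
        using IH[OF X' Acl] AX' unfolding T_def by blast
      ultimately have "chain_from (top_of X) X' Y (Suc (m + i + 1 - n))"
        using chain_from_Suc Y(1,2) by blast
      then show ?thesis by (rule chain_from_le) simp
    qed
  qed
  moreover have "?t \<in> {..<Suc m} \<rightarrow> S (points X)" using t x by (auto simp: Pi_iff less_Suc_eq)
  ultimately show ?case unfolding tT[symmetric] by (intro exI[of _ ?t]) blast
qed

lemma generated_where_corank_zero: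
  assumes U: "openin (top_of X) U" and t: "t \<in> {..<m} \<rightarrow> S (points X)"
    and corank: "\<And>p. p \<in> U \<Longrightarrow> corank_le (t ` {..<m}) p 0"
  shows "generated_by_n_sections (open_subspace X U) M m"
proof -
  have UP: "U \<subseteq> points X" using U by (rule openin_subset)
  have pts: "points (open_subspace X U) = U" using UP unfolding open_subspace_def by auto
  have opU: "openin (top_of (open_subspace X U)) W \<longleftrightarrow> openin (top_of X) W \<and> W \<subseteq> U" for W
    using openin_open_subtopology[OF U] unfolding open_subspace_def by simp
  let ?t = "\<lambda>i. sec_res M (points X) U (t i)"
  have tS: "t i \<in> S (points X)" if "i < m" for i using t that by auto
  have tU: "?t \<in> {..<m} \<rightarrow> S U" using tS sres_closed[OF openin_topspace U UP] by auto
  have "sheaf_surjective (open_subspace X U) (free_sheaf (open_subspace X U) m) M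
      (sections_map (open_subspace X U) M m ?t)"
    unfolding sheaf_surjective_def
  proof (intro allI impI)
    fix U' s x assume "openin (top_of (open_subspace X U)) U' \<and> s \<in> S U' \<and> x \<in> U'"
    then have U': "openin (top_of X) U'" "U' \<subseteq> U" and s: "s \<in> S U'" and x: "x \<in> U'" using opU by auto
    have "x \<in> U" using x U' by blast
    then obtain W where W: "openin (top_of X) W" "x \<in> W" and sp: "spans W (sec_res M (points X) W ` t ` {..<m})"
      using corank[of x] unfolding corank_le_def by auto
    define V where "V = U' \<inter> W"
    have V: "openin (top_of X) V" "V \<subseteq> U'" "V \<subseteq> W" "V \<subseteq> U" "x \<in> V"
      using U' W x unfolding V_def by auto
    interpret V: span_module "fun_ring X V" "sec M V" by (rule module_sec[OF V(1)])
    have tP: "t ` {..<m} \<subseteq> S (points X)" using t by auto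
    let ?tV = "\<lambda>i. sec_res M (points X) V (t i)"
    have tV: "?tV \<in> {..<m} \<rightarrow> S V"
      using tS sres_closed[OF openin_topspace V(1) order_trans[OF V(4) UP]] by auto
    have "S V \<subseteq> span_on V (sec_res M W V ` sec_res M (points X) W ` t ` {..<m})"
      using sp V unfolding spans_def by simp
    moreover have "sec_res M W V ` sec_res M (points X) W ` t ` {..<m} = ?tV ` {..<m}"
      unfolding global_res_res[OF W(1) V(1,3) tP] by (rule image_image)
    ultimately have "S V \<subseteq> span_on V (?tV ` {..<m})" by simp
    then have "sec_res M U' V s \<in> span_on V (?tV ` {..<m})"
      using sres_closed[OF U'(1) V(1,2) s] by (rule subsetD)
    then obtain a where a: "a \<in> {..<m} \<rightarrow>\<^sub>E carrier (fun_ring X V)"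
      and eq: "sec_res M U' V s = (\<Oplus>\<^bsub>sec M V\<^esub>i\<in>{..<m}. a i \<odot>\<^bsub>sec M V\<^esub> ?tV i)"
      using V.span_lessThan[OF tV] by blast
    have smap: "sections_map (open_subspace X U) M m ?t V a = (\<Oplus>\<^bsub>sec M V\<^esub>i\<in>{..<m}. a i \<odot>\<^bsub>sec M V\<^esub> ?tV i)"
      unfolding sections_map_def pts
    proof (rule V.M.finsum_cong')
      show "(\<lambda>i. a i \<odot>\<^bsub>sec M V\<^esub> ?tV i) \<in> {..<m} \<rightarrow> S V"
        using a tV by (auto simp: PiE_iff Pi_iff)
      fix i assume "i \<in> {..<m}"
      then show "a i \<odot>\<^bsub>sec M V\<^esub> sec_res M U V (?t i) = a i \<odot>\<^bsub>sec M V\<^esub> ?tV i"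
        using sres_sres[OF openin_topspace U V(1,4) UP tS[of i]] by simp
    qed simp
    have "a \<in> carrier (sec (free_sheaf (open_subspace X U) m) V)"
      using a unfolding free_sheaf_def free_module_def open_subspace_def by simp
    then have "sec_res M U' V s \<in>
        sections_map (open_subspace X U) M m ?t V ` carrier (sec (free_sheaf (open_subspace X U) m) V)"
      unfolding trans[OF eq smap[symmetric]] by (rule imageI)
    then show "\<exists>V. openin (top_of (open_subspace X U)) V \<and> x \<in> V \<and> V \<subseteq> U' \<and> sec_res M U' V s \<in>
        sections_map (open_subspace X U) M m ?t V ` carrier (sec (free_sheaf (open_subspace X U) m) V)"
      using V opU by (intro exI[of _ V]) simp
  qed
  then show ?thesis
    using tU unfolding generated_by_n_sections_def sections_generate_def pts by (intro exI[of _ ?t]) simp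
qed

end

section \<open>Generation outside a closed set of large codimension\<close>

lemma open_subspace_points: "open_subspace X (points X) = X"
  unfolding open_subspace_def by (simp add: subtopology_topspace)

theorem theorem7p7:
  fixes k :: "'k ring"
    and X :: "('a, 'r) ringed"
    and \<phi> :: "'k \<Rightarrow> 'r"
    and V :: "('a, 'r, 'm) sheaf_mod"
    and d n :: nat
  assumes "field k" and "infinite (carrier k)"
    and "finite_type_scheme k X \<phi>"
    and "vector_bundle X V n"
    and "globally_generated X V"
  shows "(\<exists>U. openin (top_of X) U \<and> codim (points X - U) (top_of X) > enat d \<and>
            generated_by_n_sections (open_subspace X U) V (n + d)) \<and>
         (krull_dim (top_of X) = ereal (real d) \<longrightarrow> generated_by_n_sections X V (n + d))"
proof -
  have sch: "is_scheme X" and \<phi>: "\<phi> \<in> ring_hom k (fun_ring X (points X))"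
    using assms(3) unfolding finite_type_scheme_def scheme_over_def by auto
  have ringed: "ringed_space X" using sch unfolding is_scheme_def by simp
  have sheaf: "module_sheaf X V" using assms(4) unfolding vector_bundle_def by simp
  interpret module_sheaf_on X V
    using ringed sheaf by (intro module_sheaf_on.intro ringed_space_on.intro module_sheaf_on_axioms.intro)
  have noeth: "noetherian_topology (top_of X)" by (rule finite_type_noetherian[OF assms(1,3)])
  obtain t where t: "t \<in> {..<n + d} \<rightarrow> S (points X)"
    and chains: "\<forall>i X' Y. X' \<in> irreducible_components (top_of X) (points X) \<longrightarrow> closedin (top_of X) Y \<longrightarrow>
       irreducible_in (top_of X) Y \<longrightarrow> Y \<subseteq> degeneracy (t ` {..<n + d}) i \<inter> X' \<longrightarrow>
       chain_from (top_of X) X' Y (n + d + i + 1 - n)"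
    using generic_sections[OF noeth scheme_locally_ringed[OF sch] assms(1,2) \<phi> assms(4,5), of "n + d"]
    by (elim exE conjE)
  let ?Z = "degeneracy (t ` {..<n + d}) 0"
  have chain: "chain_from (top_of X) X' Y (Suc d)"
    if "X' \<in> irreducible_components (top_of X) (points X)" "closedin (top_of X) Y"
      "irreducible_in (top_of X) Y" "Y \<subseteq> ?Z \<inter> X'" for X' Y
    using chains[rule_format, OF that] by simp
  define U where "U = {p \<in> points X. corank_le (t ` {..<n + d}) p 0}"
  have U: "openin (top_of X) U" unfolding U_def by (rule corank_open)
  have Z: "points X - U = ?Z" unfolding U_def degeneracy_def by blast
  have gen: "generated_by_n_sections (open_subspace X U) V (n + d)"
    using generated_where_corank_zero[OF U t] unfolding U_def by blast
  have "codim (points X - U) (top_of X) > enat d"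
    unfolding Z by (rule codim_gt[OF degeneracy_closed chain])
  moreover have "generated_by_n_sections X V (n + d)" if dim: "krull_dim (top_of X) = ereal (real d)"
  proof -
    have "?Z = {}"
    proof (rule ccontr)
      assume "?Z \<noteq> {}"
      then obtain p where p: "p \<in> ?Z" by blast
      then have "p \<in> points X" unfolding degeneracy_def by blast
      then obtain X' where X': "X' \<in> irreducible_components (top_of X) (points X)" "p \<in> X'"
        using in_irreducible_component[OF noeth] by blast
      have "closedin (top_of X) (?Z \<inter> X')"
        using degeneracy_closed irreducible_component_closed[OF closedin_topspace X'(1)] by (rule closedin_Int)
      from noetherian_irreducible_decomposition[OF noeth this]
      obtain F where F: "\<forall>Y\<in>F. closedin (top_of X) Y \<and> irreducible_in (top_of X) Y" "\<Union>F = ?Z \<inter> X'"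
        by (elim exE conjE)
      have "p \<in> \<Union>F" unfolding F(2) using p X'(2) by (rule IntI)
      then obtain Y where Y: "Y \<in> F" by (elim UnionE)
      then have "Y \<subseteq> ?Z \<inter> X'" using F(2) by (metis Union_upper)
      then have "chain_from (top_of X) X' Y (Suc d)" using bspec[OF F(1) Y] by (intro chain[OF X'(1)]) simp_all
      from krull_dim_ge[OF this] show False unfolding dim by simp
    qed
    then have "U = points X" using Z openin_subset[OF U] by blast
    then show ?thesis using gen open_subspace_points[of X] by simp
  qed
  ultimately show ?thesis using U gen by blast
qed

end
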